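(* Let $0<s<1<p<q$ be such that $sp<n$ and $q<p^*_s$. Let $0\le h\in L^1_{loc}(\mathbb{R}^n)$ be such that the immersion $\mathcal{D}^{s,p}(\mathbb{R}^n)\subset L^q(h\,dx;\mathbb{R}^n)$ is compact. Let $K\in L^\infty(\mathbb{R}^n)$, $K\ge0$, be such that the limit $K(\infty):=\lim_{|x|\to\infty}K(x)$ exists. Then there exists $\lambda_0>0$ such that the equation $$(-\Delta_p)^s u = \lambda h(x)|u|^{q-2}u + K(x)|u|^{p^*_s-2}u\qquad\text{in }\mathbb{R}^n$$ has a nontrivial solution for any $\lambda>\lambda_0$.
   Context: $[v]_{s,p}^p := \iint_{\mathbb{R}^n\times\mathbb{R}^n} \frac{|v(x)-v(y)|^p}{|x-y|^{n+sp}}\, dx\,dy$ and $p^*_s=\frac{np}{n-sp}$. $\mathcal{D}^{s,p}(\mathbb{R}^n)$ is the closure of $C_c^\infty(\mathbb{R}^n)$ with respect to $[\cdot]_{s,p}$; equivalently $\{v\in L^{p^*_s}(\mathbb{R}^n): [v]_{s,p}<\infty\}$. $L^q(h\,dx;\mathbb{R}^n)$ is the $L^q$ space for the measure $h\,dx$; compactness of the immersion means that every bounded sequence in $\mathcal{D}^{s,p}(\mathbb{R}^n)$ has a subsequence converging strongly in $L^q(h\,dx;\mathbb{R}^n)$. The fractional $p$-Laplacian is $(-\Delta_p)^s u(x)=\mathrm{p.v.}\int_{\mathbb{R}^n}\frac{|u(x)-u(y)|^{p-2}(u(x)-u(y))}{|x-y|^{n+sp}}\,dy$. A solution is understood weakly,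 as a critical point $u\in\mathcal{D}^{s,p}(\mathbb{R}^n)$ of $\mathcal{F}_\lambda(u)=\frac1p[u]_{s,p}^p-\frac{\lambda}{q}\int_{\mathbb{R}^n} h|u|^q\,dx-\frac1{p^*_s}\int_{\mathbb{R}^n} K|u|^{p^*_s}\,dx$.
   Formalization: The weight h is additionally assumed not to vanish almost everywhere; for h = 0 and K = 0 all stated hypotheses hold, but the only critical point is u = 0, so the statement as written fails. *)

theory Defs
  imports "HOL-Analysis.Analysis"
begin

text \<open>Functions are everywhere defined representatives of classes modulo Lebesgue null sets.\<close>

definition Lp_space :: "'a measure \<Rightarrow> real \<Rightarrow> ('a \<Rightarrow> real) set" where
  "Lp_space M r = {f \<in> borel_measurable M. integrable M (\<lambda>x. \<bar>f x\<bar> powr r)}"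

definition Linf_space :: "'a measure \<Rightarrow> ('a \<Rightarrow> real) set" where
  "Linf_space M = {f \<in> borel_measurable M. \<exists>C. AE x in M. \<bar>f x\<bar> \<le> C}"

definition L1_loc :: "(real^'n \<Rightarrow> real) set" where
  "L1_loc = {f \<in> borel_measurable lebesgue. \<forall>S. compact S \<longrightarrow> set_integrable lebesgue S f}"

primrec C_times :: "nat \<Rightarrow> (real^'n \<Rightarrow> real) \<Rightarrow> bool" where
  "C_times 0 f \<longleftrightarrow> continuous_on UNIV f"
| "C_times (Suc k) f \<longleftrightarrow>
     (\<forall>x. f differentiable (at x)) \<and>
     (\<forall>i. C_times k (\<lambda>x. frechet_derivative f (at x) (axis i 1)))"

definition Cc_infty :: "(real^'n \<Rightarrow> real) set" where
  "Cc_infty = {f. (\<forall>k. C_times k f) \<and> compact (closure {x. f x \<noteq> 0})}"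

definition crit_exp :: "'n::finite itself \<Rightarrow> real \<Rightarrow> real \<Rightarrow> real" where
  "crit_exp _ s p = real CARD('n) * p / (real CARD('n) - s * p)"

text \<open>The \<open>p\<close>-th power \<open>[v]\<^sub>s\<^sub>,\<^sub>p\<^sup>p\<close>, possibly infinite. On the (null) diagonal the integrand is
  \<open>0 / 0 = 0\<close>.\<close>

definition gagliardo_pow :: "real \<Rightarrow> real \<Rightarrow> (real^'n \<Rightarrow> real) \<Rightarrow> ennreal" where
  "gagliardo_pow s p v =
     (\<integral>\<^sup>+ (x, y). ennreal (\<bar>v x - v y\<bar> powr p / norm (x - y) powr (real CARD('n) + s * p))
        \<partial>(lebesgue \<Otimes>\<^sub>M lebesgue))"

text \<open>Only meaningful when \<open>gagliardo_pow s p v < \<infinity>\<close>, as is the case on \<open>D_space s p\<close> below,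
  because \<open>enn2real \<infinity> = 0\<close>.\<close>

definition gagliardo :: "real \<Rightarrow> real \<Rightarrow> (real^'n \<Rightarrow> real) \<Rightarrow> real" where
  "gagliardo s p v = enn2real (gagliardo_pow s p v) powr (1 / p)"

text \<open>The closure of \<open>Cc_infty\<close> with respect to the Gagliardo seminorm. It is taken inside
  \<open>L\<^sup>r\<close> with \<open>r\<close> the critical exponent: the seminorm vanishes on constants, so without an ambient
  space the closure would only be determined up to additive constants.\<close>

definition D_space :: "real \<Rightarrow> real \<Rightarrow> (real^'n \<Rightarrow> real) set" where
  "D_space s p = {v \<in> Lp_space lebesgue (crit_exp TYPE('n) s p).
     \<exists>\<phi>. (\<forall>k. \<phi> k \<in> Cc_infty) \<and>
         (\<lambda>k::nat. gagliardo_pow s p (\<lambda>x. \<phi> k x - v x)) \<longlonglongrightarrow> 0}"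

definition compact_immersion ::
    "('a \<Rightarrow> real) set \<Rightarrow> (('a \<Rightarrow> real) \<Rightarrow> real) \<Rightarrow> 'a measure \<Rightarrow> real \<Rightarrow> bool" where
  "compact_immersion V N M q \<longleftrightarrow>
     V \<subseteq> Lp_space M q \<and>
     (\<forall>u :: nat \<Rightarrow> 'a \<Rightarrow> real. (\<forall>k. u k \<in> V) \<longrightarrow> (\<exists>C. \<forall>k. N (u k) \<le> C) \<longrightarrow>
        (\<exists>r w. strict_mono r \<and> w \<in> Lp_space M q \<and>
           (\<lambda>k. LINT x|M. \<bar>u (r k) x - w x\<bar> powr q) \<longlonglongrightarrow> 0))"

text \<open>The functional whose Euler--Lagrange equation is
  \<open>(-\<Delta>\<^sub>p)\<^sup>s u = \<lambda> h \<bar>u\<bar>\<^sup>q\<^sup>-\<^sup>2 u + K \<bar>u\<bar>\<^sup>r\<^sup>-\<^sup>2 u\<close>, with \<open>r\<close> the critical exponent.\<close>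

definition energy ::
    "real \<Rightarrow> real \<Rightarrow> real \<Rightarrow> (real^'n \<Rightarrow> real) \<Rightarrow> (real^'n \<Rightarrow> real) \<Rightarrow> real \<Rightarrow>
     (real^'n \<Rightarrow> real) \<Rightarrow> real" where
  "energy s p q h K lam u =
     gagliardo s p u powr p / p
     - lam / q * (LINT x|lebesgue. h x * \<bar>u x\<bar> powr q)
     - 1 / crit_exp TYPE('n) s p * (LINT x|lebesgue. K x * \<bar>u x\<bar> powr crit_exp TYPE('n) s p)"

text \<open>\<open>F\<close> is Frechet differentiable at \<open>u\<close> on the space \<open>V\<close> normed by \<open>N\<close>, with derivative \<open>0\<close>.\<close>

definition critical_point ::
    "('a \<Rightarrow> real) set \<Rightarrow> (('a \<Rightarrow> real) \<Rightarrow> real) \<Rightarrow> (('a \<Rightarrow> real) \<Rightarrow> real) \<Rightarrow> ('a \<Rightarrow> real) \<Rightarrow> bool" where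
  "critical_point V N F u \<longleftrightarrow>
     u \<in> V \<and>
     (\<forall>e>0. \<exists>d>0. \<forall>v\<in>V. N v < d \<longrightarrow> \<bar>F (\<lambda>x. u x + v x) - F u\<bar> \<le> e * N v)"

definition weak_solution ::
    "real \<Rightarrow> real \<Rightarrow> real \<Rightarrow> (real^'n \<Rightarrow> real) \<Rightarrow> (real^'n \<Rightarrow> real) \<Rightarrow> real \<Rightarrow>
     (real^'n \<Rightarrow> real) \<Rightarrow> bool" where
  "weak_solution s p q h K lam u \<longleftrightarrow>
     critical_point (D_space s p) (gagliardo s p) (energy s p q h K lam) u"

end

theory Submission
  imports Defs "HOL-Library.Diagonal_Subsequence"
begin

text \<open>Let \<open>r\<close> be the critical exponent and write \<open>A(u) = [u]\<^sup>p\<close>, \<open>B(u) = \<integral> h \<bar>u\<bar>\<^sup>q\<close>,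
  \<open>C(u) = \<integral> K \<bar>u\<bar>\<^sup>r\<close>. The solution is a minimiser of the energy on the Nehari set
  \<open>{u. B(u) > 0 \<and> A(u) = \<lambda> B(u) + C(u)}\<close>, where the energy is at least \<open>(1/p - 1/q) A\<close>. Moving
  a fixed function with \<open>B > 0\<close> along its ray shows that the infimum tends to \<open>0\<close> as \<open>\<lambda> \<rightarrow> \<infinity>\<close>, so for
  large \<open>\<lambda>\<close> a minimising sequence \<open>u\<^sub>k\<close> has \<open>A\<close> so small that Sobolev's inequality gives \<open>C \<le> A/2\<close>.
  Along a subsequence \<open>u\<^sub>k \<rightarrow> w\<close> almost everywhere and \<open>B(u\<^sub>k) \<rightarrow> B(w) > 0\<close>. By the Brezis--Lieb lemma
  \<open>A\<close> and \<open>C\<close> lose the masses \<open>lim A(u\<^sub>k - w)\<close> and \<open>lim C(u\<^sub>k - w)\<close>, and the second is at most the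
  first; hence \<open>A(w) \<le> \<lambda> B(w) + C(w)\<close>. So \<open>t w\<close> lies in the Nehari set for some \<open>t \<le> 1\<close>,
  and its energy does not exceed the infimum.\<close>

section \<open>Power inequalities\<close>

text \<open>The obstacle is the critical term: \<open>C\<close> has no compactness, so part of a
  minimising sequence may escape. A low level repairs this, since the escaping part inherits a value
  of \<open>A\<close> below the threshold \<open>a0\<close> under which \<open>C\<close> is at most
  \<open>A / 2\<close>; the level to undercut is (1/p - 1/q) a0, and a large \<lambda> buys it. No
  Lagrange multiplier is needed: the energy on the ray of a Nehari point is largest at that point,
  so the unknown parameter that returns a perturbed ray to the Nehari set does no harm. Two
  difficulties lie underneath. The compact immersion gives a limit only for the measure h dx, which
  says nothing where h vanishes, so almost everywhere convergence is extracted from the Gagliardo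
  bound itself. And \<open>D_space\<close> is a closure of test functions, so the limit belongs to
  it only after a strong approximation, made of midpoints instead of an appeal to reflexivity.
  Reading the seminorm as the L^p norm of the increments v(x) - v(y) on pairs lets the same lemmas
  on integrals of powers serve \<open>A\<close>, \<open>B\<close> and \<open>C\<close>.\<close>

lemma powr_add_le:
  fixes a b r :: real
  assumes "0 \<le> r"
  shows "\<bar>a + b\<bar> powr r \<le> 2 powr r * (\<bar>a\<bar> powr r + \<bar>b\<bar> powr r)"
proof -
  have "\<bar>a + b\<bar> powr r \<le> (2 * max \<bar>a\<bar> \<bar>b\<bar>) powr r"
    using assms by (intro powr_mono2) auto
  also have "\<dots> = 2 powr r * max \<bar>a\<bar> \<bar>b\<bar> powr r"
    by (simp add: powr_mult)
  also have "\<dots> \<le> 2 powr r * (\<bar>a\<bar> powr r + \<bar>b\<bar> powr r)"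
    by (intro mult_left_mono) (auto simp: max_def)
  finally show ?thesis .
qed

lemma young_weak:
  fixes x y r :: real
  assumes "1 \<le> r" "0 \<le> x" "0 \<le> y"
  shows "x powr (r - 1) * y \<le> x powr r + y powr r"
proof -
  have "x powr (r - 1) * y \<le> max x y powr (r - 1) * max x y powr 1"
    using assms by (intro mult_mono powr_mono2) auto
  also have "\<dots> = max x y powr r"
    by (subst powr_add[symmetric]) simp
  also have "\<dots> \<le> x powr r + y powr r" by (auto simp: max_def)
  finally show ?thesis .
qed

text \<open>Above the threshold \<open>t\<close> the factor \<open>(x / t) powr (r - 1)\<close> is
  at least 1. The free threshold later acts as the weight in Young's inequality and as the scale in
  the error of cube averages.\<close>

lemma abs_le_add_powr:
  fixes t x r :: real
  assumes "0 < t" "1 \<le> r" "0 \<le> x"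
  shows "x \<le> t + t powr (1 - r) * x powr r"
proof (cases "x \<le> t")
  case True
  then show ?thesis by (simp add: add_increasing2)
next
  case False
  have "x = x powr (1 - r) * x powr r"
    using False assms by (simp flip: powr_add)
  also have "\<dots> \<le> t powr (1 - r) * x powr r"
    using False assms by (intro mult_right_mono powr_mono2') auto
  finally show ?thesis using assms by linarith
qed

text \<open>Homogeneity reduces everything to \<open>a = 1\<close> and \<open>t = b / a\<close>.
  Differentiability of \<open>(1 + t) powr r\<close> at 0 gives the \<open>e\<close> term for small
  \<open>t\<close>; away from 0 every term is a bounded multiple of
  \<open>\<bar>t\<bar> powr r\<close>.\<close>

lemma abs_powr_first_order:
  fixes r e :: real
  assumes r: "1 < r" and e: "0 < e"
  obtains C where "0 \<le> C"
    "\<And>a b. \<bar>\<bar>a + b\<bar> powr r - \<bar>a\<bar> powr r - r * sgn a * \<bar>a\<bar> powr (r - 1) * b\<bar>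
        \<le> e * (\<bar>a\<bar> powr (r - 1) * \<bar>b\<bar>) + C * \<bar>b\<bar> powr r"
proof -
  have "((\<lambda>t::real. (1 + t) powr r) has_real_derivative r * (1 + 0) powr (r - 1)) (at 0)"
    by (auto intro!: derivative_eq_intros)
  then have "((\<lambda>t::real. ((1 + t) powr r - 1) / t) \<longlongrightarrow> r) (at 0)"
    by (simp add: has_field_derivative_iff)
  then have "\<forall>\<^sub>F t in at (0::real). dist (((1 + t) powr r - 1) / t) r < e"
    using e by (auto simp: tendsto_iff)
  then obtain d0 where d0: "d0 > 0" "\<And>t. t \<noteq> 0 \<Longrightarrow> \<bar>t\<bar> < d0 \<Longrightarrow> \<bar>((1 + t) powr r - 1) / t - r\<bar> < e"
    unfolding eventually_at by (auto simp: dist_real_def)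
  define d where "d = min d0 1"
  have d: "d > 0" using d0 by (simp add: d_def)
  have dd: "\<bar>\<bar>1 + t\<bar> powr r - 1 - r * t\<bar> \<le> e * \<bar>t\<bar>" if "\<bar>t\<bar> < d" for t
  proof (cases "t = 0")
    case False
    have "\<bar>\<bar>1 + t\<bar> powr r - 1 - r * t\<bar> = \<bar>((1 + t) powr r - 1) / t - r\<bar> * \<bar>t\<bar>"
    proof -
      have "\<bar>1 + t\<bar> = 1 + t" using that unfolding d_def by auto
      then show ?thesis using False by (simp flip: abs_mult add: field_simps)
    qed
    also have "\<dots> \<le> e * \<bar>t\<bar>" using d0(2)[of t] False that unfolding d_def
      by (intro mult_right_mono) auto
    finally show ?thesis .
  qed simp
  \<comment> \<open>For \<bar>t\<bar> \<ge> d the summands pay in turn for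
    \<open>\<bar>1 + t\<bar> powr r\<close>, for the constant 1 and for the linear term. The last 1
    gives \<open>C \<ge> 1\<close>, which settles \<open>a = 0\<close>.\<close>
  define C where "C = 2 powr r * (1 + d powr (- r)) + d powr (- r) + r * d powr (1 - r) + 1"
  have Cge: "C \<ge> 1" using r by (simp add: C_def)
  have 1: "\<bar>\<bar>1 + t\<bar> powr r - 1 - r * t\<bar> \<le> e * \<bar>t\<bar> + C * \<bar>t\<bar> powr r" for t
  proof (cases "\<bar>t\<bar> < d")
    case True
    then show ?thesis using Cge dd[of t] by (simp add: add_increasing2)
  next
    case False
    have "d powr r \<le> \<bar>t\<bar> powr r" using False d r by (intro powr_mono2) auto
    then have t1: "1 \<le> d powr (- r) * \<bar>t\<bar> powr r"
      using d by (simp add: powr_minus field_simps)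
    have "\<bar>t\<bar> = \<bar>t\<bar> powr (1 - r) * \<bar>t\<bar> powr r" using False d by (simp flip: powr_add)
    also have "\<dots> \<le> d powr (1 - r) * \<bar>t\<bar> powr r"
      using False d r by (intro mult_right_mono powr_mono2') auto
    finally have t2: "\<bar>t\<bar> \<le> d powr (1 - r) * \<bar>t\<bar> powr r" .
    have t3: "2 powr r * (1 + \<bar>t\<bar> powr r) \<le> 2 powr r * (d powr (- r) * \<bar>t\<bar> powr r + \<bar>t\<bar> powr r)"
      using t1 by (intro mult_left_mono) auto
    have t2: "r * \<bar>t\<bar> \<le> r * (d powr (1 - r) * \<bar>t\<bar> powr r)"
      using r t2 by (intro mult_left_mono) auto
    have "\<bar>\<bar>1 + t\<bar> powr r - 1 - r * t\<bar> \<le> \<bar>1 + t\<bar> powr r + 1 + r * \<bar>t\<bar>"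
      using powr_ge_zero[of "\<bar>1 + t\<bar>" r] abs_mult[of r t] r by linarith
    also have "\<dots> \<le> 2 powr r * (1 + \<bar>t\<bar> powr r) + 1 + r * \<bar>t\<bar>"
      using powr_add_le[of r 1 t] r by simp
    also have "\<dots> \<le> 2 powr r * (d powr (- r) * \<bar>t\<bar> powr r + \<bar>t\<bar> powr r) + d powr (- r) * \<bar>t\<bar> powr r
        + r * (d powr (1 - r) * \<bar>t\<bar> powr r)"
      using t1 t2 t3 by linarith
    also have "\<dots> \<le> C * \<bar>t\<bar> powr r" unfolding C_def by (simp add: algebra_simps)
    finally show ?thesis using e by (simp add: add_increasing)
  qed
  have 2: "\<bar>\<bar>a + b\<bar> powr r - \<bar>a\<bar> powr r - r * sgn a * \<bar>a\<bar> powr (r - 1) * b\<bar>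
        \<le> e * (\<bar>a\<bar> powr (r - 1) * \<bar>b\<bar>) + C * \<bar>b\<bar> powr r" for a b
  proof (cases "a = 0")
    case True
    have "1 * \<bar>b\<bar> powr r \<le> C * \<bar>b\<bar> powr r" using Cge by (intro mult_right_mono) auto
    then show ?thesis using True by simp
  next
    case False
    have ab: "\<bar>a + b\<bar> = \<bar>a\<bar> * \<bar>1 + b / a\<bar>" "\<bar>b\<bar> = \<bar>a\<bar> * \<bar>b / a\<bar>"
      using False by (simp_all flip: abs_mult add: field_simps)
    have pm: "\<bar>a\<bar> powr r = \<bar>a\<bar> powr (r - 1) * \<bar>a\<bar>"
      using powr_add[of "\<bar>a\<bar>" "r - 1" 1] by simp
    have "\<bar>a + b\<bar> powr r - \<bar>a\<bar> powr r - r * sgn a * \<bar>a\<bar> powr (r - 1) * b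
        = \<bar>a\<bar> powr r * (\<bar>1 + b / a\<bar> powr r - 1 - r * (b / a))"
    proof -
      have "sgn a * b = \<bar>a\<bar> * (b / a)" using False by (simp add: sgn_if)
      then have "r * sgn a * \<bar>a\<bar> powr (r - 1) * b = \<bar>a\<bar> powr (r-1) * \<bar>a\<bar> * (r * (b / a))"
        by (metis (no_types, opaque_lifting) mult.assoc mult.commute)
      then show ?thesis unfolding ab(1) by (simp add: powr_mult algebra_simps pm)
    qed
    then have "\<bar>\<bar>a + b\<bar> powr r - \<bar>a\<bar> powr r - r * sgn a * \<bar>a\<bar> powr (r - 1) * b\<bar>
        = \<bar>a\<bar> powr r * \<bar>\<bar>1 + b / a\<bar> powr r - 1 - r * (b / a)\<bar>" by (simp add: abs_mult)
    also have "\<dots> \<le> \<bar>a\<bar> powr r * (e * \<bar>b / a\<bar> + C * \<bar>b / a\<bar> powr r)"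
      by (intro mult_left_mono 1) auto
    also have "\<dots> = e * (\<bar>a\<bar> powr (r - 1) * (\<bar>a\<bar> * \<bar>b / a\<bar>)) + C * (\<bar>a\<bar> powr r * \<bar>b / a\<bar> powr r)"
      using pm by (simp add: algebra_simps)
    also have "\<dots> = e * (\<bar>a\<bar> powr (r - 1) * \<bar>b\<bar>) + C * \<bar>b\<bar> powr r"
      using ab(2) powr_mult[of "\<bar>a\<bar>" "\<bar>b/a\<bar>" r] by simp
    finally show ?thesis .
  qed
  show ?thesis using that[of C] 2 Cge by simp
qed

text \<open>The pointwise inequality behind the Brezis-Lieb lemma: Young's inequality splits the
  linear term of the first-order estimate into a small multiple of
  \<open>\<bar>a\<bar> powr r\<close> and a large one of
  \<open>\<bar>b\<bar> powr r\<close>.\<close>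

lemma abs_powr_add_diff_small:
  fixes r e :: real
  assumes r: "1 < r" and e: "0 < e"
  obtains C where "0 \<le> C" "\<And>a b. \<bar>\<bar>a + b\<bar> powr r - \<bar>a\<bar> powr r\<bar> \<le> e * \<bar>a\<bar> powr r + C * \<bar>b\<bar> powr r"
proof -
  obtain C where C: "0 \<le> C"
    "\<And>a b. \<bar>\<bar>a + b\<bar> powr r - \<bar>a\<bar> powr r - r * sgn a * \<bar>a\<bar> powr (r - 1) * b\<bar>
        \<le> 1 * (\<bar>a\<bar> powr (r - 1) * \<bar>b\<bar>) + C * \<bar>b\<bar> powr r"
    using abs_powr_first_order[OF r, of 1] by auto
  define t where "t = e / (r + 1)"
  have t: "0 < t" "(r + 1) * t = e" using r e by (auto simp: t_def)
  define C' where "C' = (r + 1) * t powr (1 - r) + C"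
  have "\<bar>\<bar>a + b\<bar> powr r - \<bar>a\<bar> powr r\<bar> \<le> e * \<bar>a\<bar> powr r + C' * \<bar>b\<bar> powr r" for a b
  proof -
    have y: "\<bar>a\<bar> powr (r - 1) * \<bar>b\<bar> \<le> t * \<bar>a\<bar> powr r + t powr (1 - r) * \<bar>b\<bar> powr r"
    proof (cases "a = 0")
      case False
      \<comment> \<open>The threshold for \<open>\<bar>b\<bar>\<close> is
        \<open>t * \<bar>a\<bar>\<close>, so that the powers of \<open>\<bar>a\<bar>\<close> cancel
        in the second term.\<close>
      have "\<bar>a\<bar> powr (r - 1) * \<bar>b\<bar> \<le> \<bar>a\<bar> powr (r - 1) * (t * \<bar>a\<bar> + (t * \<bar>a\<bar>) powr (1 - r) * \<bar>b\<bar> powr r)"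
        using t r False by (intro mult_left_mono abs_le_add_powr) auto
      also have "\<dots> = t * (\<bar>a\<bar> powr (r - 1) * \<bar>a\<bar>) + t powr (1 - r) * (\<bar>a\<bar> powr (r - 1) * \<bar>a\<bar> powr (1 - r)) * \<bar>b\<bar> powr r"
        by (simp add: powr_mult algebra_simps)
      also have "\<bar>a\<bar> powr (r - 1) * \<bar>a\<bar> = \<bar>a\<bar> powr r" using powr_add[of "\<bar>a\<bar>" "r - 1" 1] by simp
      also have "\<bar>a\<bar> powr (r - 1) * \<bar>a\<bar> powr (1 - r) = 1" using False by (simp flip: powr_add)
      finally show ?thesis by simp
    qed simp
    have "\<bar>r * sgn a * \<bar>a\<bar> powr (r - 1) * b\<bar> \<le> r * (\<bar>a\<bar> powr (r - 1) * \<bar>b\<bar>)"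
      using r by (simp add: abs_mult sgn_if)
    then have "\<bar>\<bar>a + b\<bar> powr r - \<bar>a\<bar> powr r\<bar> \<le> (r + 1) * (\<bar>a\<bar> powr (r - 1) * \<bar>b\<bar>) + C * \<bar>b\<bar> powr r"
      using C(2)[of a b] unfolding distrib_right by linarith
    also have "\<dots> \<le> (r + 1) * (t * \<bar>a\<bar> powr r + t powr (1 - r) * \<bar>b\<bar> powr r) + C * \<bar>b\<bar> powr r"
      using y r by (intro add_right_mono mult_left_mono) auto
    also have "\<dots> = (r + 1) * t * \<bar>a\<bar> powr r + C' * \<bar>b\<bar> powr r"
      by (simp add: C'_def algebra_simps)
    finally show ?thesis unfolding t(2) .
  qed
  moreover have "0 \<le> C'" using C(1) r by (simp add: C'_def)
  ultimately show ?thesis using that by blast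
qed

text \<open>Strict Bernoulli inequality: \<open>z powr r - r * z\<close> strictly decreases up to
  \<open>z = 1\<close> and strictly increases afterwards.\<close>

lemma powr_gt_tangent:
  fixes r x :: real
  assumes r: "1 < r" and x: "0 \<le> x" "x \<noteq> 1"
  shows "1 + r * (x - 1) < x powr r"
proof -
  have der: "DERIV (\<lambda>x. x powr r - r * x) z :> r * z powr (r - 1) - r" if "z > 0" for z
    using that by (auto intro!: derivative_eq_intros)
  have cont: "continuous_on {u..v} (\<lambda>x. x powr r - r * x)" if "0 \<le> u" for u v
    using r that by (intro continuous_intros continuous_on_powr') auto
  consider "x > 1" | "x < 1" using x by linarith
  then have "1 powr r - r * 1 < x powr r - r * x"
  proof cases
    case 1
    show ?thesis
    proof (rule DERIV_pos_imp_increasing_open[OF 1 _ cont])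
      fix z :: real assume z: "1 < z" "z < x"
      have "1 < z powr (r - 1)" using r z by (intro gr_one_powr) auto
      then show "\<exists>y. DERIV (\<lambda>x. x powr r - r * x) z :> y \<and> 0 < y"
        using der[of z] z r by auto
    qed simp
  next
    case 2
    show ?thesis
    proof (rule DERIV_neg_imp_decreasing_open[OF 2 _ cont])
      fix z :: real assume z: "x < z" "z < 1"
      have "z powr (r - 1) < 1 powr (r - 1)" using r z x by (intro powr_less_mono2) auto
      then show "\<exists>y. DERIV (\<lambda>x. x powr r - r * x) z :> y \<and> y < 0"
        using der[of z] z r x by (intro exI[of _ "r * z powr (r - 1) - r"]) auto
    qed (use x in simp)
  qed
  then show ?thesis by (simp add: algebra_simps)
qed

lemma powr_midpoint_less:
  fixes r t :: real
  assumes r: "1 < r" and t: "\<bar>t\<bar> \<le> 1" "t \<noteq> 1"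
  shows "\<bar>(1 + t) / 2\<bar> powr r < (1 + \<bar>t\<bar> powr r) / 2"
proof (cases "t = -1")
  case True
  then show ?thesis using r by simp
next
  case False
  define s where "s = \<bar>t\<bar>"
  have s: "0 \<le> s" "s < 1" using t False by (auto simp: s_def abs_if)
  \<comment> \<open>Division by the mean \<open>m\<close> moves the points 1 and \<open>s\<close> to
    points with mean 1, so the linear terms of the two tangent inequalities cancel.\<close>
  define m where "m = (1 + s) / 2"
  have m: "m > 0" "1/m \<noteq> 1" "s / m \<noteq> 1" using s by (auto simp: m_def field_simps)
  have "\<bar>(1 + t) / 2\<bar> powr r \<le> m powr r"
    using r by (intro powr_mono2) (auto simp: m_def s_def)
  also have "m powr r < (1 + s powr r) / 2"
  proof -
    have "1 + r * (1 / m - 1) < (1/m) powr r" "1 + r * (s / m - 1) < (s/m) powr r"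
      using powr_gt_tangent[OF r] m s by auto
    moreover have "1 + s = 2 * m" by (simp add: m_def)
    then have "1 / m + s / m = 2" using m(1) by (simp flip: add_divide_distrib)
    then have "r * (1 / m - 1) + r * (s / m - 1) = 0"
      by (metis add_diff_add diff_self distrib_left mult_zero_right one_add_one)
    ultimately have "2 < (1/m) powr r + (s/m) powr r" by linarith
    then have "2 < (1 + s powr r) / m powr r"
      using m s by (simp add: powr_divide add_divide_distrib)
    then show ?thesis using m by (simp add: field_simps)
  qed
  finally show ?thesis by (simp add: s_def)
qed

text \<open>By homogeneity and symmetry \<open>a = 1\<close> and \<open>b = t\<close> with
  \<bar>t\<bar> \<le> 1. Near \<open>t = 1\<close> the left side is below \<open>e\<close>; on the
  remaining compact interval the convexity gap \<open>f\<close> is bounded away from 0. Integrated,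
  this turns a small midpoint gap into a small distance.\<close>

lemma abs_powr_uniform_convexity:
  fixes r e :: real
  assumes r: "1 < r" and e: "0 < e"
  obtains C where "0 \<le> C"
    "\<And>a b. \<bar>a - b\<bar> powr r \<le> e * (\<bar>a\<bar> powr r + \<bar>b\<bar> powr r)
       + C * ((\<bar>a\<bar> powr r + \<bar>b\<bar> powr r) / 2 - \<bar>(a + b) / 2\<bar> powr r)"
proof -
  define f where "f t = (1 + \<bar>t\<bar> powr r) / 2 - \<bar>(1 + t) / 2\<bar> powr r" for t
  \<comment> \<open>\<open>d powr r \<le> e\<close> disposes of \<open>t\<close> near 1, where the
    convexity gap degenerates; the minimum with 1 keeps the interval up to \<open>1 - d\<close>
    nonempty.\<close>
  define d where "d = min 1 (e powr (1 / r))"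
  have d: "d > 0" "d \<le> 1" using e by (auto simp: d_def)
  have dr: "d powr r \<le> e"
  proof -
    have "d powr r \<le> (e powr (1/r)) powr r" using d r by (intro powr_mono2) (auto simp: d_def)
    then show ?thesis using r e by (simp add: powr_powr)
  qed
  have "continuous_on {-1..1 - d} f"
    unfolding f_def using r by (intro continuous_intros continuous_on_powr') auto
  then obtain t0 where t0: "t0 \<in> {-1..1 - d}" "\<And>t. t \<in> {-1..1 - d} \<Longrightarrow> f t0 \<le> f t"
    using continuous_attains_inf[of "{-1..1 - d}" f] d by auto
  have "\<bar>t0\<bar> \<le> 1" "t0 \<noteq> 1" using t0(1) d by auto
  then have ft0: "f t0 > 0" using powr_midpoint_less[of r t0] r by (simp add: f_def)
  define C where "C = 2 powr r / f t0"
  have C: "C \<ge> 0" using ft0 by (simp add: C_def)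
  have 1: "\<bar>1 - t\<bar> powr r \<le> e * (1 + \<bar>t\<bar> powr r) + C * f t" if t: "\<bar>t\<bar> \<le> 1" for t
  proof (cases "t \<le> 1 - d")
    case True
    have "\<bar>1 - t\<bar> powr r \<le> 2 powr r" using t r by (intro powr_mono2) auto
    also have "\<dots> = C * f t0" using ft0 by (simp add: C_def)
    also have "\<dots> \<le> C * f t" using t0(2)[of t] t True C by (intro mult_left_mono) auto
    finally show ?thesis using e by (simp add: add_increasing)
  next
    case False
    have "\<bar>1 - t\<bar> powr r \<le> d powr r" using t r False by (intro powr_mono2) auto
    also have "\<dots> \<le> e * (1 + \<bar>t\<bar> powr r)" using dr e by (simp add: distrib_left add_increasing2)
    also have "\<dots> \<le> e * (1 + \<bar>t\<bar> powr r) + C * f t"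
      using powr_midpoint_less[of r t] r t C by (cases "t = 1") (auto simp: f_def)
    finally show ?thesis .
  qed
  let ?P = "\<lambda>a b. \<bar>a - b\<bar> powr r \<le> e * (\<bar>a\<bar> powr r + \<bar>b\<bar> powr r)
       + C * ((\<bar>a\<bar> powr r + \<bar>b\<bar> powr r) / 2 - \<bar>(a + b) / 2\<bar> powr r)"
  have 2: "?P a b" if "\<bar>b\<bar> \<le> \<bar>a\<bar>" for a b
  proof (cases "a = 0")
    case False
    define t where "t = b / a"
    have b: "b = a * t" using False by (simp add: t_def)
    have t: "\<bar>t\<bar> \<le> 1" using that False by (simp add: t_def)
    have e1: "\<bar>a - b\<bar> = \<bar>a\<bar> * \<bar>1 - t\<bar>" by (simp add: b flip: abs_mult) (simp add: algebra_simps)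
    have e2: "\<bar>(a + b) / 2\<bar> = \<bar>a\<bar> * \<bar>(1 + t) / 2\<bar>"
      unfolding b by (simp flip: abs_mult add: algebra_simps)
    have e3: "\<bar>b\<bar> = \<bar>a\<bar> * \<bar>t\<bar>" by (simp add: b abs_mult)
    have "\<bar>a - b\<bar> powr r = \<bar>a\<bar> powr r * \<bar>1 - t\<bar> powr r"
      unfolding e1 by (simp add: powr_mult)
    also have "\<dots> \<le> \<bar>a\<bar> powr r * (e * (1 + \<bar>t\<bar> powr r) + C * f t)"
      using 1[OF t] by (intro mult_left_mono) auto
    also have "\<dots> = e * (\<bar>a\<bar> powr r + \<bar>b\<bar> powr r)
       + C * ((\<bar>a\<bar> powr r + \<bar>b\<bar> powr r) / 2 - \<bar>(a + b) / 2\<bar> powr r)"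
      unfolding e2 e3 f_def powr_mult by (simp add: algebra_simps)
    finally show ?thesis .
  qed (use that in simp)
  have "?P a b" for a b
    using 2[of a b] 2[of b a] by (cases "\<bar>b\<bar> \<le> \<bar>a\<bar>") (auto simp: add.commute abs_minus_commute)
  then show ?thesis using that[of C] C by blast
qed

text \<open>If the convexity gap were negative, the term with \<open>C\<close> in the uniform
  estimate could be dropped for every \<open>e\<close>; letting \<open>e\<close> tend to 0 forces
  \<open>a = b\<close>, where the gap is 0.\<close>

lemma abs_powr_midpoint_le:
  fixes r a b :: real
  assumes r: "1 < r"
  shows "\<bar>(a + b) / 2\<bar> powr r \<le> (\<bar>a\<bar> powr r + \<bar>b\<bar> powr r) / 2"
proof (rule ccontr)
  assume neg: "\<not> ?thesis"
  have "\<bar>a - b\<bar> powr r \<le> 0 * (\<bar>a\<bar> powr r + \<bar>b\<bar> powr r)"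
  proof (rule tendsto_lowerbound)
    show "((\<lambda>e. e * (\<bar>a\<bar> powr r + \<bar>b\<bar> powr r)) \<longlongrightarrow> 0 * (\<bar>a\<bar> powr r + \<bar>b\<bar> powr r)) (at_right 0)"
      by (intro tendsto_intros)
    show "\<forall>\<^sub>F e in at_right 0. \<bar>a - b\<bar> powr r \<le> e * (\<bar>a\<bar> powr r + \<bar>b\<bar> powr r)"
      using eventually_at_right_less[of 0]
    proof eventually_elim
      case (elim e)
      obtain C where C: "0 \<le> C"
        "\<And>a b. \<bar>a - b\<bar> powr r \<le> e * (\<bar>a\<bar> powr r + \<bar>b\<bar> powr r)
           + C * ((\<bar>a\<bar> powr r + \<bar>b\<bar> powr r) / 2 - \<bar>(a + b) / 2\<bar> powr r)"
        using abs_powr_uniform_convexity[OF r elim] by blast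
      have "C * ((\<bar>a\<bar> powr r + \<bar>b\<bar> powr r) / 2 - \<bar>(a + b) / 2\<bar> powr r) \<le> 0"
        using C(1) neg by (intro mult_nonneg_nonpos) auto
      then show ?case using C(2)[of a b] by linarith
    qed
  qed auto
  then have "a = b" by simp
  then show False using neg by simp
qed

section \<open>Integrals of powers\<close>

text \<open>Junk value \<open>0\<close> if \<open>\<bar>f\<bar>\<^sup>r\<close> is not integrable.\<close>

definition pint :: "'a measure \<Rightarrow> real \<Rightarrow> ('a \<Rightarrow> real) \<Rightarrow> real" where
  "pint M r f = (LINT x|M. \<bar>f x\<bar> powr r)"

text \<open>The derivative of \<open>pint M r\<close> at \<open>f\<close> in the direction
  \<open>g\<close>, obtained by differentiating under the integral.\<close>

definition pder :: "'a measure \<Rightarrow> real \<Rightarrow> ('a \<Rightarrow> real) \<Rightarrow> ('a \<Rightarrow> real) \<Rightarrow> real" where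
  "pder M r f g = (LINT x|M. r * sgn (f x) * \<bar>f x\<bar> powr (r - 1) * g x)"

lemma Lp_spaceD:
  assumes "f \<in> Lp_space M r"
  shows "f \<in> borel_measurable M" "integrable M (\<lambda>x. \<bar>f x\<bar> powr r)"
  using assms by (auto simp: Lp_space_def)

lemma pint_nonneg: "0 \<le> pint M r f"
  by (auto simp: pint_def intro!: integral_nonneg_AE)

lemma Lp_space_add:
  assumes "f \<in> Lp_space M r" "g \<in> Lp_space M r" "0 \<le> r"
  shows "(\<lambda>x. f x + g x) \<in> Lp_space M r"
proof -
  note [measurable] = Lp_spaceD(1)[OF assms(1)] Lp_spaceD(1)[OF assms(2)]
  have "integrable M (\<lambda>x. 2 powr r * (\<bar>f x\<bar> powr r + \<bar>g x\<bar> powr r))"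
    using assms by (auto simp: Lp_space_def)
  then have "integrable M (\<lambda>x. \<bar>f x + g x\<bar> powr r)"
    by (rule Bochner_Integration.integrable_bound) (use powr_add_le[OF assms(3)] in \<open>auto intro!: AE_I2\<close>)
  then show ?thesis by (auto simp: Lp_space_def)
qed

lemma Lp_space_cmult:
  assumes "f \<in> Lp_space M r"
  shows "(\<lambda>x. c * f x) \<in> Lp_space M r"
  using assms by (auto simp: Lp_space_def abs_mult powr_mult)

lemma Lp_space_diff:
  assumes "f \<in> Lp_space M r" "g \<in> Lp_space M r" "0 \<le> r"
  shows "(\<lambda>x. f x - g x) \<in> Lp_space M r"
  using Lp_space_add[OF assms(1) Lp_space_cmult[OF assms(2), of "- 1"] assms(3)] by simp

lemma pint_cmult: "pint M r (\<lambda>x. c * f x) = \<bar>c\<bar> powr r * pint M r f"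
  by (simp add: pint_def abs_mult powr_mult)

lemma pint_cong_AE:
  assumes "f \<in> borel_measurable M" "g \<in> borel_measurable M" "AE x in M. f x = g x"
  shows "pint M r f = pint M r g"
proof -
  note [measurable] = assms(1,2)
  show ?thesis unfolding pint_def by (rule integral_cong_AE) (use assms(3) in auto)
qed

lemma pint_add_le:
  assumes "f \<in> Lp_space M r" "g \<in> Lp_space M r" "0 \<le> r"
  shows "pint M r (\<lambda>x. f x + g x) \<le> 2 powr r * (pint M r f + pint M r g)"
proof -
  have "pint M r (\<lambda>x. f x + g x) \<le> (LINT x|M. 2 powr r * (\<bar>f x\<bar> powr r + \<bar>g x\<bar> powr r))"
    unfolding pint_def
    using Lp_space_add[OF assms] assms powr_add_le[OF assms(3)]
    by (intro integral_mono) (auto simp: Lp_space_def)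
  also have "\<dots> = 2 powr r * (pint M r f + pint M r g)"
    unfolding pint_def using assms by (auto simp: Lp_space_def)
  finally show ?thesis .
qed

lemma pint_diff_le:
  assumes "f \<in> Lp_space M r" "g \<in> Lp_space M r" "0 \<le> r"
  shows "pint M r (\<lambda>x. f x - g x) \<le> 2 powr r * (pint M r f + pint M r g)"
  using pint_add_le[OF assms(1) Lp_space_cmult[OF assms(2), of "- 1"] assms(3)] pint_cmult[of M r "-1" g]
  by simp

lemma nn_integral_powr_eq_pint:
  assumes "f \<in> Lp_space M r"
  shows "(\<integral>\<^sup>+x. ennreal (\<bar>f x\<bar> powr r) \<partial>M) = ennreal (pint M r f)"
  using assms unfolding pint_def Lp_space_def by (intro nn_integral_eq_integral) auto

lemma Lp_spaceI_nn:
  assumes "f \<in> borel_measurable M" "(\<integral>\<^sup>+x. ennreal (\<bar>f x\<bar> powr r) \<partial>M) \<le> ennreal c" "0 \<le> c"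
  shows "f \<in> Lp_space M r" "pint M r f \<le> c"
proof -
  note [measurable] = assms(1)
  have "integrable M (\<lambda>x. \<bar>f x\<bar> powr r)"
    by (rule integrableI_bounded) (use assms(2) in \<open>auto simp: top_unique less_top intro: le_less_trans\<close>)
  then show 1: "f \<in> Lp_space M r" by (auto simp: Lp_space_def)
  show "pint M r f \<le> c"
    using assms(2,3) unfolding nn_integral_powr_eq_pint[OF 1] by (simp add: ennreal_le_iff)
qed

text \<open>The bound is asked for only eventually, because in \<open>banach_saks_midpoints\<close>
  it holds only beyond a fixed index.\<close>

lemma Lp_fatou:
  assumes u: "\<And>k. u k \<in> Lp_space M r" and b: "\<forall>\<^sub>F k in sequentially. pint M r (u k) \<le> c"
    and lim: "AE x in M. (\<lambda>k. u k x) \<longlonglongrightarrow> f x" and f: "f \<in> borel_measurable M" and r: "0 < r"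
  shows "f \<in> Lp_space M r" "pint M r f \<le> c"
proof -
  note [measurable] = f Lp_spaceD(1)[OF u]
  obtain k0 where "pint M r (u k0) \<le> c" using b eventually_happens'[OF sequentially_bot] by blast
  then have c: "0 \<le> c" using pint_nonneg[of M r "u k0"] by linarith
  have "(\<integral>\<^sup>+x. ennreal (\<bar>f x\<bar> powr r) \<partial>M) = (\<integral>\<^sup>+x. liminf (\<lambda>k. ennreal (\<bar>u k x\<bar> powr r)) \<partial>M)"
  proof (rule nn_integral_cong_AE, use lim in eventually_elim)
    case (elim x)
    have "(\<lambda>k. \<bar>u k x\<bar> powr r) \<longlonglongrightarrow> \<bar>f x\<bar> powr r"
      using elim r by (intro tendsto_powr' tendsto_intros) auto
    then have "(\<lambda>k. ennreal (\<bar>u k x\<bar> powr r)) \<longlonglongrightarrow> ennreal (\<bar>f x\<bar> powr r)"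
      by (rule tendsto_ennrealI)
    then show ?case using lim_imp_Liminf[OF sequentially_bot] by metis
  qed
  also have "\<dots> \<le> liminf (\<lambda>k. \<integral>\<^sup>+x. ennreal (\<bar>u k x\<bar> powr r) \<partial>M)"
    by (rule nn_integral_liminf) auto
  also have "\<dots> = liminf (\<lambda>k. ennreal (pint M r (u k)))"
    using nn_integral_powr_eq_pint[OF u] by simp
  also have "\<dots> \<le> limsup (\<lambda>k. ennreal (pint M r (u k)))"
    by (intro Liminf_le_Limsup) auto
  also have "\<dots> \<le> ennreal c"
    using b by (intro Limsup_bounded) (auto elim!: eventually_mono intro: ennreal_leI)
  finally show "f \<in> Lp_space M r" "pint M r f \<le> c" using Lp_spaceI_nn[OF f _ c] by auto
qed

text \<open>The defect \<open>g k\<close> need not have an integrable majorant, but its part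
  \<open>W k\<close> exceeding \<open>e * d k\<close> is dominated by a multiple of
  \<open>\<bar>f x\<bar> powr r\<close> and tends to 0 almost everywhere. Dominated convergence
  removes it, and the rest integrates to at most \<open>e * D\<close>.\<close>

lemma brezis_lieb:
  assumes u: "\<And>k. u k \<in> Lp_space M r" and b: "\<And>k. pint M r (u k) \<le> c"
    and lim: "AE x in M. (\<lambda>k. u k x) \<longlonglongrightarrow> f x" and f: "f \<in> Lp_space M r" and r: "1 < r"
  shows "(\<lambda>k. pint M r (u k) - pint M r (\<lambda>x. u k x - f x)) \<longlonglongrightarrow> pint M r f"
proof -
  note [measurable] = Lp_spaceD(1)[OF f] Lp_spaceD(1)[OF u]
  have r0: "0 \<le> r" using r by simp
  define d where "d k x = \<bar>u k x - f x\<bar> powr r" for k x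
  define g where "g k x = \<bar>\<bar>u k x\<bar> powr r - d k x - \<bar>f x\<bar> powr r\<bar>" for k x
  have [measurable]: "d k \<in> borel_measurable M" "g k \<in> borel_measurable M" for k
    unfolding g_def[abs_def] d_def[abs_def] by measurable
  have id: "integrable M (d k)" for k
    using Lp_space_diff[OF u f r0] unfolding d_def by (auto simp: Lp_space_def)
  have iu: "integrable M (\<lambda>x. \<bar>u k x\<bar> powr r)" for k using u by (auto simp: Lp_space_def)
  have "if": "integrable M (\<lambda>x. \<bar>f x\<bar> powr r)" using f by (auto simp: Lp_space_def)
  have ig: "integrable M (g k)" for k unfolding g_def using id iu "if" by auto
  define D where "D = 2 powr r * (c + pint M r f)"
  have dD: "integral\<^sup>L M (d k) \<le> D" for k
  proof -
    have "integral\<^sup>L M (d k) \<le> 2 powr r * (pint M r (u k) + pint M r f)"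
      using pint_diff_le[OF u f r0] by (simp add: d_def[abs_def] pint_def)
    also have "\<dots> \<le> D" unfolding D_def using b by (intro mult_left_mono add_mono) auto
    finally show ?thesis .
  qed
  have D0: "0 \<le> D"
  proof -
    have "0 \<le> integral\<^sup>L M (d 0)" by (auto simp: d_def intro!: integral_nonneg_AE)
    then show ?thesis using dD[of 0] by linarith
  qed
  have gl: "(\<lambda>k. integral\<^sup>L M (g k)) \<longlonglongrightarrow> 0"
  proof (rule LIMSEQ_I)
    fix e0 :: real assume e0: "0 < e0"
    define e where "e = e0 / (2 * (D + 1))"
    have e: "e > 0" "e * D < e0" using e0 D0 mult_nonneg_nonneg[OF D0, of e0]
      by (auto simp: e_def field_simps add_pos_nonneg add_nonneg_pos)
    obtain C where C: "0 \<le> C" "\<And>a b. \<bar>\<bar>a + b\<bar> powr r - \<bar>a\<bar> powr r\<bar> \<le> e * \<bar>a\<bar> powr r + C * \<bar>b\<bar> powr r"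
      using abs_powr_add_diff_small[OF r e(1)] by blast
    define W where "W k x = max 0 (g k x - e * d k x)" for k x
    have [measurable]: "W k \<in> borel_measurable M" for k unfolding W_def[abs_def] by measurable
    have Wb: "norm (W k x) \<le> (C + 1) * \<bar>f x\<bar> powr r" for k x
    proof -
      have "g k x \<le> \<bar>\<bar>u k x\<bar> powr r - d k x\<bar> + \<bar>f x\<bar> powr r"
        unfolding g_def using powr_ge_zero[of "\<bar>f x\<bar>" r] by linarith
      moreover have "\<bar>\<bar>u k x\<bar> powr r - d k x\<bar> \<le> e * d k x + C * \<bar>f x\<bar> powr r"
        using C(2)[of "u k x - f x" "f x"] by (simp add: d_def)
      ultimately have "g k x - e * d k x \<le> (C + 1) * \<bar>f x\<bar> powr r" by (simp add: algebra_simps)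
      then show ?thesis unfolding W_def using C(1) by (auto simp: max_def)
    qed
    have Wint: "(\<lambda>k. integral\<^sup>L M (W k)) \<longlonglongrightarrow> integral\<^sup>L M (\<lambda>x. 0)"
    proof (rule integral_dominated_convergence)
      show "integrable M (\<lambda>x. (C + 1) * \<bar>f x\<bar> powr r)" using "if" by auto
      show "AE x in M. norm (W k x) \<le> (C + 1) * \<bar>f x\<bar> powr r" for k using Wb by auto
      show "AE x in M. (\<lambda>k. W k x) \<longlonglongrightarrow> 0"
        using lim
      proof eventually_elim
        case (elim x)
        have 1: "(\<lambda>k. d k x) \<longlonglongrightarrow> \<bar>f x - f x\<bar> powr r"
          unfolding d_def using elim r by (intro tendsto_powr' tendsto_intros) auto
        have 2: "(\<lambda>k. \<bar>u k x\<bar> powr r) \<longlonglongrightarrow> \<bar>f x\<bar> powr r"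
          using elim r by (intro tendsto_powr' tendsto_intros) auto
        have "(\<lambda>k. W k x) \<longlonglongrightarrow> max 0 (\<bar>\<bar>f x\<bar> powr r - \<bar>f x - f x\<bar> powr r - \<bar>f x\<bar> powr r\<bar> - e * \<bar>f x - f x\<bar> powr r)"
          unfolding W_def g_def by (intro tendsto_intros 1 2)
        then show ?case using r by simp
      qed
    qed (auto simp: W_def)
    have iW: "integrable M (W k)" for k
      unfolding W_def using ig id by auto
    have gW: "integral\<^sup>L M (g k) \<le> integral\<^sup>L M (W k) + e * D" for k
    proof -
      have "integral\<^sup>L M (g k) \<le> integral\<^sup>L M (\<lambda>x. W k x + e * d k x)"
        using ig iW id by (intro integral_mono) (auto simp: W_def)
      also have "\<dots> = integral\<^sup>L M (W k) + e * integral\<^sup>L M (d k)"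
        using iW id by simp
      finally show ?thesis using mult_left_mono[OF dD[of k], of e] e by linarith
    qed
    have "\<forall>\<^sub>F k in sequentially. integral\<^sup>L M (W k) < e0 - e * D"
      using order_tendstoD(2)[OF Wint, of "e0 - e * D"] e by simp
    then obtain n where n: "\<And>k. k \<ge> n \<Longrightarrow> integral\<^sup>L M (W k) < e0 - e * D"
      by (auto simp: eventually_sequentially)
    have g0: "0 \<le> integral\<^sup>L M (g k)" for k by (auto simp: g_def intro!: integral_nonneg_AE)
    show "\<exists>no. \<forall>n\<ge>no. norm (integral\<^sup>L M (g n) - 0) < e0"
      using n gW g0 by (intro exI[of _ n]) (auto, smt (verit))
  qed
  have nb: "norm (pint M r (u k) - pint M r (\<lambda>x. u k x - f x) - pint M r f) \<le> integral\<^sup>L M (g k)" for k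
  proof -
    have "pint M r (u k) - pint M r (\<lambda>x. u k x - f x) - pint M r f
       = (LINT x|M. \<bar>u k x\<bar> powr r - d k x - \<bar>f x\<bar> powr r)"
      using id[of k] iu[of k] "if" unfolding pint_def d_def by simp
    then show ?thesis unfolding g_def using integral_abs_bound[of M "\<lambda>x. \<bar>u k x\<bar> powr r - d k x - \<bar>f x\<bar> powr r"] by simp
  qed
  have "(\<lambda>k. pint M r (u k) - pint M r (\<lambda>x. u k x - f x) - pint M r f) \<longlonglongrightarrow> 0"
    by (rule Lim_null_comparison[OF always_eventually gl]) (use nb in blast)
  then show ?thesis by (rule LIM_zero_cancel)
qed

section \<open>First-order expansion of integrals of powers\<close>

lemma integrable_pder:
  assumes f: "f \<in> Lp_space M r" and g: "g \<in> Lp_space M r" and r: "1 < r"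
  shows "integrable M (\<lambda>x. \<bar>f x\<bar> powr (r - 1) * \<bar>g x\<bar>)"
    and "integrable M (\<lambda>x. r * sgn (f x) * \<bar>f x\<bar> powr (r - 1) * g x)"
proof -
  note [measurable] = Lp_spaceD(1)[OF f] Lp_spaceD(1)[OF g]
  have "integrable M (\<lambda>x. \<bar>f x\<bar> powr r + \<bar>g x\<bar> powr r)"
    using f g by (auto simp: Lp_space_def)
  then show 1: "integrable M (\<lambda>x. \<bar>f x\<bar> powr (r - 1) * \<bar>g x\<bar>)"
    by (rule Bochner_Integration.integrable_bound) (use r young_weak in \<open>auto intro!: AE_I2\<close>)
  then have "integrable M (\<lambda>x. r * (\<bar>f x\<bar> powr (r - 1) * \<bar>g x\<bar>))" by simp
  then show "integrable M (\<lambda>x. r * sgn (f x) * \<bar>f x\<bar> powr (r - 1) * g x)"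
    by (rule Bochner_Integration.integrable_bound) (use r in \<open>auto intro!: AE_I2 simp: abs_mult sgn_if\<close>)
qed

lemma pder_cmult: "pder M r f (\<lambda>x. c * g x) = c * pder M r f g"
proof -
  have "pder M r f (\<lambda>x. c * g x) = (LINT x|M. c * (r * sgn (f x) * \<bar>f x\<bar> powr (r - 1) * g x))"
    unfolding pder_def by (rule Bochner_Integration.integral_cong) (auto simp: algebra_simps)
  then show ?thesis by (simp add: pder_def)
qed

text \<open>Uniformity in \<open>g\<close> comes from Young's inequality with weight \<open>t\<close>, in place of Hoelder's.\<close>

lemma pint_expansion:
  assumes f: "f \<in> Lp_space M r" and r: "1 < r" and e: "0 < e"
  shows "\<exists>d>0. \<forall>g\<in>Lp_space M r. \<forall>t. 0 \<le> t \<and> t < d \<and> pint M r g \<le> t powr r \<longrightarrow>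
     \<bar>pint M r (\<lambda>x. f x + g x) - pint M r f - pder M r f g\<bar> \<le> e * t"
proof -
  have r0: "0 \<le> r" using r by simp
  define P where "P = pint M r f"
  have P: "0 \<le> P" by (simp add: P_def pint_nonneg)
  define e1 where "e1 = e / (2 * (P + 1))"
  have e1: "e1 > 0" "e1 * (P + 1) = e / 2" using e P by (auto simp: e1_def field_simps add_pos_nonneg add_nonneg_pos)
  obtain C where C: "0 \<le> C"
    "\<And>a b. \<bar>\<bar>a + b\<bar> powr r - \<bar>a\<bar> powr r - r * sgn a * \<bar>a\<bar> powr (r - 1) * b\<bar>
        \<le> e1 * (\<bar>a\<bar> powr (r - 1) * \<bar>b\<bar>) + C * \<bar>b\<bar> powr r"
    using abs_powr_first_order[OF r e1(1)] by blast
  \<comment> \<open>Chosen so that \<open>C * d powr (r - 1) \<le> e / 2\<close>. With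
    \<open>e1 * (P + 1) = e / 2\<close>, each of the two error terms is at most
    \<open>e / 2 * t\<close>.\<close>
  define d where "d = (e / (2 * (C + 1))) powr (1 / (r - 1))"
  have d: "d > 0" using e C by (simp add: d_def)
  have pos: "\<bar>pint M r (\<lambda>x. f x + g x) - P - pder M r f g\<bar> \<le> e * t"
    if g: "g \<in> Lp_space M r" and t: "0 < t" "t < d" "pint M r g \<le> t powr r" for g t
  proof -
    note Ii = Lp_spaceD(2)[OF f] Lp_spaceD(2)[OF g] integrable_pder[OF f g r]
      Lp_spaceD(2)[OF Lp_space_add[OF f g r0]]
    have I1: "(LINT x|M. \<bar>f x\<bar> powr (r - 1) * \<bar>g x\<bar>) \<le> t * (P + 1)"
    proof -
      have "(LINT x|M. \<bar>f x\<bar> powr (r - 1) * \<bar>g x\<bar>) \<le> (LINT x|M. t * (\<bar>f x\<bar> powr r + t powr (- r) * \<bar>g x\<bar> powr r))"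
      proof (rule integral_mono)
        show "\<bar>f x\<bar> powr (r - 1) * \<bar>g x\<bar> \<le> t * (\<bar>f x\<bar> powr r + t powr (- r) * \<bar>g x\<bar> powr r)" for x
        proof -
          have "\<bar>f x\<bar> powr (r - 1) * (\<bar>g x\<bar> / t) \<le> \<bar>f x\<bar> powr r + (\<bar>g x\<bar> / t) powr r"
            using r t by (intro young_weak) auto
          then have "t * (\<bar>f x\<bar> powr (r - 1) * (\<bar>g x\<bar> / t)) \<le> t * (\<bar>f x\<bar> powr r + (\<bar>g x\<bar> / t) powr r)"
            using t by (intro mult_left_mono) auto
          then show ?thesis using t by (simp add: powr_divide powr_minus field_simps)
        qed
      qed (use Ii in auto)
      also have "\<dots> = t * (P + t powr (- r) * pint M r g)"
        using Ii by (simp add: P_def pint_def)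
      also have "\<dots> \<le> t * (P + t powr (- r) * t powr r)"
        using t by (intro mult_left_mono add_left_mono) auto
      also have "\<dots> = t * (P + 1)" using t by (simp flip: powr_add)
      finally show ?thesis .
    qed
    have "pint M r (\<lambda>x. f x + g x) - P - pder M r f g
       = (LINT x|M. \<bar>f x + g x\<bar> powr r - \<bar>f x\<bar> powr r - r * sgn (f x) * \<bar>f x\<bar> powr (r - 1) * g x)"
      unfolding pint_def P_def pder_def using Ii by simp
    then have "\<bar>pint M r (\<lambda>x. f x + g x) - P - pder M r f g\<bar>
       \<le> (LINT x|M. \<bar>\<bar>f x + g x\<bar> powr r - \<bar>f x\<bar> powr r - r * sgn (f x) * \<bar>f x\<bar> powr (r - 1) * g x\<bar>)"
      by (simp add: integral_abs_bound)
    also have "\<dots> \<le> (LINT x|M. e1 * (\<bar>f x\<bar> powr (r - 1) * \<bar>g x\<bar>) + C * \<bar>g x\<bar> powr r)"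
      using Ii C(2) by (intro integral_mono) auto
    also have "\<dots> = e1 * (LINT x|M. \<bar>f x\<bar> powr (r - 1) * \<bar>g x\<bar>) + C * pint M r g"
      using Ii by (simp add: pint_def)
    also have "\<dots> \<le> e1 * (t * (P + 1)) + C * t powr r"
      using I1 e1 C t by (intro add_mono mult_left_mono) auto
    also have "e1 * (t * (P + 1)) = e / 2 * t" 
      unfolding e1(2)[symmetric] by (simp only: mult_ac)
    also have "C * t powr r \<le> e / 2 * t"
    proof -
      have "t powr (r - 1) \<le> d powr (r - 1)" using t r by (intro powr_mono2) auto
      also have "\<dots> = e / (2 * (C + 1))" using r e C by (simp add: d_def powr_powr)
      finally have "C * t powr (r - 1) \<le> C * (e / (2 * (C + 1)))" using C by (intro mult_left_mono) auto
      also have "\<dots> \<le> e / 2" using C e by (simp add: field_simps)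
      finally have "C * t powr (r - 1) * t \<le> e / 2 * t" using t by (intro mult_right_mono) auto
      moreover have "t powr r = t powr (r - 1) * t"
        using powr_add[of t "r - 1" 1] t by simp
      ultimately show ?thesis by simp
    qed
    finally show ?thesis by (simp add: algebra_simps)
  qed
  have "\<bar>pint M r (\<lambda>x. f x + g x) - P - pder M r f g\<bar> \<le> e * t"
    if g: "g \<in> Lp_space M r" and t: "0 \<le> t" "t < d" "pint M r g \<le> t powr r" for g t
  proof (cases "t = 0")
    \<comment> \<open>Such a \<open>g\<close> has \<open>pint M r g = 0\<close> and so meets the
      bound for every positive \<open>t\<close>, which can then be sent to 0.\<close>
    case True
    then have g0: "pint M r g = 0" using t pint_nonneg[of M r g] by simp
    have "\<bar>pint M r (\<lambda>x. f x + g x) - P - pder M r f g\<bar> \<le> e * 0"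
    proof (rule tendsto_lowerbound)
      show "((\<lambda>t. e * t) \<longlongrightarrow> e * 0) (at_right 0)" by (intro tendsto_intros)
      show "\<forall>\<^sub>F t in at_right 0. \<bar>pint M r (\<lambda>x. f x + g x) - P - pder M r f g\<bar> \<le> e * t"
        using eventually_at_right_less[of 0] eventually_at_right_field[of "\<lambda>t. t < d" 0] d
          pos[OF g] g0 by (auto simp: eventually_at_right_field intro!: exI[of _ d])
    qed auto
    then show ?thesis using True by simp
  qed (use pos[OF g] t in auto)
  then show ?thesis using d unfolding P_def by blast
qed

text \<open>Dyadic convex combinations. Midpoints are enough because the uniform convexity estimate
  compares two functions with their midpoint only.\<close>

inductive_set mid_hull :: "('a \<Rightarrow> real) set \<Rightarrow> ('a \<Rightarrow> real) set" for U where
  base: "f \<in> U \<Longrightarrow> f \<in> mid_hull U"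
| mid: "f \<in> mid_hull U \<Longrightarrow> g \<in> mid_hull U \<Longrightarrow> (\<lambda>x. (f x + g x) / 2) \<in> mid_hull U"

lemma mid_hull_mono:
  assumes "U \<subseteq> V" shows "mid_hull U \<subseteq> mid_hull V"
proof
  fix f assume "f \<in> mid_hull U"
  then show "f \<in> mid_hull V" by induction (use assms in \<open>auto intro: mid_hull.intros\<close>)
qed

lemma mid_hull_Lp_bound:
  assumes "v \<in> mid_hull U" "1 < r" "\<And>f. f \<in> U \<Longrightarrow> f \<in> Lp_space M r \<and> pint M r f \<le> c"
  shows "v \<in> Lp_space M r \<and> pint M r v \<le> c"
  using assms(1)
proof induction
  case (base f)
  then show ?case using assms by auto
next
  case (mid f g)
  have r: "0 \<le> r" using assms by simp
  have eq: "(\<lambda>x. (f x + g x) / 2) = (\<lambda>x. (1/2) * (f x + g x))" by auto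
  have 1: "(\<lambda>x. (f x + g x) / 2) \<in> Lp_space M r"
    unfolding eq using mid r by (intro Lp_space_cmult Lp_space_add) auto
  have "pint M r (\<lambda>x. (f x + g x) / 2) \<le> (LINT x|M. (\<bar>f x\<bar> powr r + \<bar>g x\<bar> powr r) / 2)"
    unfolding pint_def using mid Lp_spaceD(2)[OF 1] abs_powr_midpoint_le[OF assms(2)]
    by (intro integral_mono) (auto simp: Lp_space_def)
  also have "\<dots> = (pint M r f + pint M r g) / 2"
    unfolding pint_def using mid by (auto simp: Lp_space_def)
  finally show ?case using 1 mid by auto
qed

text \<open>Almost minimisers of the distance to \<open>f\<close> over the midpoint hulls of the tails of \<open>u\<close> form
  a Cauchy sequence by uniform convexity. As they converge to \<open>f\<close> almost everywhere, Fatou's lemma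
  identifies their limit.\<close>

lemma banach_saks_midpoints:
  assumes u: "\<And>k. u k \<in> Lp_space M r" and b: "\<And>k. pint M r (u k) \<le> c"
    and lim: "AE x in M. (\<lambda>k. u k x) \<longlonglongrightarrow> f x" and f: "f \<in> Lp_space M r" and r: "1 < r"
    and eta: "0 < \<eta>"
  shows "\<exists>v\<in>mid_hull (range u). v \<in> Lp_space M r \<and> pint M r (\<lambda>x. v x - f x) < \<eta>"
proof -
  have r0: "0 \<le> r" using r by simp
  define H where "H m = mid_hull (u ` {m..})" for m :: nat
  define N where "N v = pint M r (\<lambda>x. v x - f x)" for v
  have HL: "v \<in> Lp_space M r" "pint M r v \<le> c" if "v \<in> H m" for v m
    using mid_hull_Lp_bound[OF that[unfolded H_def] r] u b by auto
  have Hmono: "H l \<subseteq> H m" if "m \<le> l" for l m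
    unfolding H_def using that by (intro mid_hull_mono) auto
  have Hne: "u m \<in> H m" for m unfolding H_def by (intro mid_hull.base) auto
  define B where "B = 2 powr r * (c + pint M r f)"
  have NB: "N v \<le> B" if "v \<in> H m" for v m
  proof -
    have "N v \<le> 2 powr r * (pint M r v + pint M r f)"
      unfolding N_def using pint_diff_le[OF HL(1)[OF that] f r0] .
    also have "\<dots> \<le> B" unfolding B_def using HL(2)[OF that] by (intro mult_left_mono) auto
    finally show ?thesis .
  qed
  have N0: "0 \<le> N v" for v by (simp add: N_def pint_nonneg)
  \<comment> \<open>The distance (to the power \<open>r\<close>) of \<open>f\<close> from the hull
    of the \<open>m\<close>-th tail. It increases with \<open>m\<close> and stays below
    \<open>B\<close>, so the gap to its limit \<open>D\<close> becomes small.\<close>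
  define d where "d m = Inf (N ` H m)" for m
  have bdd: "bdd_below (N ` H m)" for m using N0 by (intro bdd_belowI[of _ 0]) auto
  have dle: "d m \<le> N v" if "v \<in> H m" for m v
    unfolding d_def using that bdd by (intro cInf_lower) auto
  have dB: "d m \<le> B" for m using dle[OF Hne] NB[OF Hne] by (rule order_trans)
  have "incseq d"
  proof (rule incseq_SucI)
    show "d m \<le> d (Suc m)" for m
      unfolding d_def using Hne[of "Suc m"] Hmono[of m "Suc m"] bdd by (intro cInf_superset_mono) auto
  qed
  then obtain D where D: "d \<longlonglongrightarrow> D" "\<And>m. d m \<le> D"
    using incseq_convergent[of d B] dB by auto
  have "\<exists>v\<in>H m. N v < d m + 1 / Suc m" for m
  proof -
    have "\<exists>y\<in>N ` H m. y < d m + 1 / Suc m"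
      using Hne[of m] bdd[of m] unfolding d_def by (intro cInf_lessD) auto
    then show ?thesis by auto
  qed
  then obtain v where v: "\<And>m. v m \<in> H m" "\<And>m. N (v m) < d m + 1 / Suc m" by metis
  have vf: "AE x in M. (\<lambda>k. v k x) \<longlonglongrightarrow> f x"
    using lim
  proof eventually_elim
    case (elim x)
    show ?case
    proof (rule LIMSEQ_I)
      fix e :: real assume "0 < e"
      then obtain n where n: "\<And>k. k \<ge> n \<Longrightarrow> \<bar>u k x - f x\<bar> < e"
        using LIMSEQ_D[OF elim, of e] by auto
      \<comment> \<open>An interval around \<open>f x\<close> is closed under midpoints, so the hull
        of a tail stays in it along with the tail.\<close>
      have "\<bar>w x - f x\<bar> < e" if "w \<in> H n" for w
        using that unfolding H_def
      proof induction
        case (base w) then show ?case using n by auto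
      next
        case (mid w1 w2) then show ?case by (auto simp: abs_if field_simps split: if_splits)
      qed
      then show "\<exists>no. \<forall>n\<ge>no. norm (v n x - f x) < e"
        using v(1) Hmono by (intro exI[of _ n]) (auto simp: subset_iff)
    qed
  qed
  define e where "e = \<eta> / (4 * (B + 1))"
  have B0: "0 \<le> B" using NB[OF Hne[of 0]] N0[of "u 0"] by linarith
  have e: "0 < e" "e * (2 * B) < \<eta> / 2" using eta B0 by (auto simp: e_def field_simps add_pos_nonneg add_nonneg_pos)
  obtain C where C: "0 \<le> C"
    "\<And>a b. \<bar>a - b\<bar> powr r \<le> e * (\<bar>a\<bar> powr r + \<bar>b\<bar> powr r)
       + C * ((\<bar>a\<bar> powr r + \<bar>b\<bar> powr r) / 2 - \<bar>(a + b) / 2\<bar> powr r)"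
    using abs_powr_uniform_convexity[OF r e(1)] by blast
  have key: "pint M r (\<lambda>x. v l x - v m x) \<le> e * (2 * B) + C * (D - d m + 1 / Suc m)" if lm: "m \<le> l" for l m
  proof -
    let ?a = "\<lambda>x. v l x - f x" and ?b = "\<lambda>x. v m x - f x"
    let ?w = "\<lambda>x. (v l x + v m x) / 2"
    \<comment> \<open>The midpoint stays in the larger hull \<open>H m\<close>, so its distance is
      at least \<open>d m\<close> while those of \<open>v l\<close> and \<open>v m\<close> hardly
      exceed \<open>D\<close>. This bounds the convexity gap.\<close>
    have wH: "?w \<in> H m" unfolding H_def
      by (rule mid_hull.mid) (use v(1) Hmono[OF lm] in \<open>auto simp: H_def[symmetric]\<close>)
    have ia: "?a \<in> Lp_space M r" and ib: "?b \<in> Lp_space M r" and iw: "(\<lambda>x. ?w x - f x) \<in> Lp_space M r"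
      and iab: "(\<lambda>x. ?a x - ?b x) \<in> Lp_space M r"
      using HL(1)[OF v(1)] HL(1)[OF wH] f r0 by (auto intro!: Lp_space_diff)
    note Ii = Lp_spaceD(2)[OF ia] Lp_spaceD(2)[OF ib] Lp_spaceD(2)[OF iw] Lp_spaceD(2)[OF iab]
    have "pint M r (\<lambda>x. ?a x - ?b x) \<le> (LINT x|M. e * (\<bar>?a x\<bar> powr r + \<bar>?b x\<bar> powr r)
       + C * ((\<bar>?a x\<bar> powr r + \<bar>?b x\<bar> powr r) / 2 - \<bar>?w x - f x\<bar> powr r))"
      unfolding pint_def
    proof (rule integral_mono)
      show "\<bar>?a x - ?b x\<bar> powr r \<le> e * (\<bar>?a x\<bar> powr r + \<bar>?b x\<bar> powr r)
       + C * ((\<bar>?a x\<bar> powr r + \<bar>?b x\<bar> powr r) / 2 - \<bar>?w x - f x\<bar> powr r)" for x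
      proof -
        have wx: "?w x - f x = (?a x + ?b x) / 2" by (simp add: field_simps)
        show ?thesis unfolding wx by (rule C(2))
      qed
    qed (use Ii in auto)
    also have "\<dots> = e * (N (v l) + N (v m)) + C * ((N (v l) + N (v m)) / 2 - N ?w)"
      unfolding N_def pint_def using Ii by simp
    also have "\<dots> \<le> e * (2 * B) + C * (D - d m + 1 / Suc m)"
    proof (intro add_mono mult_left_mono)
      show "N (v l) + N (v m) \<le> 2 * B" using NB[OF v(1)[of l]] NB[OF v(1)[of m]] by simp
      have "d m \<le> N ?w" by (rule dle[OF wH])
      moreover have "N (v l) < D + 1 / Suc m"
      proof -
        have "1 / real (Suc l) \<le> 1 / Suc m" using lm by (simp add: field_simps)
        then show ?thesis using v(2)[of l] D(2)[of l] by linarith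
      qed
      moreover have "N (v m) < D + 1 / Suc m" using v(2)[of m] D(2)[of m] by linarith
      ultimately show "(N (v l) + N (v m)) / 2 - N ?w \<le> D - d m + 1 / Suc m" by argo
    qed (use e C in auto)
    finally show ?thesis by simp
  qed
  have Nv: "N (v m) \<le> e * (2 * B) + C * (D - d m + 1 / Suc m)" for m
  proof -
    have eq: "N (v m) = pint M r (\<lambda>x. f x - v m x)"
      unfolding N_def pint_def by (simp add: abs_minus_commute)
    show ?thesis unfolding eq
    proof (rule Lp_fatou(2)[where u = "\<lambda>l x. v l x - v m x"])
      show "\<forall>\<^sub>F l in sequentially. pint M r (\<lambda>x. v l x - v m x) \<le> e * (2 * B) + C * (D - d m + 1 / Suc m)"
        using key by (auto simp: eventually_sequentially)
      show "AE x in M. (\<lambda>l. v l x - v m x) \<longlonglongrightarrow> f x - v m x"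
        using vf by eventually_elim (intro tendsto_intros)
    qed (use HL(1)[OF v(1)] f r0 r Lp_spaceD(1) in \<open>auto intro!: Lp_space_diff borel_measurable_diff\<close>)
  qed
  have "(\<lambda>m. e * (2 * B) + C * (D - d m + 1 / Suc m)) \<longlonglongrightarrow> e * (2 * B) + C * (D - D + 0)"
    using D(1) by (intro tendsto_intros LIMSEQ_Suc lim_1_over_n)
  then have "\<forall>\<^sub>F m in sequentially. e * (2 * B) + C * (D - d m + 1 / Suc m) < \<eta>"
    by (rule order_tendstoD) (use e eta in simp)
  then obtain m where "e * (2 * B) + C * (D - d m + 1 / Suc m) < \<eta>"
    using eventually_happens'[OF sequentially_bot] by blast
  then have "N (v m) < \<eta>" using Nv[of m] by linarith
  moreover have "v m \<in> mid_hull (range u)"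
    using v(1)[of m] mid_hull_mono[of "u ` {m..}" "range u"] unfolding H_def by auto
  ultimately show ?thesis using HL(1)[OF v(1)] unfolding N_def by blast
qed

section \<open>Minimisation on the Nehari set\<close>

text \<open>Frechet differentiability with derivative \<open>L\<close>, of which only homogeneity is
  recorded: it turns the expansion into directional quotients and gives the sign change under
  \<open>v\<close> to \<open>- v\<close>.\<close>

definition first_order_expansion ::
  "('a \<Rightarrow> real) set \<Rightarrow> (('a \<Rightarrow> real) \<Rightarrow> real) \<Rightarrow> (('a \<Rightarrow> real) \<Rightarrow> real) \<Rightarrow> ('a \<Rightarrow> real) \<Rightarrow>
    (('a \<Rightarrow> real) \<Rightarrow> real) \<Rightarrow> bool" where
  "first_order_expansion V N F u L \<longleftrightarrow>
     (\<forall>c v. L (\<lambda>x. c * v x) = c * L v) \<and>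
     (\<forall>e>0. \<exists>d>0. \<forall>v\<in>V. N v < d \<longrightarrow> \<bar>F (\<lambda>x. u x + v x) - F u - L v\<bar> \<le> e * N v)"

lemma first_order_expansion_quotient:
  assumes L: "first_order_expansion V N F u L" and v: "v \<in> V"
    and V: "\<And>c. (\<lambda>x. c * v x) \<in> V" and N: "\<And>c. N (\<lambda>x. c * v x) = \<bar>c\<bar> * N v" "0 \<le> N v"
  shows "((\<lambda>t. (F (\<lambda>x. u x + t * v x) - F u) / t) \<longlongrightarrow> L v) (at_right 0)"
proof (rule tendstoI)
  fix e :: real assume e: "0 < e"
  define e1 where "e1 = e / (2 * (N v + 1))"
  have e1: "0 < e1" "e1 * N v < e" using e N(2) mult_nonneg_nonneg[OF N(2), of e]
    by (auto simp: e1_def field_simps add_pos_nonneg add_nonneg_pos)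
  obtain d where d: "d > 0"
    "\<And>w. w \<in> V \<Longrightarrow> N w < d \<Longrightarrow> \<bar>F (\<lambda>x. u x + w x) - F u - L w\<bar> \<le> e1 * N w"
    using L e1(1) unfolding first_order_expansion_def by meson
  have "\<forall>\<^sub>F t in at_right 0. t < d / (N v + 1)"
    using d N by (intro eventually_at_rightI[of 0 "d / (N v + 1)"]) auto
  with eventually_at_right_less[of 0]
  show "\<forall>\<^sub>F t in at_right 0. dist ((F (\<lambda>x. u x + t * v x) - F u) / t) (L v) < e"
  proof eventually_elim
    case (elim t)
    have "t * N v < d" 
    proof -
      have "t * (N v + 1) < d" using elim N by (simp add: pos_less_divide_eq)
      then show ?thesis using elim by (simp add: algebra_simps)
    qed
    then have "\<bar>F (\<lambda>x. u x + t * v x) - F u - t * L v\<bar> \<le> e1 * (t * N v)"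
      using d(2)[OF V, of t] N elim L unfolding first_order_expansion_def by simp
    moreover have "(F (\<lambda>x. u x + t * v x) - F u) / t - L v = (F (\<lambda>x. u x + t * v x) - F u - t * L v) / t"
      using elim by (simp add: field_simps)
    ultimately have "\<bar>(F (\<lambda>x. u x + t * v x) - F u) / t - L v\<bar> \<le> e1 * N v"
      using elim by (simp add: field_simps)
    then show ?case using e1 by (simp add: dist_real_def)
  qed
qed

lemma first_order_quotient_imp_tendsto:
  fixes f :: "real \<Rightarrow> real"
  assumes "((\<lambda>t. (f t - a) / t) \<longlongrightarrow> l) (at_right 0)"
  shows "(f \<longlongrightarrow> a) (at_right 0)"
proof -
  have "((\<lambda>t. (f t - a) / t * t + a) \<longlongrightarrow> l * 0 + a) (at_right 0)"
    by (intro tendsto_intros assms)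
  moreover have "\<forall>\<^sub>F t in at_right 0. (f t - a) / t * t + a = f t"
    using eventually_at_right_less[of 0] by eventually_elim simp
  ultimately show ?thesis by (simp add: tendsto_cong)
qed

text \<open>Bernoulli's inequality for \<open>t powr p\<close> with exponent \<open>q / p\<close>.
  It is the reason why the energy on the ray of a Nehari point is largest at that point.\<close>

lemma powr_diff_quot_mono:
  fixes p q t :: real
  assumes "0 < p" "p < q" "0 < t"
  shows "(t powr p - 1) / p \<le> (t powr q - 1) / q"
proof -
  have "1 + q / p * (t powr p - 1) \<le> (t powr p) powr (q / p)"
    using powr_gt_tangent[of "q / p" "t powr p"] assms by (cases "t powr p = 1") auto
  also have "\<dots> = t powr q" using assms by (simp add: powr_powr)
  finally show ?thesis using assms by (simp add: field_simps)
qed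

text \<open>Dividing the Nehari equation of \<open>t * u\<close> by \<open>t powr p\<close> leaves a
  continuous function of \<open>t\<close> to which the intermediate value theorem applies. The lower
  end \<open>s = 0\<close> is allowed: since \<open>0 powr x = 0\<close> and \<open>0 < a\<close>,
  the solution is never 0.\<close>

lemma ray_hits_nehari:
  fixes a b c p q r s T :: real
  assumes "0 < a" "p < q" "q < r" "0 \<le> s" "s \<le> T"
    and "b * s powr (q - p) + c * s powr (r - p) \<le> a"
    and "a \<le> b * T powr (q - p) + c * T powr (r - p)"
  shows "\<exists>t. 0 < t \<and> s \<le> t \<and> t \<le> T \<and> t powr p * a = b * t powr q + c * t powr r"
proof -
  have "\<exists>t. s \<le> t \<and> t \<le> T \<and> b * t powr (q - p) + c * t powr (r - p) = a"
    using assms by (intro IVT' continuous_intros continuous_on_powr') auto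
  then obtain t where t: "s \<le> t" "t \<le> T" "b * t powr (q - p) + c * t powr (r - p) = a" by auto
  have t0: "0 < t" using t assms by (cases "t = 0") auto
  have "t powr p * a = b * (t powr p * t powr (q - p)) + c * (t powr p * t powr (r - p))"
    unfolding t(3)[symmetric] by (simp add: algebra_simps)
  then have "t powr p * a = b * t powr q + c * t powr r" by (simp flip: powr_add)
  with t t0 show ?thesis by blast
qed

text \<open>All that the variational argument uses of the three functionals.
  \<open>compactness\<close> combines the Brezis-Lieb splitting of \<open>A\<close> and
  \<open>C\<close> with genuine convergence of \<open>B\<close>; \<open>ex_pos\<close> is where a
  nonzero weight enters.\<close>

locale nehari =
  fixes D :: "('a \<Rightarrow> real) set" and A B C :: "('a \<Rightarrow> real) \<Rightarrow> real" and p q r cB cC :: real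
  assumes exps: "0 < p" "p < q" "q < r"
    and D_add: "\<And>u v. u \<in> D \<Longrightarrow> v \<in> D \<Longrightarrow> (\<lambda>x. u x + v x) \<in> D"
    and D_cmult: "\<And>c u. u \<in> D \<Longrightarrow> (\<lambda>x. c * u x) \<in> D"
    and nonneg: "\<And>u. 0 \<le> A u" "\<And>u. 0 \<le> B u" "\<And>u. 0 \<le> C u"
    and hom: "\<And>c u. A (\<lambda>x. c * u x) = \<bar>c\<bar> powr p * A u"
      "\<And>c u. B (\<lambda>x. c * u x) = \<bar>c\<bar> powr q * B u"
      "\<And>c u. C (\<lambda>x. c * u x) = \<bar>c\<bar> powr r * C u"
    and cBC: "0 \<le> cB" "0 \<le> cC"
    and bounds: "\<And>u. u \<in> D \<Longrightarrow> B u \<le> cB * A u powr (q / p)"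
      "\<And>u. u \<in> D \<Longrightarrow> C u \<le> cC * A u powr (r / p)"
    and expansions:
      "\<And>u. u \<in> D \<Longrightarrow> \<exists>L. first_order_expansion D (\<lambda>v. A v powr (1 / p)) A u L"
      "\<And>u. u \<in> D \<Longrightarrow> \<exists>L. first_order_expansion D (\<lambda>v. A v powr (1 / p)) B u L"
      "\<And>u. u \<in> D \<Longrightarrow> \<exists>L. first_order_expansion D (\<lambda>v. A v powr (1 / p)) C u L"
    and compactness: "\<And>(u :: nat \<Rightarrow> 'a \<Rightarrow> real) M. (\<And>k. u k \<in> D) \<Longrightarrow> (\<And>k. A (u k) \<le> M) \<Longrightarrow>
      \<exists>\<rho> w. strict_mono \<rho> \<and> w \<in> D \<and>
        (\<lambda>k. A (u (\<rho> k)) - A (\<lambda>x. u (\<rho> k) x - w x)) \<longlonglongrightarrow> A w \<and>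
        (\<lambda>k. C (u (\<rho> k)) - C (\<lambda>x. u (\<rho> k) x - w x)) \<longlonglongrightarrow> C w \<and>
        (\<lambda>k. B (u (\<rho> k))) \<longlonglongrightarrow> B w"
    and ex_pos: "\<exists>u\<in>D. 0 < B u"
begin

definition F :: "real \<Rightarrow> ('a \<Rightarrow> real) \<Rightarrow> real" where
  "F lam u = A u / p - lam / q * B u - 1 / r * C u"

text \<open>The condition \<open>0 < B u\<close> replaces nonvanishing of \<open>u\<close>: it
  forces \<open>0 < A u\<close> and excludes functions with \<open>B u = 0\<close>, on whose energy
  \<open>lam\<close> has no influence.\<close>

definition nehari_set :: "real \<Rightarrow> ('a \<Rightarrow> real) set" where
  "nehari_set lam = {u \<in> D. 0 < B u \<and> A u = lam * B u + C u}"

section \<open>The energy along rays and its first variation at a minimiser\<close>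

lemma A_pos: "u \<in> D \<Longrightarrow> 0 < B u \<Longrightarrow> 0 < A u"
  using bounds(1)[of u] nonneg(1)[of u] exps by (cases "A u = 0") auto

text \<open>Eliminating \<open>lam * B u\<close> leaves two positive coefficients, so on the Nehari
  set the energy is nonnegative and controls \<open>A\<close>.\<close>

lemma F_nehari:
  assumes "u \<in> nehari_set lam"
  shows "F lam u = (1 / p - 1 / q) * A u + (1 / q - 1 / r) * C u"
proof -
  have "lam * B u = A u - C u" using assms by (simp add: nehari_set_def)
  then have "lam / q * B u = (A u - C u) / q" by simp
  then show ?thesis unfolding F_def by (simp add: algebra_simps diff_divide_distrib)
qed

lemma F_cmult:
  assumes "0 < t"
  shows "F lam (\<lambda>x. t * u x) = t powr p * A u / p - lam / q * (t powr q * B u) - 1 / r * (t powr r * C u)"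
  using assms by (simp add: F_def hom)

lemma nehari_set_cmultI:
  assumes "u \<in> D" "0 < B u" "0 < t" "t powr p * A u = lam * B u * t powr q + C u * t powr r"
  shows "(\<lambda>x. t * u x) \<in> nehari_set lam"
  using assms D_cmult by (auto simp: nehari_set_def hom mult_ac)

text \<open>Once \<open>A u\<close> is replaced by \<open>lam * B u + C u\<close>, the difference of
  energies is a combination, with nonnegative weights, of the differences compared in
  \<open>powr_diff_quot_mono\<close>.\<close>

lemma F_ray_le:
  assumes "u \<in> nehari_set lam" "0 < t" "0 \<le> lam"
  shows "F lam (\<lambda>x. t * u x) \<le> F lam u"
proof -
  have Au: "A u = lam * B u + C u" using assms by (simp add: nehari_set_def)
  have "F lam (\<lambda>x. t * u x) - F lam u
    = lam * B u * ((t powr p - 1) / p - (t powr q - 1) / q) + C u * ((t powr p - 1) / p - (t powr r - 1) / r)"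
    unfolding F_cmult[OF assms(2)] unfolding F_def Au
    by (simp add: algebra_simps add_divide_distrib diff_divide_distrib)
  also have "\<dots> \<le> 0"
    using powr_diff_quot_mono[of p q t] powr_diff_quot_mono[of p r t] exps assms nonneg
    by (intro add_nonpos_nonpos mult_nonneg_nonpos) auto
  finally show ?thesis by simp
qed

text \<open>For small \<open>\<tau> > 0\<close> the ray through \<open>z + \<tau> v\<close> meets the Nehari set at some \<open>t (z + \<tau> v)\<close> with
  \<open>t\<close> close to \<open>1\<close>, and then \<open>F (t (z + \<tau> v)) \<ge> F z \<ge> F (t z)\<close>.\<close>

lemma minimiser_derivative_nonneg:
  assumes z: "z \<in> nehari_set lam" and lam: "0 < lam"
    and min: "\<And>u. u \<in> nehari_set lam \<Longrightarrow> F lam z \<le> F lam u"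
    and v: "v \<in> D"
    and L: "first_order_expansion D (\<lambda>v. A v powr (1 / p)) A z LA"
      "first_order_expansion D (\<lambda>v. A v powr (1 / p)) B z LB"
      "first_order_expansion D (\<lambda>v. A v powr (1 / p)) C z LC"
  shows "0 \<le> LA v / p - lam / q * LB v - 1 / r * LC v"
proof (rule ccontr)
  assume neg: "\<not> ?thesis"
  have zD: "z \<in> D" "0 < B z" "A z = lam * B z + C z" using z by (auto simp: nehari_set_def)
  define u where "u \<tau> = (\<lambda>x. z x + \<tau> * v x)" for \<tau>
  have uD: "u \<tau> \<in> D" for \<tau> unfolding u_def by (intro D_add D_cmult zD v)
  have Nc: "A (\<lambda>x. c * v x) powr (1 / p) = \<bar>c\<bar> * A v powr (1 / p)" for c
    using exps by (simp add: hom powr_mult powr_powr)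
  note quot = first_order_expansion_quotient[OF _ v D_cmult[OF v] Nc powr_ge_zero]
  define dA where "dA \<tau> = (A (u \<tau>) - A z) / \<tau>" for \<tau>
  define dB where "dB \<tau> = (B (u \<tau>) - B z) / \<tau>" for \<tau>
  define dC where "dC \<tau> = (C (u \<tau>) - C z) / \<tau>" for \<tau>
  have dl: "(dA \<longlongrightarrow> LA v) (at_right 0)" "(dB \<longlongrightarrow> LB v) (at_right 0)" "(dC \<longlongrightarrow> LC v) (at_right 0)"
    unfolding dA_def dB_def dC_def u_def using quot L by blast+
  have l: "((\<lambda>\<tau>. A (u \<tau>)) \<longlongrightarrow> A z) (at_right 0)" "((\<lambda>\<tau>. B (u \<tau>)) \<longlongrightarrow> B z) (at_right 0)"
    "((\<lambda>\<tau>. C (u \<tau>)) \<longlongrightarrow> C z) (at_right 0)"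
    using dl unfolding dA_def dB_def dC_def by (auto intro: first_order_quotient_imp_tendsto)
  \<comment> \<open>\<open>?G t \<tau>\<close> is the difference of the energies of
    \<open>t * u \<tau>\<close> and \<open>t * z\<close>, divided by \<tau>. The product filter lets
    \<open>t\<close> vary independently of \<tau>, since the parameter at which the ray crosses is
    only known to be close to 1.\<close>
  let ?G = "\<lambda>t \<tau>. t powr p * dA \<tau> / p - lam / q * (t powr q * dB \<tau>) - 1 / r * (t powr r * dC \<tau>)"
  have "((\<lambda>(t, \<tau>). ?G t \<tau>) \<longlongrightarrow> 1 powr p * LA v / p - lam / q * (1 powr q * LB v) - 1 / r * (1 powr r * LC v))
     (nhds 1 \<times>\<^sub>F at_right 0)"
    unfolding case_prod_beta using exps
    by (intro tendsto_intros filterlim_compose[OF dl(1) filterlim_snd]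
        filterlim_compose[OF dl(2) filterlim_snd] filterlim_compose[OF dl(3) filterlim_snd]
        filterlim_fst) auto
  then have "\<forall>\<^sub>F x in nhds 1 \<times>\<^sub>F at_right 0. (\<lambda>(t, \<tau>). ?G t \<tau>) x < 0"
    using neg by (intro order_tendstoD) auto
  then obtain P Q where PQ: "eventually P (nhds 1)" "eventually Q (at_right 0)"
    "\<And>t \<tau>. P t \<Longrightarrow> Q \<tau> \<Longrightarrow> ?G t \<tau> < 0"
    unfolding eventually_prod_filter by auto
  then obtain d0 where d0: "d0 > 0" "\<And>t. \<bar>t - 1\<bar> < d0 \<Longrightarrow> P t"
    unfolding eventually_nhds_metric by (auto simp: dist_real_def)
  define d where "d = min (d0 / 2) (1 / 2)"
  have d: "0 < d" "d < 1" "\<And>t. \<bar>t - 1\<bar> \<le> d \<Longrightarrow> P t" using d0 by (auto simp: d_def)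
  have lim2: "((\<lambda>\<tau>. lam * B (u \<tau>) * t powr (q - p) + C (u \<tau>) * t powr (r - p) - A (u \<tau>)) \<longlongrightarrow>
     lam * B z * t powr (q - p) + C z * t powr (r - p) - A z) (at_right 0)" for t
    by (intro tendsto_intros l)
  \<comment> \<open>Because \<open>lam * B z > 0\<close>, the ray equation of \<open>z\<close> is
    strict on either side of \<open>t = 1\<close>. For small \<tau> both signs persist and trap a
    crossing of the perturbed ray between \<open>1 - d\<close> and \<open>1 + d\<close>.\<close>
  have up: "0 < lam * B z * (1 + d) powr (q - p) + C z * (1 + d) powr (r - p) - A z"
  proof -
    have "1 < (1 + d) powr (q - p)" "1 \<le> (1 + d) powr (r - p)"
      using d exps by (auto intro!: gr_one_powr ge_one_powr_ge_zero)
    then have "lam * B z * 1 < lam * B z * (1 + d) powr (q - p)" "C z * 1 \<le> C z * (1 + d) powr (r - p)"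
      using lam zD nonneg by (intro mult_strict_left_mono mult_left_mono; simp)+
    then show ?thesis using zD by linarith
  qed
  have dn: "lam * B z * (1 - d) powr (q - p) + C z * (1 - d) powr (r - p) - A z < 0"
  proof -
    have "(1 - d) powr (q - p) < 1 powr (q - p)" "(1 - d) powr (r - p) \<le> 1 powr (r - p)"
      using d exps by (intro powr_less_mono2 powr_mono2; simp)+
    then have "lam * B z * (1 - d) powr (q - p) < lam * B z * 1" "C z * (1 - d) powr (r - p) \<le> C z * 1"
      using lam zD nonneg by (intro mult_strict_left_mono mult_left_mono; simp)+
    then show ?thesis using zD by linarith
  qed
  \<comment> \<open>The claim \<tau> < 0 stands for a contradiction, as \<tau> is positive to the
    right of 0.\<close>
  have "\<forall>\<^sub>F \<tau> in at_right 0. \<tau> < (0 :: real)"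
    using order_tendstoD(1)[OF lim2 up] order_tendstoD(2)[OF lim2 dn] PQ(2)
      order_tendstoD(1)[OF l(2) zD(2)] eventually_at_right_less[of 0]
  proof eventually_elim
    case (elim \<tau>)
    have Apos: "0 < A (u \<tau>)" using A_pos[OF uD] elim by simp
    obtain t where t: "0 < t" "1 - d \<le> t" "t \<le> 1 + d"
      "t powr p * A (u \<tau>) = lam * B (u \<tau>) * t powr q + C (u \<tau>) * t powr r"
      using ray_hits_nehari[of "A (u \<tau>)" p q r "1 - d" "1 + d" "lam * B (u \<tau>)" "C (u \<tau>)"] Apos exps d elim
      by auto
    have "F lam z \<le> F lam (\<lambda>x. t * u \<tau> x)"
      using t elim by (intro min nehari_set_cmultI uD) auto
    moreover have "F lam (\<lambda>x. t * z x) \<le> F lam z" using F_ray_le[OF z] t lam by simp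
    moreover have "F lam (\<lambda>x. t * u \<tau> x) - F lam (\<lambda>x. t * z x) = \<tau> * ?G t \<tau>"
      unfolding F_cmult[OF t(1)] dA_def dB_def dC_def using elim exps by (simp add: field_simps)
    moreover have "?G t \<tau> < 0" using PQ(3) d(3) t elim by (simp add: abs_le_iff)
    then have "\<tau> * ?G t \<tau> < 0" using elim by (intro mult_pos_neg) auto
    ultimately show ?case by linarith
  qed
  then obtain b :: real where "0 < b" "\<And>y. 0 < y \<Longrightarrow> y < b \<Longrightarrow> y < 0"
    unfolding eventually_at_right_field by blast
  from this(2)[of "b / 2"] this(1) show False by simp
qed

text \<open>The one-sided inequality for \<open>v\<close> and for \<open>- v\<close> makes the
  derivative vanish in every direction, not only along the Nehari set. What remains of the energy is
  the sum of three error terms with weights adding up to \<open>K\<close>.\<close>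

lemma minimiser_critical:
  assumes z: "z \<in> nehari_set lam" and lam: "0 < lam"
    and min: "\<And>u. u \<in> nehari_set lam \<Longrightarrow> F lam z \<le> F lam u"
    and e: "0 < e"
  shows "\<exists>d>0. \<forall>v\<in>D. A v powr (1 / p) < d \<longrightarrow>
    \<bar>F lam (\<lambda>x. z x + v x) - F lam z\<bar> \<le> e * A v powr (1 / p)"
proof -
  have zD: "z \<in> D" using z by (auto simp: nehari_set_def)
  let ?N = "\<lambda>v. A v powr (1 / p)"
  obtain LA LB LC where L: "first_order_expansion D ?N A z LA"
      "first_order_expansion D ?N B z LB" "first_order_expansion D ?N C z LC"
    using expansions[OF zD] by blast
  define L where "L v = LA v / p - lam / q * LB v - 1 / r * LC v" for v
  have Lm: "L (\<lambda>x. (- 1) * v x) = - L v" for v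
  proof -
    have "LA (\<lambda>x. (- 1) * v x) = (-1) * LA v" "LB (\<lambda>x. (- 1) * v x) = (-1) * LB v"
      "LC (\<lambda>x. (- 1) * v x) = (-1) * LC v"
      using L unfolding first_order_expansion_def by blast+
    then show ?thesis unfolding L_def by simp
  qed
  have L0: "L v = 0" if v: "v \<in> D" for v
    using minimiser_derivative_nonneg[OF z lam min v L]
      minimiser_derivative_nonneg[OF z lam min D_cmult[OF v, of "- 1"] L] Lm[of v]
    unfolding L_def by linarith
  define K where "K = 1 / p + lam / q + 1 / r"
  have K: "K > 0" using exps lam by (auto simp: K_def intro!: add_pos_pos)
  have eK: "e / K > 0" using e K by simp
  obtain d1 where d1: "d1 > 0" "\<And>v. v \<in> D \<Longrightarrow> ?N v < d1 \<Longrightarrow> \<bar>A (\<lambda>x. z x + v x) - A z - LA v\<bar> \<le> e / K * ?N v"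
    using L(1) eK unfolding first_order_expansion_def by meson
  obtain d2 where d2: "d2 > 0" "\<And>v. v \<in> D \<Longrightarrow> ?N v < d2 \<Longrightarrow> \<bar>B (\<lambda>x. z x + v x) - B z - LB v\<bar> \<le> e / K * ?N v"
    using L(2) eK unfolding first_order_expansion_def by meson
  obtain d3 where d3: "d3 > 0" "\<And>v. v \<in> D \<Longrightarrow> ?N v < d3 \<Longrightarrow> \<bar>C (\<lambda>x. z x + v x) - C z - LC v\<bar> \<le> e / K * ?N v"
    using L(3) eK unfolding first_order_expansion_def by meson
  have "\<bar>F lam (\<lambda>x. z x + v x) - F lam z\<bar> \<le> e * ?N v"
    if v: "v \<in> D" "?N v < min d1 (min d2 d3)" for v
  proof -
    let ?a = "A (\<lambda>x. z x + v x) - A z - LA v" and ?b = "B (\<lambda>x. z x + v x) - B z - LB v"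
      and ?c = "C (\<lambda>x. z x + v x) - C z - LC v"
    have "F lam (\<lambda>x. z x + v x) - F lam z = 1 / p * ?a - lam / q * ?b - 1 / r * ?c + L v"
      unfolding F_def L_def by (simp add: algebra_simps diff_divide_distrib)
    then have "\<bar>F lam (\<lambda>x. z x + v x) - F lam z\<bar> \<le> \<bar>1 / p * ?a\<bar> + \<bar>lam / q * ?b\<bar> + \<bar>1 / r * ?c\<bar>"
      using L0[OF v(1)] by linarith
    also have "\<dots> = 1 / p * \<bar>?a\<bar> + lam / q * \<bar>?b\<bar> + 1 / r * \<bar>?c\<bar>"
      unfolding abs_mult using exps lam by simp
    also have "\<dots> \<le> 1 / p * (e / K * ?N v) + lam / q * (e / K * ?N v) + 1 / r * (e / K * ?N v)"
      using d1(2)[OF v(1)] d2(2)[OF v(1)] d3(2)[OF v(1)] v(2) exps lam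
      by (intro add_mono mult_left_mono) auto
    also have "\<dots> = K * (e / K * ?N v)" unfolding K_def by (simp only: distrib_right)
    also have "\<dots> = e * ?N v" using K by simp
    finally show ?thesis .
  qed
  then show ?thesis using d1(1) d2(1) d3(1) by (intro exI[of _ "min d1 (min d2 d3)"]) auto
qed

text \<open>As \<open>r > p\<close>, \<open>C u\<close> is at most
  \<open>cC * A u powr ((r - p) / p)\<close> times \<open>A u\<close>, and \<open>a0\<close> makes
  the first factor at most 1/2.\<close>

lemma C_le_half_A:
  obtains a0 where "0 < a0" "\<And>u. u \<in> D \<Longrightarrow> A u \<le> a0 \<Longrightarrow> C u \<le> A u / 2"
proof -
  define a0 where "a0 = (1 / (2 * (cC + 1))) powr (p / (r - p))"
  have a0: "0 < a0" using cBC by (simp add: a0_def)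
  have "C u \<le> A u / 2" if u: "u \<in> D" "A u \<le> a0" for u
  proof -
    have "A u powr ((r - p) / p) \<le> a0 powr ((r - p) / p)"
      using u nonneg exps by (intro powr_mono2) auto
    also have "\<dots> = 1 / (2 * (cC + 1))" using exps cBC by (simp add: a0_def powr_powr)
    finally have 1: "A u powr ((r - p) / p) \<le> 1 / (2 * (cC + 1))" .
    have "r / p = 1 + (r - p) / p" using exps by (simp add: field_simps)
    then have "A u powr (r / p) = A u * A u powr ((r - p) / p)"
      using nonneg(1)[of u] by (simp add: powr_add)
    then have "C u \<le> cC * (A u * A u powr ((r - p) / p))" using bounds(2)[OF u(1)] by simp
    also have "\<dots> \<le> cC * (A u * (1 / (2 * (cC + 1))))"
      using 1 nonneg cBC by (intro mult_left_mono) auto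
    also have "\<dots> \<le> A u / 2" using cBC nonneg(1)[of u] by (simp add: field_simps)
    finally show ?thesis .
  qed
  with a0 that show ?thesis by blast
qed

lemma nehari_level_small:
  assumes eps: "0 < eps"
  obtains lam0 where "0 < lam0" "\<And>lam. lam0 < lam \<Longrightarrow> \<exists>u\<in>nehari_set lam. F lam u < eps"
proof -
  obtain f where f: "f \<in> D" "0 < B f" using ex_pos by blast
  have Af: "0 < A f" using A_pos f by blast
  \<comment> \<open>The value of \<open>T powr (q - p)\<close> for which
    \<open>T powr p * A f / p\<close> equals \<open>eps\<close>; \<open>lam0\<close> is the
    parameter at which \<open>A f / (lam * B f)\<close> has fallen to \<open>h\<close>.\<close>
  define h where "h = (eps * p / A f) powr ((q - p) / p)"
  have h: "0 < h" using eps exps Af by (simp add: h_def)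
  define lam0 where "lam0 = A f / (B f * h)"
  have lam0: "0 < lam0" using Af f h by (simp add: lam0_def)
  have "\<exists>u\<in>nehari_set lam. F lam u < eps" if lam: "lam0 < lam" for lam
  proof -
    have lp: "0 < lam" using lam lam0 by linarith
    have hl: "A f / (lam * B f) < h" using lam lp f h by (simp add: lam0_def field_simps)
    \<comment> \<open>At \<open>T\<close> the term with \<open>B\<close> alone balances
      \<open>A\<close>, so the ray crosses the Nehari set no later than there.\<close>
    define T where "T = (A f / (lam * B f)) powr (1 / (q - p))"
    have T: "0 < T" using Af lp f by (simp add: T_def)
    have TT: "T powr (q - p) = A f / (lam * B f)"
      using exps Af lp f by (simp add: T_def powr_powr)
    obtain t where t: "0 < t" "t \<le> T" "t powr p * A f = lam * B f * t powr q + C f * t powr r"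
      using ray_hits_nehari[of "A f" p q r 0 T "lam * B f" "C f"] Af exps T TT nonneg lp f by auto
    have "t powr p \<le> (T powr (q - p)) powr (p / (q - p))"
      using t exps by (simp add: powr_powr powr_mono2)
    also have "\<dots> < h powr (p / (q - p))"
      unfolding TT using hl exps Af lp f by (intro powr_less_mono2) auto
    also have "\<dots> = eps * p / A f" using exps eps Af by (simp add: h_def powr_powr)
    finally have tp: "t powr p * A f / p < eps" using Af exps by (simp add: field_simps)
    have "F lam (\<lambda>x. t * f x) \<le> t powr p * A f / p"
    proof -
      have "0 \<le> lam / q * (t powr q * B f)" "0 \<le> 1 / r * (t powr r * C f)"
        using lp exps nonneg by auto
      then show ?thesis unfolding F_cmult[OF t(1)] by linarith
    qed
    then show ?thesis using tp nehari_set_cmultI[OF f t(1,3)] by (intro bexI) auto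
  qed
  with lam0 that show ?thesis by blast
qed

text \<open>A level below \<open>(1 / p - 1 / q) * a0\<close> keeps the limit \<open>a\<close> of
  \<open>A\<close> along the minimising sequence below \<open>a0\<close>. The bound on
  \<open>C\<close> is then available eventually both for the sequence and for its difference from
  the limit \<open>w\<close>.\<close>

lemma nehari_minimiser:
  assumes a0: "0 < a0" "\<And>u. u \<in> D \<Longrightarrow> A u \<le> a0 \<Longrightarrow> C u \<le> A u / 2"
    and lam: "0 < lam" and small: "\<exists>u\<in>nehari_set lam. F lam u < (1 / p - 1 / q) * a0"
  obtains z where "z \<in> nehari_set lam" "\<And>u. u \<in> nehari_set lam \<Longrightarrow> F lam z \<le> F lam u"
proof -
  define k1 where "k1 = 1 / p - 1 / q"
  define k2 where "k2 = 1 / q - 1 / r"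
  have k: "0 < k1" "0 < k2" using exps by (auto simp: k1_def k2_def field_simps)
  have FN: "F lam u = k1 * A u + k2 * C u" if "u \<in> nehari_set lam" for u
    using F_nehari[OF that] by (simp add: k1_def k2_def)
  define m where "m = Inf (F lam ` nehari_set lam)"
  have F0: "0 \<le> F lam u" if "u \<in> nehari_set lam" for u using FN[OF that] k nonneg by simp
  have bdd: "bdd_below (F lam ` nehari_set lam)" using F0 by (intro bdd_belowI[of _ 0]) auto
  have mle: "m \<le> F lam u" if "u \<in> nehari_set lam" for u
    unfolding m_def using that bdd by (intro cInf_lower) auto
  have msmall: "m < k1 * a0" using small mle unfolding k1_def by force
  have "\<exists>u\<in>nehari_set lam. F lam u < m + 1 / real (Suc k)" for k
  proof -
    have "\<exists>y\<in>F lam ` nehari_set lam. y < m + 1 / real (Suc k)"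
      using small bdd unfolding m_def by (intro cInf_lessD) auto
    then show ?thesis by auto
  qed
  then obtain u where u: "\<And>k. u k \<in> nehari_set lam" "\<And>k. F lam (u k) < m + 1 / real (Suc k)" by metis
  have uD: "u k \<in> D" "0 < B (u k)" "A (u k) = lam * B (u k) + C (u k)" for k
    using u(1)[of k] by (auto simp: nehari_set_def)
  have Ab: "A (u k) \<le> (m + 1) / k1" for k
  proof -
    have "k1 * A (u k) \<le> F lam (u k)" using FN[OF u(1)] k nonneg by simp
    also have "\<dots> \<le> m + 1" 
    proof -
      have "1 / real (Suc k) \<le> 1" by simp
      then show ?thesis using u(2)[of k] by linarith
    qed
    finally show ?thesis using k by (simp add: field_simps)
  qed
  obtain \<rho>1 w where w: "strict_mono \<rho>1" "w \<in> D"
    "(\<lambda>k. A (u (\<rho>1 k)) - A (\<lambda>x. u (\<rho>1 k) x - w x)) \<longlonglongrightarrow> A w"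
    "(\<lambda>k. C (u (\<rho>1 k)) - C (\<lambda>x. u (\<rho>1 k) x - w x)) \<longlonglongrightarrow> C w"
    "(\<lambda>k. B (u (\<rho>1 k))) \<longlonglongrightarrow> B w"
    using compactness[of u, OF uD(1) Ab] by (elim exE conjE) (rule that)
  have "bounded (range (\<lambda>k. A (u (\<rho>1 k))))"
    using Ab nonneg by (intro boundedI[of _ "(m + 1) / k1"]) auto
  then obtain a \<rho>2 where \<rho>2: "strict_mono \<rho>2" "((\<lambda>k. A (u (\<rho>1 k))) \<circ> \<rho>2) \<longlonglongrightarrow> a"
    using bounded_imp_convergent_subsequence by blast
  define y where "y k = u (\<rho>1 (\<rho>2 k))" for k
  have yN: "y k \<in> nehari_set lam" for k by (simp add: y_def u)
  have yD: "y k \<in> D" "0 < B (y k)" "A (y k) = lam * B (y k) + C (y k)" for k by (simp_all add: y_def uD)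
  have Ay: "(\<lambda>k. A (y k)) \<longlonglongrightarrow> a" using \<rho>2(2) by (simp add: y_def o_def)
  have By: "(\<lambda>k. B (y k)) \<longlonglongrightarrow> B w"
    using LIMSEQ_subseq_LIMSEQ[OF w(5) \<rho>2(1)] by (simp add: y_def o_def)
  \<comment> \<open>Once \<open>A\<close> and \<open>B\<close> converge, the Nehari constraint
    dictates the limit of \<open>C\<close>.\<close>
  define c where "c = a - lam * B w"
  have Cy: "(\<lambda>k. C (y k)) \<longlonglongrightarrow> c"
  proof -
    have "(\<lambda>k. A (y k) - lam * B (y k)) \<longlonglongrightarrow> c" unfolding c_def by (intro tendsto_intros Ay By)
    then show ?thesis using yD(3) by simp
  qed
  have Fm: "k1 * a + k2 * c = m"
  proof -
    have 1: "(\<lambda>k. F lam (y k)) \<longlonglongrightarrow> k1 * a + k2 * c"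
      unfolding FN[OF yN] by (intro tendsto_intros Ay Cy)
    have s: "strict_mono (\<lambda>k. \<rho>1 (\<rho>2 k))" using strict_mono_o[OF w(1) \<rho>2(1)] by (simp add: o_def)
    have "(\<lambda>k. m + 1 / real (Suc k)) \<longlonglongrightarrow> m + 0"
      by (intro tendsto_intros LIMSEQ_Suc lim_1_over_n)
    from LIMSEQ_subseq_LIMSEQ[OF this s]
    have 2: "(\<lambda>k. m + 1 / real (Suc (\<rho>1 (\<rho>2 k)))) \<longlonglongrightarrow> m" by (simp add: o_def)
    have "(\<lambda>k. F lam (y k)) \<longlonglongrightarrow> m"
    proof (rule tendsto_sandwich[OF _ _ tendsto_const 2])
      show "\<forall>\<^sub>F k in sequentially. m \<le> F lam (y k)" using mle[OF yN] by simp
      show "\<forall>\<^sub>F k in sequentially. F lam (y k) \<le> m + 1 / real (Suc (\<rho>1 (\<rho>2 k)))"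
        using u(2) unfolding y_def by (intro always_eventually allI less_imp_le)
    qed
    with 1 show ?thesis by (rule LIMSEQ_unique)
  qed
  have c0: "0 \<le> c" using Cy nonneg by (intro LIMSEQ_le_const[OF Cy]) auto
  have a_ge: "0 \<le> a" using nonneg by (intro LIMSEQ_le_const[OF Ay]) auto
  have aa0: "a < a0"
  proof -
    have "k1 * a < k1 * a0" using Fm msmall c0 k mult_nonneg_nonneg[of k2 c] by linarith
    then show ?thesis using k by simp
  qed
  have Aw: "(\<lambda>k. A (\<lambda>x. y k x - w x)) \<longlonglongrightarrow> a - A w"
  proof -
    have "(\<lambda>k. A (y k) - (A (y k) - A (\<lambda>x. y k x - w x))) \<longlonglongrightarrow> a - A w"
      using LIMSEQ_subseq_LIMSEQ[OF w(3) \<rho>2(1)] by (intro tendsto_intros Ay) (simp add: y_def o_def)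
    then show ?thesis by simp
  qed
  have Cw: "(\<lambda>k. C (\<lambda>x. y k x - w x)) \<longlonglongrightarrow> c - C w"
  proof -
    have "(\<lambda>k. C (y k) - (C (y k) - C (\<lambda>x. y k x - w x))) \<longlonglongrightarrow> c - C w"
      using LIMSEQ_subseq_LIMSEQ[OF w(4) \<rho>2(1)] by (intro tendsto_intros Cy) (simp add: y_def o_def)
    then show ?thesis by simp
  qed
  have yw: "(\<lambda>x. y k x - w x) \<in> D" for k
    using D_add[OF yD(1) D_cmult[OF w(2), of "- 1"]] by simp
  have al: "0 \<le> a - A w" using nonneg by (intro LIMSEQ_le_const[OF Aw]) auto
  have ga: "0 \<le> c - C w" using nonneg by (intro LIMSEQ_le_const[OF Cw]) auto
  \<comment> \<open>The remainder \<open>y k - w\<close> has \<open>A\<close> tending to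
    \<open>a - A w\<close>, which is at most \<open>a\<close> and hence below \<open>a0\<close>, so
    \<open>a0(2)\<close> applies to the escaping part.\<close>
  have "c - C w \<le> (a - A w) / 2"
  proof (rule tendsto_le[OF sequentially_bot _ Cw])
    show "(\<lambda>k. A (\<lambda>x. y k x - w x) / 2) \<longlonglongrightarrow> (a - A w) / 2" by (intro tendsto_intros Aw) auto
    have "a - A w < a0" using aa0 nonneg(1)[of w] by linarith
    from order_tendstoD(2)[OF Aw this]
    show "\<forall>\<^sub>F k in sequentially. C (\<lambda>x. y k x - w x) \<le> A (\<lambda>x. y k x - w x) / 2"
      by eventually_elim (use a0(2)[OF yw] in auto)
  qed
  then have gal: "c - C w \<le> a - A w" using al field_sum_of_halves[of "a - A w"] by linarith
  have half: "\<forall>\<^sub>F k in sequentially. A (y k) / 2 \<le> lam * B (y k)"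
    using order_tendstoD(2)[OF Ay aa0] by eventually_elim (use a0(2)[OF yD(1)] yD(3) in \<open>smt (verit) field_sum_of_halves\<close>)
  \<comment> \<open>Dividing \<open>A / 2 \<le> lam * B\<close> by \<open>A\<close> gives
    \<open>1 / 2 \<le> lam * cB * A powr ((q - p) / p)\<close>; since \<open>q > p\<close>, the
    right side would vanish in the limit.\<close>
  have "a \<noteq> 0"
  proof
    assume a: "a = 0"
    have "(\<lambda>k. lam * cB * A (y k) powr ((q - p) / p)) \<longlonglongrightarrow> lam * cB * 0 powr ((q - p) / p)"
      using Ay a exps nonneg by (intro tendsto_intros tendsto_powr') auto
    moreover have "\<forall>\<^sub>F k in sequentially. 1 / 2 \<le> lam * cB * A (y k) powr ((q - p) / p)"
      using half
    proof eventually_elim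
      case (elim k)
      have Ap: "0 < A (y k)" using A_pos yD by blast
      have "q / p = 1 + (q - p) / p" using exps by (simp add: field_simps)
      then have e: "A (y k) powr (q / p) = A (y k) * A (y k) powr ((q - p) / p)"
        using Ap by (simp add: powr_add)
      have "lam * B (y k) \<le> lam * (cB * A (y k) powr (q / p))"
        using bounds(1)[OF yD(1)] lam by (intro mult_left_mono) auto
      then have "A (y k) * (1 / 2) \<le> A (y k) * (lam * cB * A (y k) powr ((q - p) / p))"
        using elim unfolding e by (simp add: mult_ac)
      then show ?case using Ap by (simp only: mult_le_cancel_left_pos)
    qed
    ultimately have "1 / 2 \<le> lam * cB * 0 powr ((q - p) / p)"
      by (intro tendsto_lowerbound) auto
    then show False by simp
  qed
  then have apos: "0 < a" using a_ge by simp
  have "a / 2 \<le> lam * B w"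
    using Ay By by (intro tendsto_le[OF sequentially_bot _ _ half] tendsto_intros) auto
  then have Bw: "0 < B w" using apos lam by (simp add: zero_less_mult_iff) (smt (verit) mult_nonneg_nonpos half_gt_zero)
  have Awp: "0 < A w" using A_pos w(2) Bw by blast
  \<comment> \<open>With the value of \<open>c\<close> inserted, this is the comparison
    \<open>gal\<close> of the escaping masses. It places the crossing of the ray of \<open>w\<close>
    at some \<open>t \<le> 1\<close>.\<close>
  have "A w \<le> lam * B w + C w" using gal by (simp add: c_def)
  then obtain t where t: "0 < t" "t \<le> 1" "t powr p * A w = lam * B w * t powr q + C w * t powr r"
    using ray_hits_nehari[of "A w" p q r 0 1 "lam * B w" "C w"] Awp exps by auto
  let ?z = "\<lambda>x. t * w x"
  have zN: "?z \<in> nehari_set lam" using nehari_set_cmultI[OF w(2) Bw t(1,3)] .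
  have "F lam ?z = k1 * (t powr p * A w) + k2 * (t powr r * C w)"
    unfolding FN[OF zN] using t by (simp add: hom)
  also have "\<dots> \<le> k1 * a + k2 * c"
  proof (intro add_mono mult_left_mono)
    have "t powr p \<le> 1" "t powr r \<le> 1" using t exps by (auto intro: powr_le1)
    then have "t powr p * A w \<le> 1 * A w" "t powr r * C w \<le> 1 * C w"
      using nonneg by (intro mult_right_mono; simp)+
    then show "t powr p * A w \<le> a" "t powr r * C w \<le> c" using al ga by auto
  qed (use k in auto)
  finally have "F lam ?z \<le> m" using Fm by simp
  then show ?thesis using that[OF zN] mle by (meson order_trans)
qed

theorem ex_critical_point:
  "\<exists>lam0>0. \<forall>lam>lam0. \<exists>u\<in>D. 0 < B u \<and>
     (\<forall>e>0. \<exists>d>0. \<forall>v\<in>D. A v powr (1 / p) < d \<longrightarrow>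
        \<bar>F lam (\<lambda>x. u x + v x) - F lam u\<bar> \<le> e * A v powr (1 / p))"
proof -
  obtain a0 where a0: "0 < a0" "\<And>u. u \<in> D \<Longrightarrow> A u \<le> a0 \<Longrightarrow> C u \<le> A u / 2"
    using C_le_half_A by blast
  have "0 < (1 / p - 1 / q) * a0" using a0(1) exps by (auto simp: field_simps)
  then obtain lam0 where lam0: "0 < lam0"
    "\<And>lam. lam0 < lam \<Longrightarrow> \<exists>u\<in>nehari_set lam. F lam u < (1 / p - 1 / q) * a0"
    using nehari_level_small by blast
  show ?thesis
  proof (intro exI[of _ lam0] conjI allI impI lam0(1))
    fix lam assume lam: "lam0 < lam"
    then have lp: "0 < lam" using lam0 by linarith
    obtain z where z: "z \<in> nehari_set lam" "\<And>u. u \<in> nehari_set lam \<Longrightarrow> F lam z \<le> F lam u"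
      using nehari_minimiser[OF a0 lp lam0(2)[OF lam]] by blast
    show "\<exists>u\<in>D. 0 < B u \<and>
     (\<forall>e>0. \<exists>d>0. \<forall>v\<in>D. A v powr (1 / p) < d \<longrightarrow>
        \<bar>F lam (\<lambda>x. u x + v x) - F lam u\<bar> \<le> e * A v powr (1 / p))"
      using z minimiser_critical[OF z(1) lp z(2)] by (intro bexI[of _ z]) (auto simp: nehari_set_def)
  qed
qed

end

section \<open>The fractional Sobolev inequality\<close>

lemma sigma_finite_lebesgue: "sigma_finite_measure (lebesgue :: 'a::euclidean_space measure)"
proof
  show "\<exists>A::'a set set. countable A \<and> A \<subseteq> sets lebesgue \<and> \<Union> A = space lebesgue \<and> (\<forall>a\<in>A. emeasure lebesgue a \<noteq> \<infinity>)"
  proof (intro exI[of _ "range (\<lambda>n::nat. cball 0 (real n))"] conjI)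
    show "\<Union> (range (\<lambda>n::nat. cball (0::'a) (real n))) = space lebesgue"
      using real_arch_simple by auto
    show "\<forall>a\<in>range (\<lambda>n::nat. cball (0::'a) (real n)). emeasure lebesgue a \<noteq> \<infinity>"
      by (auto simp: emeasure_cball)
  qed auto
qed

interpretation leb: sigma_finite_measure "lebesgue :: 'a::euclidean_space measure"
  by (rule sigma_finite_lebesgue)

interpretation leb2: pair_sigma_finite "lebesgue :: 'a::euclidean_space measure" "lebesgue :: 'b::euclidean_space measure"
  by standard

lemma fst_borel_lebesgue_pair [measurable]:
  "fst \<in> borel_measurable ((lebesgue :: 'a::euclidean_space measure) \<Otimes>\<^sub>M (lebesgue :: 'b::euclidean_space measure))"
  by (rule measurable_compose[OF measurable_fst]) (simp add: measurable_completion)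

lemma snd_borel_lebesgue_pair [measurable]:
  "snd \<in> borel_measurable ((lebesgue :: 'a::euclidean_space measure) \<Otimes>\<^sub>M (lebesgue :: 'b::euclidean_space measure))"
  by (rule measurable_compose[OF measurable_snd]) (simp add: measurable_completion)

text \<open>On the diagonal the weight is \<open>1 / 0 = 0\<close>, in agreement with \<^const>\<open>gagliardo_pow\<close>.\<close>

definition gmeas :: "real \<Rightarrow> real \<Rightarrow> ((real^'n) \<times> (real^'n)) measure" where
  "gmeas s p = density (lebesgue \<Otimes>\<^sub>M lebesgue)
     (\<lambda>z. ennreal (1 / norm (fst z - snd z) powr (real CARD('n) + s * p)))"

text \<open>A linear map that turns the Gagliardo seminorm into the L^p norm for
  \<open>gmeas s p\<close>, so that Fatou, Brezis-Lieb, Banach-Saks and the first-order expansion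
  apply to the seminorm directly.\<close>

definition incr :: "('a \<Rightarrow> real) \<Rightarrow> 'a \<times> 'a \<Rightarrow> real" where
  "incr v z = v (fst z) - v (snd z)"

definition gfun :: "real \<Rightarrow> real \<Rightarrow> (real^'n \<Rightarrow> real) \<Rightarrow> real^'n \<Rightarrow> ennreal" where
  "gfun s p v x = (\<integral>\<^sup>+ y. ennreal (\<bar>v x - v y\<bar> powr p / norm (x - y) powr (real CARD('n) + s * p)) \<partial>lebesgue)"

lemma incr_borel_lebesgue_pair [measurable]:
  fixes v :: "'a::euclidean_space \<Rightarrow> real"
  assumes [measurable]: "v \<in> borel_measurable lebesgue"
  shows "incr v \<in> borel_measurable (lebesgue \<Otimes>\<^sub>M lebesgue)"
  unfolding incr_def by measurable

lemma incr_borel_gmeas: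
  assumes "v \<in> borel_measurable lebesgue"
  shows "incr v \<in> borel_measurable (gmeas s p)"
  using incr_borel_lebesgue_pair[OF assms] unfolding gmeas_def by simp

lemma gagliardo_pow_eq_nn_integral:
  assumes [measurable]: "v \<in> borel_measurable lebesgue"
  shows "gagliardo_pow s p v = (\<integral>\<^sup>+ z. ennreal (\<bar>incr v z\<bar> powr p) \<partial>gmeas s p)"
proof -
  have [measurable]: "incr v \<in> borel_measurable (lebesgue \<Otimes>\<^sub>M lebesgue)"
    by (rule incr_borel_lebesgue_pair) fact
  have "(\<integral>\<^sup>+ z. ennreal (\<bar>incr v z\<bar> powr p) \<partial>gmeas s p)
    = (\<integral>\<^sup>+ z. ennreal (1 / norm (fst z - snd z) powr (real CARD('a) + s * p)) * ennreal (\<bar>incr v z\<bar> powr p)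
        \<partial>(lebesgue \<Otimes>\<^sub>M lebesgue))"
    unfolding gmeas_def by (rule nn_integral_density) measurable
  also have "\<dots> = gagliardo_pow s p v"
    unfolding gagliardo_pow_def
    by (intro nn_integral_cong) (auto simp: incr_def split_beta simp flip: ennreal_mult)
  finally show ?thesis ..
qed

lemma gagliardo_pow_eq_gfun:
  assumes [measurable]: "v \<in> borel_measurable lebesgue"
  shows "gagliardo_pow s p v = (\<integral>\<^sup>+ x. gfun s p v x \<partial>lebesgue)"
    and "gfun s p v \<in> borel_measurable lebesgue"
proof -
  have [measurable]: "(\<lambda>z. ennreal (\<bar>v (fst z) - v (snd z)\<bar> powr p / norm (fst z - snd z) powr (real CARD('a) + s * p)))
    \<in> borel_measurable (lebesgue \<Otimes>\<^sub>M lebesgue)"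
    by measurable
  show "gagliardo_pow s p v = (\<integral>\<^sup>+ x. gfun s p v x \<partial>lebesgue)"
    unfolding gagliardo_pow_def gfun_def split_beta
    by (subst leb.nn_integral_fst[symmetric]) simp_all
  show "gfun s p v \<in> borel_measurable lebesgue"
    unfolding gfun_def[abs_def]
    using leb.borel_measurable_nn_integral_fst[of "\<lambda>z. ennreal (\<bar>v (fst z) - v (snd z)\<bar> powr p / norm (fst z - snd z) powr (real CARD('a) + s * p))" lebesgue]
    by simp
qed

abbreviation gag_p :: "real \<Rightarrow> real \<Rightarrow> (real^'n \<Rightarrow> real) \<Rightarrow> real" where
  "gag_p s p v \<equiv> pint (gmeas s p) p (incr v)"

lemma incr_Lp_iff:
  assumes "v \<in> borel_measurable lebesgue"
  shows "incr v \<in> Lp_space (gmeas s p) p \<longleftrightarrow> gagliardo_pow s p v < \<infinity>"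
  unfolding gagliardo_pow_eq_nn_integral[OF assms] Lp_space_def
  using incr_borel_gmeas[OF assms, of s p] by (auto simp: integrable_iff_bounded)

lemma gagliardo_pow_eq_pint:
  assumes "v \<in> borel_measurable lebesgue" "incr v \<in> Lp_space (gmeas s p) p"
  shows "gagliardo_pow s p v = ennreal (gag_p s p v)"
  unfolding gagliardo_pow_eq_nn_integral[OF assms(1)] by (rule nn_integral_powr_eq_pint[OF assms(2)])

text \<open>Finiteness need not be assumed: for an infinite seminorm both \<open>enn2real\<close>
  and the Bochner integral return 0.\<close>

lemma gagliardo_eq_pint:
  assumes "v \<in> borel_measurable lebesgue"
  shows "gagliardo s p v = gag_p s p v powr (1 / p)"
proof -
  note [measurable] = incr_borel_gmeas[OF assms, of s p]
  have "gag_p s p v = enn2real (gagliardo_pow s p v)"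
    unfolding gagliardo_pow_eq_nn_integral[OF assms] pint_def
    by (rule integral_eq_nn_integral) auto
  then show ?thesis by (simp add: gagliardo_def)
qed

text \<open>Let \<open>V = \<integral> \<bar>v\<bar>\<^sup>r\<close>. By Chebyshev's inequality \<open>\<bar>v\<bar> \<le> \<bar>v x\<bar> / 2\<close> on at least half of the ball
  around \<open>x\<close> of volume \<open>2\<^sup>r\<^sup>+\<^sup>1 V / \<bar>v x\<bar>\<^sup>r\<close>, and there the Gagliardo integrand is bounded below.\<close>

lemma sobolev_pointwise:
  fixes v :: "real^'n \<Rightarrow> real"
  assumes s: "0 < s" and p: "1 < p" and sp: "s * p < real CARD('n)"
    and v: "v \<in> Lp_space lebesgue (crit_exp TYPE('n) s p)"
    and V0: "0 < pint lebesgue (crit_exp TYPE('n) s p) v"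
  defines "r \<equiv> crit_exp TYPE('n) s p" and "n \<equiv> real CARD('n)"
  defines "b \<equiv> unit_ball_vol n"
  shows "ennreal (\<bar>v x\<bar> powr r) \<le>
     ennreal (2 / b * 2 powr p * (2 * 2 powr r / b) powr (s * p / n) * pint lebesgue r v powr (s * p / n)) * gfun s p v x"
proof (cases "v x = 0")
  case True
  then show ?thesis by simp
next
  case False
  note [measurable] = Lp_spaceD(1)[OF v]
  have n: "0 < n" by (simp add: n_def)
  have b: "0 < b" by (simp add: b_def n_def)
  \<comment> \<open>The second equation characterises the critical exponent; through it the powers
    of \<open>a\<close> recombine to \<open>a powr r\<close> at the end.\<close>
  have r: "0 < r" "r = p + r * (s * p / n)"
    using sp s p by (auto simp: r_def crit_exp_def n_def field_simps)
  define a where "a = \<bar>v x\<bar>"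
  define V where "V = pint lebesgue r v"
  have a: "0 < a" using False by (simp add: a_def)
  have V: "0 < V" using V0 by (simp add: V_def r_def)
  define c where "c = 2 * 2 powr r * V / (b * a powr r)"
  have c: "0 < c" using V b a by (simp add: c_def)
  define \<rho> where "\<rho> = c powr (1 / n)"
  have rho: "0 < \<rho>" using c by (simp add: \<rho>_def)
  have rn: "\<rho> powr n = c" using n c by (simp add: \<rho>_def powr_powr)
  have mball: "emeasure lebesgue (ball x \<rho>) = ennreal (b * c)"
  proof -
    have "\<rho> ^ CARD('n) = c" using rho rn by (simp add: n_def powr_realpow)
    then show ?thesis using rho by (simp add: emeasure_ball b_def n_def)
  qed
  define T where "T = {y. a / 2 < \<bar>v y\<bar>}"
  have Tm [measurable]: "T \<in> sets lebesgue"
  proof -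
    have "{y \<in> space lebesgue. a / 2 < \<bar>v y\<bar>} \<in> sets lebesgue" by measurable
    then show ?thesis by (simp add: T_def)
  qed
  have mT: "emeasure lebesgue T \<le> ennreal (b * c / 2)"
  proof -
    have "emeasure lebesgue {y \<in> space lebesgue. (a / 2) powr r \<le> \<bar>v y\<bar> powr r} \<le> ennreal (1 / (a / 2) powr r * V)"
      unfolding V_def pint_def
      by (rule integral_Markov_inequality) (use Lp_spaceD(2)[OF v] a in \<open>auto simp: r_def\<close>)
    also have "1 / (a / 2) powr r * V = b * c / 2"
    proof -
      have "b * c / 2 = 2 powr r * V / a powr r" using b by (simp add: c_def)
      then show ?thesis by (simp add: powr_divide)
    qed
    finally have 1: "emeasure lebesgue {y \<in> space lebesgue. (a / 2) powr r \<le> \<bar>v y\<bar> powr r} \<le> ennreal (b * c / 2)" .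
    have "emeasure lebesgue T \<le> emeasure lebesgue {y \<in> space lebesgue. (a / 2) powr r \<le> \<bar>v y\<bar> powr r}"
    proof (rule emeasure_mono)
      show "T \<subseteq> {y \<in> space lebesgue. (a / 2) powr r \<le> \<bar>v y\<bar> powr r}"
        using a r by (auto simp: T_def intro!: powr_mono2)
    qed measurable
    with 1 show ?thesis by (rule order_trans[rotated])
  qed
  define S where "S = ball x \<rho> - T"
  have [measurable]: "S \<in> sets lebesgue" unfolding S_def using Tm by (intro sets.Diff) auto
  have "ennreal (b * c) = emeasure lebesgue (ball x \<rho>)"
    using mball by simp
  also have "\<dots> \<le> emeasure lebesgue (S \<union> T)"
    by (rule emeasure_mono) (auto simp: S_def)
  also have "\<dots> \<le> emeasure lebesgue S + emeasure lebesgue T"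
    by (rule emeasure_subadditive) auto
  also have "\<dots> \<le> emeasure lebesgue S + ennreal (b * c / 2)" by (intro add_left_mono mT)
  finally have "ennreal (b * c) \<le> emeasure lebesgue S + ennreal (b * c / 2)" .
  moreover have "ennreal (b * c) = ennreal (b * c / 2) + ennreal (b * c / 2)"
    using b c by (simp flip: ennreal_plus)
  ultimately have mS: "ennreal (b * c / 2) \<le> emeasure lebesgue S"
    by (simp add: add.commute)
  \<comment> \<open>A lower bound for the Gagliardo integrand on \<open>S\<close>, where the
    increment is at least \<open>a / 2\<close> and the distance to \<open>x\<close> is below
    \<rho>.\<close>
  define k where "k = (a / 2) powr p / \<rho> powr (n + s * p)"
  have k: "0 < k" using a rho by (simp add: k_def)
  have "ennreal (k * (b * c / 2)) = ennreal k * ennreal (b * c / 2)"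
    using k b c by (intro ennreal_mult) auto
  also have "\<dots> \<le> ennreal k * emeasure lebesgue S" by (intro mult_left_mono mS) auto
  also have "\<dots> = (\<integral>\<^sup>+ y. ennreal k * indicator S y \<partial>lebesgue)"
    by (simp add: nn_integral_cmult_indicator)
  also have "\<dots> \<le> gfun s p v x"
    unfolding gfun_def n_def[symmetric]
  proof (rule nn_integral_mono)
    fix y
    show "ennreal k * indicator S y \<le> ennreal (\<bar>v x - v y\<bar> powr p / norm (x - y) powr (n + s * p))"
    proof (cases "y \<in> S")
      case True
      then have y: "norm (x - y) < \<rho>" "\<bar>v y\<bar> \<le> a / 2" by (auto simp: S_def T_def dist_norm)
      have xy: "x \<noteq> y" using y a by (auto simp: a_def)
      have "k \<le> \<bar>v x - v y\<bar> powr p / norm (x - y) powr (n + s * p)"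
        unfolding k_def
      proof (rule frac_le)
        show "(a / 2) powr p \<le> \<bar>v x - v y\<bar> powr p"
          using y a p by (intro powr_mono2) (auto simp: a_def abs_if split: if_splits)
        show "norm (x - y) powr (n + s * p) \<le> \<rho> powr (n + s * p)"
          using y n s p by (intro powr_mono2) auto
      qed (use xy in auto)
      then show ?thesis using True by (simp add: ennreal_leI)
    qed simp
  qed
  finally have G: "ennreal (k * (b * c / 2)) \<le> gfun s p v x" .
  have "a powr r = (2 / b * 2 powr p * (2 * 2 powr r / b) powr (s * p / n) * V powr (s * p / n)) * (k * (b * c / 2))"
  proof -
    have e: "c powr (s * p / n) = (2 * 2 powr r / b) powr (s * p / n) * V powr (s * p / n) / a powr (r * (s * p / n))"
      using V b a by (simp add: c_def powr_mult powr_divide powr_powr)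
    have "\<rho> powr (n + s * p) = c * c powr (s * p / n)"
      unfolding powr_add rn by (simp add: \<rho>_def powr_powr)
    then have "k * (b * c / 2) = (a / 2) powr p * b / 2 / c powr (s * p / n)"
      using c by (simp add: k_def)
    also have "\<dots> = a powr p * a powr (r * (s * p / n)) * b / (2 * 2 powr p)
        / ((2 * 2 powr r / b) powr (s * p / n) * V powr (s * p / n))"
      unfolding e by (simp add: powr_divide mult_ac)
    also have "a powr p * a powr (r * (s * p / n)) = a powr r" using r(2) by (simp flip: powr_add)
    finally have e2: "k * (b * c / 2) = a powr r * b / (2 * 2 powr p)
        / ((2 * 2 powr r / b) powr (s * p / n) * V powr (s * p / n))" .
    have pos: "(2 * 2 powr r / b) powr (s * p / n) > 0" "V powr (s * p / n) > 0" using b V by auto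
    show ?thesis unfolding e2 using b pos by (simp add: field_simps)
  qed
  then have "ennreal (a powr r) = ennreal (2 / b * 2 powr p * (2 * 2 powr r / b) powr (s * p / n) * V powr (s * p / n))
      * ennreal (k * (b * c / 2))"
    using b k c by (simp flip: ennreal_mult)
  also have "\<dots> \<le> ennreal (2 / b * 2 powr p * (2 * 2 powr r / b) powr (s * p / n) * V powr (s * p / n)) * gfun s p v x"
    by (intro mult_left_mono G) auto
  finally show ?thesis unfolding a_def V_def .
qed

text \<open>Integrating \<open>sobolev_pointwise\<close> gives
  \<open>V \<le> C * V powr (s * p / n) * A\<close>. Since \<open>v\<close> is assumed to lie in the
  critical Lebesgue space, \<open>V\<close> is finite and its power can be divided out;
  \<open>(1 - s * p / n) * (r / p) = 1\<close> then yields the exponent.\<close>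

theorem fractional_sobolev:
  assumes s: "0 < s" and p: "1 < p" and sp: "s * p < real CARD('n)"
  obtains S where "0 \<le> S"
    "\<And>v :: real^'n \<Rightarrow> real. v \<in> Lp_space lebesgue (crit_exp TYPE('n) s p) \<Longrightarrow> incr v \<in> Lp_space (gmeas s p) p \<Longrightarrow>
       pint lebesgue (crit_exp TYPE('n) s p) v \<le> S * gag_p s p v powr (crit_exp TYPE('n) s p / p)"
proof -
  define r where "r = crit_exp TYPE('n) s p"
  define n where "n = real CARD('n)"
  define b where "b = unit_ball_vol n"
  define C where "C = 2 / b * 2 powr p * (2 * 2 powr r / b) powr (s * p / n)"
  have n: "0 < n" by (simp add: n_def)
  have "0 < b" by (simp add: b_def n_def)
  then have C: "0 < C" by (simp add: C_def)
  have r: "0 < r" "(1 - s * p / n) * (r / p) = 1" "0 < 1 - s * p / n"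
    using sp s p by (auto simp: r_def crit_exp_def n_def field_simps)
  show ?thesis
  proof (rule that[of "C powr (r / p)"])
    fix v :: "real^'n \<Rightarrow> real"
    assume v0: "v \<in> Lp_space lebesgue (crit_exp TYPE('n) s p)" and i: "incr v \<in> Lp_space (gmeas s p) p"
    note [measurable] = Lp_spaceD(1)[OF v0] gagliardo_pow_eq_gfun(2)[OF Lp_spaceD(1)[OF v0]]
    have v: "v \<in> Lp_space lebesgue r" using v0 by (simp add: r_def)
    define V where "V = pint lebesgue r v"
    define A where "A = gag_p s p v"
    have A: "0 \<le> A" by (simp add: A_def pint_nonneg)
    have "V \<le> C powr (r / p) * A powr (r / p)"
    proof (cases "V = 0")
      case False
      then have V: "0 < V" using pint_nonneg[of lebesgue r v] by (simp add: V_def)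
      have "ennreal V = (\<integral>\<^sup>+ x. ennreal (\<bar>v x\<bar> powr r) \<partial>lebesgue)"
        unfolding V_def by (rule nn_integral_powr_eq_pint[OF v, symmetric])
      also have "\<dots> \<le> (\<integral>\<^sup>+ x. ennreal (C * V powr (s * p / n)) * gfun s p v x \<partial>lebesgue)"
        using sobolev_pointwise[OF s p sp v0] V
        unfolding C_def b_def n_def V_def r_def by (intro nn_integral_mono) blast
      also have "\<dots> = ennreal (C * V powr (s * p / n)) * (\<integral>\<^sup>+ x. gfun s p v x \<partial>lebesgue)"
        by (rule nn_integral_cmult) measurable
      also have "(\<integral>\<^sup>+ x. gfun s p v x \<partial>lebesgue) = ennreal A"
        unfolding A_def gagliardo_pow_eq_gfun(1)[OF Lp_spaceD(1)[OF v0], symmetric]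
        by (rule gagliardo_pow_eq_pint[OF Lp_spaceD(1)[OF v0] i])
      finally have "ennreal V \<le> ennreal (C * V powr (s * p / n) * A)"
        using C A by (simp add: ennreal_mult)
      then have 1: "V \<le> C * V powr (s * p / n) * A"
        using C A by (simp add: ennreal_le_iff)
      have "V powr (1 - s * p / n) * V powr (s * p / n) = V" using V by (simp flip: powr_add)
      then have "V powr (1 - s * p / n) * V powr (s * p / n) \<le> (C * A) * V powr (s * p / n)"
        using 1 by (simp add: mult_ac)
      then have "V powr (1 - s * p / n) \<le> C * A" using V by simp
      then have "(V powr (1 - s * p / n)) powr (r / p) \<le> (C * A) powr (r / p)"
        using r p by (intro powr_mono2) auto
      then show ?thesis using V r by (simp add: powr_powr powr_mult)
    qed simp
    then show "pint lebesgue (crit_exp TYPE('n) s p) v \<le> C powr (r / p) * gag_p s p v powr (crit_exp TYPE('n) s p / p)"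
      by (simp add: V_def A_def r_def)
  qed simp
qed

section \<open>Almost everywhere convergent subsequences\<close>

text \<open>The index of the half-open dyadic cube of side \<open>1 / 2 ^ m\<close> containing
  \<open>x\<close>. Its countable type makes functions of the grid measurable and admits a diagonal
  argument over all cubes.\<close>

definition grid :: "nat \<Rightarrow> real^'n \<Rightarrow> int^'n" where
  "grid m x = (\<chi> i. \<lfloor>2 ^ m * x $ i\<rfloor>)"

definition cube :: "nat \<Rightarrow> int^'n \<Rightarrow> (real^'n) set" where
  "cube m z = {x. grid m x = z}"

definition cube_avg :: "(real^'n \<Rightarrow> real) \<Rightarrow> nat \<Rightarrow> int^'n \<Rightarrow> real" where
  "cube_avg u m z = (2 ^ m) ^ CARD('n) * (LINT y|lebesgue. indicator (cube m z) y * u y)"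

lemma cube_eq: "cube m z = {x. \<forall>i. of_int (z $ i) / 2 ^ m \<le> x $ i \<and> x $ i < (of_int (z $ i) + 1) / 2 ^ m}"
  unfolding cube_def grid_def vec_eq_iff
  by (auto simp: floor_eq_iff field_simps)

lemma cube_sets: "cube m (z :: int^'n) \<in> sets borel"
proof -
  have "cube m z = (\<Inter>i\<in>UNIV. {x. of_int (z $ i) / 2 ^ m \<le> x $ i} \<inter> {x. x $ i < (of_int (z $ i) + 1) / 2 ^ m})"
    unfolding cube_eq by auto
  also have "\<dots> \<in> sets borel"
    by (intro sets.finite_INT sets.Int borel_closed borel_open closed_halfspace_component_ge_cart
        open_halfspace_component_lt_cart) auto
  finally show ?thesis .
qed

lemma cube_sets_lebesgue [measurable]: "cube m z \<in> sets lebesgue"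
  using cube_sets[of m z] by simp

text \<open>The half-open cube is squeezed between an open and a closed box of equal volume.\<close>

lemma emeasure_cube: "emeasure lebesgue (cube m (z :: int^'n)) = ennreal ((1 / 2 ^ m) ^ CARD('n))"
proof -
  define l :: "real^'n" where "l = (\<chi> i. of_int (z $ i) / 2 ^ m)"
  define u :: "real^'n" where "u = (\<chi> i. (of_int (z $ i) + 1) / 2 ^ m)"
  have lu: "(u - l) \<bullet> b = 1 / 2 ^ m" if "b \<in> Basis" for b
    using that by (auto simp: Basis_vec_def inner_axis u_def l_def field_simps)
  then have le: "l \<bullet> b \<le> u \<bullet> b" if "b \<in> Basis" for b
    using that by (smt (verit) inner_diff_left zero_le_divide_1_iff zero_le_power)
  have pr: "(\<Prod>b\<in>Basis. (u - l) \<bullet> b) = (1 / 2 ^ m) ^ CARD('n)"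
    using lu by simp
  have 1: "emeasure lebesgue (cbox l u) = ennreal ((1 / 2 ^ m) ^ CARD('n))"
    using emeasure_lborel_cbox[of l u, OF le] pr by simp
  have 2: "emeasure lebesgue (box l u) = ennreal ((1 / 2 ^ m) ^ CARD('n))"
    using emeasure_lborel_box[of l u, OF le] pr by simp
  have "cube m z \<subseteq> cbox l u" "box l u \<subseteq> cube m z"
    by (auto simp: cube_eq mem_box_cart l_def u_def less_imp_le)
  then have "emeasure lebesgue (cube m z) \<le> emeasure lebesgue (cbox l u)"
    "emeasure lebesgue (box l u) \<le> emeasure lebesgue (cube m z)"
    by (intro emeasure_mono; simp add: cube_sets_lebesgue)+
  then show ?thesis unfolding 1 2 by (rule antisym)
qed

lemma integrable_cube: "integrable lebesgue (indicator (cube m (z :: int^'n)) :: _ \<Rightarrow> real)"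
  using emeasure_cube[of m z] by (auto intro!: integrable_real_indicator)

lemma integral_cube: "(LINT y|lebesgue. indicator (cube m (z :: int^'n)) y) = ((1 / 2 ^ m) ^ CARD('n) :: real)"
  using emeasure_cube[of m z] by (simp add: measure_def)

lemma norm_diff_cube:
  assumes "x \<in> cube m z" "y \<in> cube m (z :: int^'n)"
  shows "norm (x - y) \<le> real CARD('n) / 2 ^ m"
proof -
  have "norm (x - y) \<le> (\<Sum>i\<in>UNIV. \<bar>(x - y) $ i\<bar>)" by (rule norm_le_l1_cart)
  also have "\<dots> \<le> (\<Sum>i\<in>(UNIV :: 'n set). 1 / 2 ^ m)"
  proof (rule sum_mono)
    fix i
    have "of_int (z $ i) / 2 ^ m \<le> x $ i" "x $ i < (of_int (z $ i) + 1) / 2 ^ m"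
      "of_int (z $ i) / 2 ^ m \<le> y $ i" "y $ i < (of_int (z $ i) + 1) / 2 ^ m"
      using assms by (auto simp: cube_eq)
    then show "\<bar>(x - y) $ i\<bar> \<le> 1 / 2 ^ m"
      unfolding add_divide_distrib by (simp add: abs_le_iff)
  qed
  also have "\<dots> = real CARD('n) / 2 ^ m" by simp
  finally show ?thesis .
qed

lemma grid_measurable [measurable]: "grid m \<in> lebesgue \<rightarrow>\<^sub>M count_space (UNIV :: (int^'n) set)"
proof -
  have "grid m -` {z} \<inter> space lebesgue = cube m z" for z :: "int^'n"
    by (auto simp: cube_def)
  then show ?thesis
    by (subst measurable_count_space_eq_countable) (auto intro: uncountable_def)
qed

lemma cube_avg_grid_measurable [measurable]: "(\<lambda>x. h (grid m x) :: real) \<in> borel_measurable (lebesgue :: (real^'n) measure)"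
  by (rule measurable_compose[OF grid_measurable]) simp

lemma integrable_cube_mult:
  assumes u: "u \<in> Lp_space lebesgue r" and r: "1 \<le> r"
  shows "integrable lebesgue (\<lambda>y. indicator (cube m z) y * u y)"
proof -
  note [measurable] = Lp_spaceD(1)[OF u]
  have "integrable lebesgue (\<lambda>y. indicator (cube m z) y + \<bar>u y\<bar> powr r)"
    by (rule Bochner_Integration.integrable_add[OF integrable_cube Lp_spaceD(2)[OF u]])
  then show ?thesis
  proof (rule Bochner_Integration.integrable_bound)
    show "AE x in lebesgue. norm (indicator (cube m z) x * u x) \<le> norm (indicator (cube m z) x + \<bar>u x\<bar> powr r)"
      using abs_le_add_powr[of 1 r "\<bar>u x\<bar>" for x] r
      by (intro AE_I2) (auto simp: indicator_def)
  qed measurable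
qed

lemma cube_avg_bound:
  fixes u :: "real^'n \<Rightarrow> real"
  assumes u: "u \<in> Lp_space lebesgue r" and r: "1 \<le> r" and b: "pint lebesgue r u \<le> c"
  shows "\<bar>cube_avg u m z\<bar> \<le> 1 + (2 ^ m) ^ CARD('n) * c"
proof -
  have "\<bar>LINT y|lebesgue. indicator (cube m z) y * u y\<bar> \<le> (LINT y|lebesgue. \<bar>indicator (cube m z) y * u y\<bar>)"
    by (rule integral_abs_bound)
  also have "\<dots> \<le> (LINT y|lebesgue. indicator (cube m z) y + \<bar>u y\<bar> powr r)"
  proof (rule integral_mono)
    show "\<bar>indicator (cube m z) x * u x\<bar> \<le> indicator (cube m z) x + \<bar>u x\<bar> powr r" for x
      using abs_le_add_powr[of 1 r "\<bar>u x\<bar>"] r by (auto simp: indicator_def)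
  qed (intro integrable_abs Bochner_Integration.integrable_add integrable_cube_mult[OF u r] integrable_cube Lp_spaceD(2)[OF u])+
  also have "\<dots> = (1 / 2 ^ m) ^ CARD('n) + pint lebesgue r u"
    by (simp only: pint_def Bochner_Integration.integral_add[OF integrable_cube Lp_spaceD(2)[OF u]] integral_cube)
  finally have "\<bar>cube_avg u m z\<bar> \<le> (2 ^ m) ^ CARD('n) * ((1 / 2 ^ m) ^ CARD('n) + pint lebesgue r u)"
    unfolding cube_avg_def abs_mult by (intro mult_mono) auto
  also have "\<dots> \<le> (2 ^ m) ^ CARD('n) * ((1 / 2 ^ m) ^ CARD('n) + c)"
    using b by (intro mult_left_mono) auto
  also have "\<dots> = 1 + (2 ^ m) ^ CARD('n) * c"
    unfolding distrib_left power_mult_distrib[symmetric] by simp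
  finally show ?thesis .
qed

text \<open>A fractional Poincare estimate. In the cube of \<open>x\<close>,
  \<open>abs_le_add_powr\<close> at threshold \<open>d\<close> trades the increment for
  \<open>d\<close> plus its \<open>p\<close>-th power, and the diameter bound turns this power into
  the Gagliardo integrand. The threshold \<open>(1 / 2 ^ m) powr s\<close> makes both contributions,
  averaged over the cube, of order \<open>d\<close>.\<close>

lemma cube_avg_error_pointwise:
  fixes u :: "real^'n \<Rightarrow> real" and m :: nat
  assumes u: "u \<in> Lp_space lebesgue r" and r: "1 \<le> r" and p: "1 < p" and s: "0 < s"
  defines "n \<equiv> real CARD('n)" and "d \<equiv> (1 / 2 ^ m) powr s"
  shows "ennreal \<bar>u x - cube_avg u m (grid m x)\<bar> \<le> ennreal d + ennreal (d * n powr (n + s * p)) * gfun s p u x"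
proof -
  note [measurable] = Lp_spaceD(1)[OF u]
  define Q where "Q = cube m (grid m x)"
  have [measurable]: "Q \<in> sets lebesgue" unfolding Q_def by (rule cube_sets_lebesgue)
  have xQ: "x \<in> Q" by (simp add: Q_def cube_def)
  define W :: real where "W = (2 ^ m) ^ CARD('n)"
  have W: "0 < W" by (simp add: W_def)
  have d: "0 < d" by (simp add: d_def)
  have n: "0 < n" by (simp add: n_def)
  have ep: "ennreal (a + b * c) = ennreal a + ennreal b * ennreal c" if "0 \<le> a" "0 \<le> b" "0 \<le> c" for a b c
    using that by (simp add: ennreal_plus ennreal_mult)
  have i1: "integrable lebesgue (\<lambda>y. indicator Q y * u y)"
    unfolding Q_def by (rule integrable_cube_mult[OF u r])
  have i2: "integrable lebesgue (indicator Q :: _ \<Rightarrow> real)" unfolding Q_def by (rule integrable_cube)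
  have iQ: "W * (LINT y|lebesgue. indicator Q y) = 1"
    unfolding W_def Q_def integral_cube power_mult_distrib[symmetric] by simp
  have eQ: "ennreal W * emeasure lebesgue Q = 1"
  proof -
    have "ennreal W * emeasure lebesgue Q = ennreal (W * (1 / 2 ^ m) ^ CARD('n))"
      using W unfolding Q_def emeasure_cube by (intro ennreal_mult[symmetric]) auto
    also have "W * (1 / 2 ^ m) ^ CARD('n) = 1" unfolding W_def power_mult_distrib[symmetric] by simp
    finally show ?thesis by simp
  qed
  have i3: "integrable lebesgue (\<lambda>y. indicator Q y * (u x - u y))"
  proof -
    have "integrable lebesgue (\<lambda>y. u x * indicator Q y - indicator Q y * u y)" using i1 i2 by auto
    then show ?thesis by (simp add: algebra_simps)
  qed
  have "u x - cube_avg u m (grid m x) = W * (LINT y|lebesgue. indicator Q y * (u x - u y))"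
  proof -
    have "(LINT y|lebesgue. indicator Q y * (u x - u y)) = (LINT y|lebesgue. u x * indicator Q y - indicator Q y * u y)"
      by (rule Bochner_Integration.integral_cong) (auto simp: algebra_simps)
    also have "\<dots> = u x * (LINT y|lebesgue. indicator Q y) - (LINT y|lebesgue. indicator Q y * u y)"
      using i1 i2 by (subst Bochner_Integration.integral_diff) auto
    finally have "W * (LINT y|lebesgue. indicator Q y * (u x - u y))
       = u x * (W * (LINT y|lebesgue. indicator Q y)) - cube_avg u m (grid m x)"
      unfolding cube_avg_def W_def[symmetric] Q_def[symmetric] by (simp only: right_diff_distrib mult.left_commute)
    then show ?thesis using iQ by simp
  qed
  then have "\<bar>u x - cube_avg u m (grid m x)\<bar> \<le> W * (LINT y|lebesgue. \<bar>indicator Q y * (u x - u y)\<bar>)"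
    using W integral_abs_bound[of lebesgue "\<lambda>y. indicator Q y * (u x - u y)"] by (simp add: abs_mult)
  then have "ennreal \<bar>u x - cube_avg u m (grid m x)\<bar> \<le> ennreal (W * (LINT y|lebesgue. \<bar>indicator Q y * (u x - u y)\<bar>))"
    by (rule ennreal_leI)
  also have "\<dots> = ennreal W * ennreal (LINT y|lebesgue. \<bar>indicator Q y * (u x - u y)\<bar>)"
    using W by (intro ennreal_mult integral_nonneg_AE) auto
  also have "ennreal (LINT y|lebesgue. \<bar>indicator Q y * (u x - u y)\<bar>) = (\<integral>\<^sup>+ y. ennreal \<bar>indicator Q y * (u x - u y)\<bar> \<partial>lebesgue)"
    using i3 by (intro nn_integral_eq_integral[symmetric]) auto
  finally have first: "ennreal \<bar>u x - cube_avg u m (grid m x)\<bar>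
    \<le> ennreal W * (\<integral>\<^sup>+ y. ennreal \<bar>indicator Q y * (u x - u y)\<bar> \<partial>lebesgue)" .
  define E where "E = ennreal (d powr (1 - p) * (n / 2 ^ m) powr (n + s * p))"
  define R where "R y = ennreal (\<bar>u x - u y\<bar> powr p / norm (x - y) powr (n + s * p))" for y
  have "(\<integral>\<^sup>+ y. ennreal \<bar>indicator Q y * (u x - u y)\<bar> \<partial>lebesgue) \<le> (\<integral>\<^sup>+ y. ennreal d * indicator Q y + E * R y \<partial>lebesgue)"
  proof (rule nn_integral_mono)
    fix y
    show "ennreal \<bar>indicator Q y * (u x - u y)\<bar> \<le> ennreal d * indicator Q y + E * R y"
    proof (cases "y \<in> Q")
      case True
      have "\<bar>u x - u y\<bar> \<le> d + d powr (1 - p) * \<bar>u x - u y\<bar> powr p"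
        using d p by (intro abs_le_add_powr) auto
      also have "\<bar>u x - u y\<bar> powr p \<le> (n / 2 ^ m) powr (n + s * p) * (\<bar>u x - u y\<bar> powr p / norm (x - y) powr (n + s * p))"
      proof (cases "x = y")
        case False
        have "norm (x - y) \<le> n / 2 ^ m"
          using norm_diff_cube[of x m "grid m x" y] xQ True unfolding Q_def n_def by auto
        then have "norm (x - y) powr (n + s * p) \<le> (n / 2 ^ m) powr (n + s * p)"
          using n s p by (intro powr_mono2) auto
        then have "\<bar>u x - u y\<bar> powr p * norm (x - y) powr (n + s * p) \<le> \<bar>u x - u y\<bar> powr p * (n / 2 ^ m) powr (n + s * p)"
          by (intro mult_left_mono) auto
        then show ?thesis using False by (simp add: field_simps)
      qed simp
      finally have "\<bar>u x - u y\<bar> \<le> d + d powr (1 - p) * ((n / 2 ^ m) powr (n + s * p) * (\<bar>u x - u y\<bar> powr p / norm (x - y) powr (n + s * p)))"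
        by (simp add: mult_left_mono)
      then have "ennreal \<bar>u x - u y\<bar> \<le> ennreal (d + d powr (1 - p) * (n / 2 ^ m) powr (n + s * p) * (\<bar>u x - u y\<bar> powr p / norm (x - y) powr (n + s * p)))"
        by (intro ennreal_leI) (simp add: mult.assoc)
      also have "\<dots> = ennreal d + E * R y"
        unfolding E_def R_def using d by (intro ep) auto
      finally show ?thesis using True by simp
    qed simp
  qed
  also have "\<dots> = ennreal d * emeasure lebesgue Q + E * gfun s p u x"
  proof -
    have [measurable]: "(\<lambda>y. norm (x - y)) \<in> borel_measurable lebesgue"
      by (intro measurable_completion) simp
    have R [measurable]: "R \<in> borel_measurable lebesgue" unfolding R_def by measurable
    have G: "gfun s p u x = (\<integral>\<^sup>+ y. R y \<partial>lebesgue)" by (simp add: gfun_def R_def n_def)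
    have "(\<integral>\<^sup>+ y. ennreal d * indicator Q y + E * R y \<partial>lebesgue)
      = (\<integral>\<^sup>+ y. ennreal d * indicator Q y \<partial>lebesgue) + (\<integral>\<^sup>+ y. E * R y \<partial>lebesgue)"
      by (rule nn_integral_add) measurable
    also have "\<dots> = ennreal d * emeasure lebesgue Q + E * gfun s p u x"
      unfolding G by (simp only: nn_integral_cmult[OF R] nn_integral_cmult_indicator[OF \<open>Q \<in> sets lebesgue\<close>])
    finally show ?thesis .
  qed
  finally have J: "(\<integral>\<^sup>+ y. ennreal \<bar>indicator Q y * (u x - u y)\<bar> \<partial>lebesgue) \<le>
     ennreal d * emeasure lebesgue Q + E * gfun s p u x" .
  note first
  also have "ennreal W * (\<integral>\<^sup>+ y. ennreal \<bar>indicator Q y * (u x - u y)\<bar> \<partial>lebesgue) \<le>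
     ennreal W * (ennreal d * emeasure lebesgue Q + E * gfun s p u x)"
    by (rule mult_left_mono[OF J]) simp
  also have "\<dots> = ennreal d * (ennreal W * emeasure lebesgue Q)
     + ennreal (W * (d powr (1 - p) * (n / 2 ^ m) powr (n + s * p))) * gfun s p u x"
  proof -
    have "ennreal (W * (d powr (1 - p) * (n / 2 ^ m) powr (n + s * p)))
       = ennreal W * ennreal (d powr (1 - p) * (n / 2 ^ m) powr (n + s * p))"
      using W by (intro ennreal_mult) auto
    then show ?thesis unfolding E_def by (simp only: distrib_left mult_ac)
  qed
  also have "W * (d powr (1 - p) * (n / 2 ^ m) powr (n + s * p)) = d * n powr (n + s * p)"
  proof -
    have W': "W = (2 ^ m) powr n" by (simp add: W_def n_def powr_realpow)
    have e1: "(n / 2 ^ m) powr (n + s * p) = n powr (n + s * p) * ((1 / 2 ^ m) powr n * (1 / 2 ^ m) powr (s * p))"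
      using powr_mult[of n "1 / 2 ^ m" "n + s * p"] by (simp add: powr_add)
    have e2: "(2 ^ m) powr n * (1 / 2 ^ m) powr n = 1"
      unfolding powr_mult[symmetric] by simp
    have e3: "d powr (1 - p) * (1 / 2 ^ m) powr (s * p) = d"
      unfolding d_def powr_powr powr_add[symmetric] by (simp add: algebra_simps)
    have "W * (d powr (1 - p) * (n / 2 ^ m) powr (n + s * p)) = ((2 ^ m) powr n * (1 / 2 ^ m) powr n)
        * (d powr (1 - p) * (1 / 2 ^ m) powr (s * p)) * n powr (n + s * p)"
      unfolding W' e1 by (simp only: mult_ac)
    then show ?thesis unfolding e2 e3 by simp
  qed
  finally show ?thesis unfolding eQ by simp
qed

text \<open>The pointwise error contains the constant \<open>d\<close>, not integrable over the
  whole space; an integrable weight tames it, and \<open>w \<le> 1\<close> leaves the seminorm part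
  untouched.\<close>

lemma cube_avg_error:
  fixes u w :: "real^'n \<Rightarrow> real" and m :: nat
  assumes u: "u \<in> Lp_space lebesgue r" and r: "1 \<le> r" and p: "1 < p" and s: "0 < s"
    and i: "incr u \<in> Lp_space (gmeas s p) p" and M: "gag_p s p u \<le> M"
    and w: "w \<in> borel_measurable lebesgue" "\<And>x. 0 < w x" "\<And>x. w x \<le> 1" "integrable lebesgue w"
  defines "n \<equiv> real CARD('n)" and "d \<equiv> (1 / 2 ^ m) powr s"
  shows "integrable lebesgue (\<lambda>x. w x * \<bar>u x - cube_avg u m (grid m x)\<bar>)"
    and "(LINT x|lebesgue. w x * \<bar>u x - cube_avg u m (grid m x)\<bar>) \<le> d * (integral\<^sup>L lebesgue w + n powr (n + s * p) * M)"
proof -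
  note [measurable] = Lp_spaceD(1)[OF u] w(1)
  have G [measurable]: "gfun s p u \<in> borel_measurable lebesgue" by (rule gagliardo_pow_eq_gfun) fact
  define k where "k = d * n powr (n + s * p)"
  define I where "I = integral\<^sup>L lebesgue w"
  have d: "0 < d" by (simp add: d_def)
  have k: "0 \<le> k" using d by (simp add: k_def)
  have I: "0 \<le> I" unfolding I_def using w(2) by (intro integral_nonneg_AE) (auto simp: less_imp_le)
  have M0: "0 \<le> M" using M pint_nonneg order_trans by blast
  have f [measurable]: "(\<lambda>x. w x * \<bar>u x - cube_avg u m (grid m x)\<bar>) \<in> borel_measurable lebesgue" by measurable
  have "(\<integral>\<^sup>+ x. ennreal (w x * \<bar>u x - cube_avg u m (grid m x)\<bar>) \<partial>lebesgue)
    \<le> (\<integral>\<^sup>+ x. ennreal d * ennreal (w x) + ennreal k * gfun s p u x \<partial>lebesgue)"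
  proof (rule nn_integral_mono)
    fix x
    have "ennreal (w x * \<bar>u x - cube_avg u m (grid m x)\<bar>) = ennreal (w x) * ennreal \<bar>u x - cube_avg u m (grid m x)\<bar>"
      using w(2)[of x] by (intro ennreal_mult) auto
    also have "\<dots> \<le> ennreal (w x) * (ennreal d + ennreal k * gfun s p u x)"
      using cube_avg_error_pointwise[OF u r p s, of x m] unfolding k_def d_def n_def by (intro mult_left_mono) auto
    also have "\<dots> = ennreal d * ennreal (w x) + ennreal (w x) * (ennreal k * gfun s p u x)"
      by (simp add: distrib_left mult.commute)
    also have "\<dots> \<le> ennreal d * ennreal (w x) + 1 * (ennreal k * gfun s p u x)"
      using w(3)[of x] by (intro add_left_mono mult_right_mono) (auto simp: ennreal_le_1)
    finally show "ennreal (w x * \<bar>u x - cube_avg u m (grid m x)\<bar>) \<le> ennreal d * ennreal (w x) + ennreal k * gfun s p u x"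
      by simp
  qed
  also have "\<dots> = (\<integral>\<^sup>+ x. ennreal d * ennreal (w x) \<partial>lebesgue) + (\<integral>\<^sup>+ x. ennreal k * gfun s p u x \<partial>lebesgue)"
    by (rule nn_integral_add) measurable
  also have "\<dots> = ennreal d * (\<integral>\<^sup>+ x. ennreal (w x) \<partial>lebesgue) + ennreal k * (\<integral>\<^sup>+ x. gfun s p u x \<partial>lebesgue)"
    by (simp add: nn_integral_cmult)
  also have "(\<integral>\<^sup>+ x. ennreal (w x) \<partial>lebesgue) = ennreal I"
    unfolding I_def using w by (intro nn_integral_eq_integral) (auto simp: less_imp_le)
  also have "(\<integral>\<^sup>+ x. gfun s p u x \<partial>lebesgue) = ennreal (gag_p s p u)"
    unfolding gagliardo_pow_eq_gfun(1)[OF Lp_spaceD(1)[OF u], symmetric]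
    by (rule gagliardo_pow_eq_pint[OF Lp_spaceD(1)[OF u] i])
  also have "ennreal d * ennreal I + ennreal k * ennreal (gag_p s p u) = ennreal (d * I + k * gag_p s p u)"
    using d I k pint_nonneg[of "gmeas s p" p "incr u"] by (simp add: ennreal_mult ennreal_plus)
  also have "\<dots> \<le> ennreal (d * I + k * M)"
    using M k by (intro ennreal_leI add_left_mono mult_left_mono)
  also have "d * I + k * M = d * (I + n powr (n + s * p) * M)" by (simp add: k_def algebra_simps)
  finally have 1: "(\<integral>\<^sup>+ x. ennreal (w x * \<bar>u x - cube_avg u m (grid m x)\<bar>) \<partial>lebesgue)
     \<le> ennreal (d * (I + n powr (n + s * p) * M))" .
  show 2: "integrable lebesgue (\<lambda>x. w x * \<bar>u x - cube_avg u m (grid m x)\<bar>)"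
    using w(2) le_less_trans[OF 1] by (intro integrableI_nonneg f) (auto simp: less_imp_le)
  have "ennreal (LINT x|lebesgue. w x * \<bar>u x - cube_avg u m (grid m x)\<bar>) \<le> ennreal (d * (I + n powr (n + s * p) * M))"
    using 1 w(2) by (subst nn_integral_eq_integral[OF 2, symmetric]) (auto simp: less_imp_le)
  then show "(LINT x|lebesgue. w x * \<bar>u x - cube_avg u m (grid m x)\<bar>) \<le> d * (integral\<^sup>L lebesgue w + n powr (n + s * p) * M)"
    using d I M0 unfolding I_def by (subst (asm) ennreal_le_iff) auto
qed

text \<open>Coordinates are enumerated by \<open>from_nat\<close>; stage \<open>n\<close> of the
  diagonal construction makes coordinate \<open>n\<close> converge by Bolzano-Weierstrass.\<close>

lemma bounded_countable_convergent_subseq: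
  fixes a :: "nat \<Rightarrow> 'b::countable \<Rightarrow> real"
  assumes "\<And>k i. \<bar>a k i\<bar> \<le> c i"
  obtains \<rho> where "strict_mono \<rho>" "\<And>i. convergent (\<lambda>k. a (\<rho> k) i)"
proof -
  interpret subseqs "\<lambda>n \<sigma>. convergent (\<lambda>k. a (\<sigma> k) (from_nat n))"
  proof
    fix n :: nat and \<sigma> :: "nat \<Rightarrow> nat"
    have "bounded (range (\<lambda>k. a (\<sigma> k) (from_nat n)))"
      using assms by (intro boundedI[of _ "c (from_nat n)"]) auto
    then obtain l \<tau> where "strict_mono \<tau>" "((\<lambda>k. a (\<sigma> k) (from_nat n)) \<circ> \<tau>) \<longlonglongrightarrow> l"
      using bounded_imp_convergent_subsequence by blast
    then show "\<exists>\<tau>. strict_mono \<tau> \<and> convergent (\<lambda>k. a ((\<sigma> \<circ> \<tau>) k) (from_nat n))"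
      by (auto simp: convergent_def o_def)
  qed
  have "convergent (\<lambda>k. a ((diagseq \<circ> (+) (Suc n)) k) (from_nat n))" for n
  proof (rule diagseq_holds)
    fix \<tau> \<sigma> :: "nat \<Rightarrow> nat" and n
    assume "strict_mono \<tau>" "convergent (\<lambda>k. a (\<sigma> k) (from_nat n))"
    then show "convergent (\<lambda>k. a ((\<sigma> \<circ> \<tau>) k) (from_nat n))"
      unfolding o_def using convergent_subseq_convergent[of "\<lambda>k. a (\<sigma> k) (from_nat n)" \<tau>] by (simp add: o_def)
  qed
  \<comment> \<open>The diagonal sequence refines stage \<open>n\<close> only from index
    \<open>Suc n\<close> on; the initial segment does not affect convergence.\<close>
  then have "convergent (\<lambda>k. a (diagseq (k + Suc n)) (from_nat n))" for n
    by (simp only: o_apply add.commute)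
  then have "convergent (\<lambda>k. a (diagseq k) (from_nat n))" for n
    using convergent_ignore_initial_segment[of "\<lambda>k. a (diagseq k) (from_nat n)" "Suc n"] by blast
  then have "convergent (\<lambda>k. a (diagseq k) (from_nat (to_nat i)))" for i :: 'b by blast
  then have "convergent (\<lambda>k. a (diagseq k) i)" for i by simp
  with subseq_diagseq that show ?thesis by blast
qed

text \<open>Cube averages at scale \<open>2\<^sup>-\<^sup>m\<close> approximate \<open>u k\<close> in a weighted \<open>L\<^sup>1\<close> space with an error of
  order \<open>2\<^sup>-\<^sup>m\<^sup>s\<close> uniformly in \<open>k\<close>; a diagonal subsequence makes all averages converge.\<close>

theorem gagliardo_AE_convergent_subseq:
  fixes u :: "nat \<Rightarrow> real^'n \<Rightarrow> real"
  assumes u: "\<And>k. u k \<in> Lp_space lebesgue r" and r: "1 \<le> r" and p: "1 < p" and s: "0 < s"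
    and i: "\<And>k. incr (u k) \<in> Lp_space (gmeas s p) p" and M: "\<And>k. gag_p s p (u k) \<le> M"
    and M': "\<And>k. pint lebesgue r (u k) \<le> M'"
  obtains \<rho> f where "strict_mono \<rho>" "f \<in> borel_measurable lebesgue" "AE x in lebesgue. (\<lambda>k. u (\<rho> k) x) \<longlonglongrightarrow> f x"
proof -
  note [measurable] = Lp_spaceD(1)[OF u]
  obtain w :: "real^'n \<Rightarrow> real" where w: "w \<in> borel_measurable lebesgue" "\<And>x. 0 < w x" "\<And>x. w x \<le> 1" "integrable lebesgue w"
    using leb.obtain_positive_integrable_function by blast
  note [measurable] = w(1)
  have w0: "0 \<le> w x" for x using w(2)[of x] by simp
  define c where "c m = 1 + (2 ^ m) ^ CARD('n) * M'" for m :: nat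
  \<comment> \<open>Scale and cube form one countable index, so a single subsequence serves all
    scales.\<close>
  have "\<bar>case z of (m, z) \<Rightarrow> cube_avg (u k) m z\<bar> \<le> (case z of (m, z) \<Rightarrow> c m)" for k z
    using cube_avg_bound[OF u r M'] by (auto simp: c_def split: prod.split)
  then obtain \<sigma> where \<sigma>: "strict_mono \<sigma>" "\<And>z. convergent (\<lambda>k. case z of (m, z) \<Rightarrow> cube_avg (u (\<sigma> k)) m z)"
    using bounded_countable_convergent_subseq[of "\<lambda>k z. case z of (m, z) \<Rightarrow> cube_avg (u k) m z" "\<lambda>z. case z of (m, z) \<Rightarrow> c m"]
    by blast
  define y where "y k = u (\<sigma> k)" for k
  have yL: "y k \<in> Lp_space lebesgue r" for k by (simp add: y_def u)
  note [measurable] = Lp_spaceD(1)[OF yL]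
  define g where "g m z = lim (\<lambda>k. cube_avg (y k) m z)" for m z
  have g: "(\<lambda>k. cube_avg (y k) m z) \<longlonglongrightarrow> g m z" for m z
    using \<sigma>(2)[of "(m, z)"] by (simp add: g_def y_def convergent_LIMSEQ_iff)
  have cb: "\<bar>cube_avg (y k) m z\<bar> \<le> c m" for k m z
    using cube_avg_bound[OF u r M'] by (simp add: c_def y_def)
  have gb: "\<bar>g m z\<bar> \<le> c m" for m z
    by (rule LIMSEQ_le_const2[OF tendsto_rabs[OF g]]) (use cb in blast)
  have wb: "norm (w x * \<bar>cube_avg (y k) m (grid m x) - g m (grid m x)\<bar>) \<le> w x * (2 * c m)" for k m x
  proof -
    have "\<bar>cube_avg (y k) m (grid m x) - g m (grid m x)\<bar> \<le> 2 * c m"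
      using cb[of k m "grid m x"] gb[of m "grid m x"] by linarith
    then show ?thesis using w0[of x] by (simp add: abs_mult mult_left_mono)
  qed
  have i2: "integrable lebesgue (\<lambda>x. w x * \<bar>cube_avg (y k) m (grid m x) - g m (grid m x)\<bar>)" for k m
  proof (rule Bochner_Integration.integrable_bound)
    show "integrable lebesgue (\<lambda>x. w x * (2 * c m))" using w(4) by simp
    show "AE x in lebesgue. norm (w x * \<bar>cube_avg (y k) m (grid m x) - g m (grid m x)\<bar>) \<le> norm (w x * (2 * c m))"
      by (intro AE_I2 order_trans[OF wb]) (simp only: real_norm_def abs_ge_self)
  qed measurable
  have lim2: "(\<lambda>k. LINT x|lebesgue. w x * \<bar>cube_avg (y k) m (grid m x) - g m (grid m x)\<bar>) \<longlonglongrightarrow> 0" for m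
  proof -
    have "(\<lambda>k. LINT x|lebesgue. w x * \<bar>cube_avg (y k) m (grid m x) - g m (grid m x)\<bar>) \<longlonglongrightarrow> (LINT x|(lebesgue :: (real^'n) measure). 0)"
    proof (rule integral_dominated_convergence)
      show "integrable lebesgue (\<lambda>x. w x * (2 * c m))" using w(4) by simp
      show "AE x in lebesgue. norm (w x * \<bar>cube_avg (y k) m (grid m x) - g m (grid m x)\<bar>) \<le> w x * (2 * c m)" for k
        using wb by simp
      show "AE x in lebesgue. (\<lambda>k. w x * \<bar>cube_avg (y k) m (grid m x) - g m (grid m x)\<bar>) \<longlonglongrightarrow> 0"
      proof (rule AE_I2)
        fix x
        have "(\<lambda>k. w x * \<bar>cube_avg (y k) m (grid m x) - g m (grid m x)\<bar>) \<longlonglongrightarrow> w x * \<bar>g m (grid m x) - g m (grid m x)\<bar>"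
          by (intro tendsto_intros g)
        then show "(\<lambda>k. w x * \<bar>cube_avg (y k) m (grid m x) - g m (grid m x)\<bar>) \<longlonglongrightarrow> 0" by simp
      qed
    qed measurable
    then show ?thesis by simp
  qed
  define K where "K = integral\<^sup>L lebesgue w + real CARD('n) powr (real CARD('n) + s * p) * M"
  note err = cube_avg_error[OF u r p s i M w]
  have i1: "integrable lebesgue (\<lambda>x. w x * \<bar>y k x - cube_avg (y k) m (grid m x)\<bar>)" for k m
    unfolding y_def by (rule err(1))
  have e1: "(LINT x|lebesgue. w x * \<bar>y k x - cube_avg (y k) m (grid m x)\<bar>) \<le> ((1 / 2) powr s) ^ m * K" for k m
  proof -
    have "((1 / 2 :: real) ^ m) powr s = ((1 / 2) powr s) ^ m"
      by (simp add: powr_powr mult.commute flip: powr_realpow)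
    then show ?thesis using err(2)[of "\<sigma> k" m] unfolding y_def K_def by (simp add: power_divide)
  qed
  have iy: "integrable lebesgue (\<lambda>x. w x * y k x)" for k
  proof (rule Bochner_Integration.integrable_bound)
    show "integrable lebesgue (\<lambda>x. w x + \<bar>y k x\<bar> powr r)" using w(4) Lp_spaceD(2)[OF yL] by auto
    show "AE x in lebesgue. norm (w x * y k x) \<le> norm (w x + \<bar>y k x\<bar> powr r)"
    proof (rule AE_I2)
      fix x
      have "w x * \<bar>y k x\<bar> \<le> w x * (1 + \<bar>y k x\<bar> powr r)"
        using abs_le_add_powr[of 1 r "\<bar>y k x\<bar>"] r w0 by (intro mult_left_mono) auto
      also have "\<dots> \<le> w x + 1 * \<bar>y k x\<bar> powr r"
        unfolding distrib_left using w(3) by (intro add_mono mult_right_mono) auto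
      finally show "norm (w x * y k x) \<le> norm (w x + \<bar>y k x\<bar> powr r)"
        using w0[of x] by (simp add: abs_mult)
    qed
  qed measurable
  have "\<exists>N. \<forall>k\<ge>N. \<forall>l\<ge>N. (LINT x|lebesgue. norm (w x * y k x - w x * y l x)) < e" if e: "0 < e" for e
  proof -
    \<comment> \<open>The scale \<open>m\<close> is fixed first, with an error uniform in
      \<open>k\<close>; only then is \<open>N\<close> taken so large that the averages at this scale
      are close to their limits.\<close>
    have "(1 / 2) powr s < 1 powr s" using s by (intro powr_less_mono2) auto
    then have "(\<lambda>m. ((1 / 2 :: real) powr s) ^ m * K) \<longlonglongrightarrow> 0 * K"
      by (intro tendsto_mult LIMSEQ_power_zero tendsto_const) simp
    then have "\<forall>\<^sub>F m in sequentially. ((1 / 2) powr s) ^ m * K < e / 4"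
      by (rule order_tendstoD) (use e in simp)
    then obtain m where m: "((1 / 2) powr s) ^ m * K < e / 4"
      using eventually_happens'[OF sequentially_bot] by blast
    have "\<forall>\<^sub>F k in sequentially. (LINT x|lebesgue. w x * \<bar>cube_avg (y k) m (grid m x) - g m (grid m x)\<bar>) < e / 4"
      by (rule order_tendstoD(2)[OF lim2]) (use e in simp)
    then obtain N where N: "\<And>k. k \<ge> N \<Longrightarrow> (LINT x|lebesgue. w x * \<bar>cube_avg (y k) m (grid m x) - g m (grid m x)\<bar>) < e / 4"
      by (auto simp: eventually_sequentially)
    have "(LINT x|lebesgue. norm (w x * y k x - w x * y l x)) < e" if kl: "N \<le> k" "N \<le> l" for k l
    proof -
      let ?P = "\<lambda>k x. cube_avg (y k) m (grid m x)"
      have "(LINT x|lebesgue. norm (w x * y k x - w x * y l x)) \<le>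
        (LINT x|lebesgue. (w x * \<bar>y k x - ?P k x\<bar> + w x * \<bar>?P k x - g m (grid m x)\<bar>)
           + (w x * \<bar>y l x - ?P l x\<bar> + w x * \<bar>?P l x - g m (grid m x)\<bar>))"
      proof (rule integral_mono)
        fix x
        have "norm (w x * y k x - w x * y l x) = w x * \<bar>y k x - y l x\<bar>"
          using w0[of x] by (simp flip: right_diff_distrib add: abs_mult)
        also have "\<dots> \<le> w x * (\<bar>y k x - ?P k x\<bar> + \<bar>?P k x - g m (grid m x)\<bar> + \<bar>y l x - ?P l x\<bar> + \<bar>?P l x - g m (grid m x)\<bar>)"
          using w0 by (intro mult_left_mono) linarith+
        finally show "norm (w x * y k x - w x * y l x) \<le> (w x * \<bar>y k x - ?P k x\<bar> + w x * \<bar>?P k x - g m (grid m x)\<bar>)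
           + (w x * \<bar>y l x - ?P l x\<bar> + w x * \<bar>?P l x - g m (grid m x)\<bar>)" by (simp add: algebra_simps)
      qed (intro Bochner_Integration.integrable_add Bochner_Integration.integrable_norm Bochner_Integration.integrable_diff i1 i2 iy)+
      also have "\<dots> = ((LINT x|lebesgue. w x * \<bar>y k x - ?P k x\<bar>) + (LINT x|lebesgue. w x * \<bar>?P k x - g m (grid m x)\<bar>))
           + ((LINT x|lebesgue. w x * \<bar>y l x - ?P l x\<bar>) + (LINT x|lebesgue. w x * \<bar>?P l x - g m (grid m x)\<bar>))"
        by (simp only: Bochner_Integration.integral_add Bochner_Integration.integrable_add i1 i2)
      also have "\<dots> < e" using e1[of k m] e1[of l m] N[OF kl(1)] N[OF kl(2)] m by linarith
      finally show ?thesis .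
    qed
    then show ?thesis by blast
  qed
  then obtain \<tau> where \<tau>: "strict_mono \<tau>" "AE x in lebesgue. Cauchy (\<lambda>i. w x * y (\<tau> i) x)"
    using cauchy_L1_AE_cauchy_subseq[of lebesgue "\<lambda>k x. w x * y k x", OF iy] by blast
  \<comment> \<open>Where the sequence diverges \<open>lim\<close> is an arbitrary value, but this
    happens on a null set only and measurability holds regardless.\<close>
  define f where "f x = lim (\<lambda>i. y (\<tau> i) x)" for x
  have "f \<in> borel_measurable lebesgue" unfolding f_def[abs_def] by (intro borel_measurable_lim_metric) measurable
  moreover have "strict_mono (\<lambda>i. \<sigma> (\<tau> i))" using strict_mono_o[OF \<sigma>(1) \<tau>(1)] by (simp add: o_def)
  moreover have "AE x in lebesgue. (\<lambda>i. u (\<sigma> (\<tau> i)) x) \<longlonglongrightarrow> f x"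
    using \<tau>(2)
  proof eventually_elim
    case (elim x)
    then obtain l where l: "(\<lambda>i. w x * y (\<tau> i) x) \<longlonglongrightarrow> l" using Cauchy_convergent convergent_def by blast
    have "(\<lambda>i. w x * y (\<tau> i) x / w x) \<longlonglongrightarrow> l / w x"
      using w(2)[of x] by (intro tendsto_divide l tendsto_const) auto
    then have "(\<lambda>i. y (\<tau> i) x) \<longlonglongrightarrow> l / w x" using w(2)[of x] by simp
    then have "(\<lambda>i. y (\<tau> i) x) \<longlonglongrightarrow> f x"
      unfolding f_def using convergent_LIMSEQ_iff convergent_def by blast
    then show ?case by (simp add: y_def)
  qed
  ultimately show ?thesis using that by blast
qed

section \<open>Test functions\<close>

text \<open>Two families indexed by \<open>nat\<close> instead of one indexed by \<open>int\<close>,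
  because near and far shells are estimated differently and summed as separate geometric
  series.\<close>

lemma ex_dyadic:
  fixes z :: real
  assumes "0 < z"
  shows "(\<exists>j::nat. 2 powr (- real j - 1) \<le> z \<and> z < 2 powr (- real j)) \<or>
         (\<exists>j::nat. 2 powr (real j) \<le> z \<and> z < 2 powr (real j + 1))"
proof -
  define i where "i = \<lfloor>log 2 z\<rfloor>"
  have i: "2 powr (of_int i) \<le> z" "z < 2 powr (of_int i + 1)"
    using floor_log_eq_powr_iff[of z 2 i] assms i_def by auto
  show ?thesis
  proof (cases "0 \<le> i")
    case True
    then have "of_int i = real (nat i)" by simp
    then show ?thesis using i by metis
  next
    case False
    then have "of_int i = - real (nat (- i - 1)) - 1" "of_int i + 1 = - real (nat (- i - 1))" by auto
    then show ?thesis using i by metis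
  qed
qed

lemma emeasure_ball_powr:
  fixes x :: "real^'n"
  assumes "0 < \<rho>"
  shows "emeasure lebesgue (ball x \<rho>) = ennreal (unit_ball_vol (real CARD('n)) * \<rho> powr real CARD('n))"
  using assms by (simp add: emeasure_ball powr_realpow)

text \<open>Dyadic shells around \<open>x\<close>, each replaced by its enclosing ball. Near
  \<open>x\<close> the Lipschitz bound gives the ratio \<open>2 powr (s * p - p)\<close>, below 1 as
  \<open>s < 1\<close>; far away the sup bound gives \<open>2 powr (- (s * p))\<close>, below 1 as
  \<open>s > 0\<close>.\<close>

lemma gfun_bounded:
  fixes f :: "real^'n \<Rightarrow> real"
  assumes s: "0 < s" "s < 1" and p: "1 < p" and B: "\<And>x. \<bar>f x\<bar> \<le> B"
    and L: "\<And>x y. \<bar>f x - f y\<bar> \<le> L * norm (x - y)" and L0: "0 \<le> L"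
  shows "\<exists>K. \<forall>x. gfun s p f x \<le> ennreal K"
proof -
  define n where "n = real CARD('n)"
  define b where "b = unit_ball_vol n"
  have n: "0 < n" by (simp add: n_def)
  have b: "0 < b" by (simp add: b_def n_def)
  have B0: "0 \<le> B" using B[of 0] by linarith
  define \<alpha> where "\<alpha> j = L powr p * (2 powr (- real j)) powr p / (2 powr (- real j - 1)) powr (n + s * p)" for j :: nat
  define \<beta> where "\<beta> j = (2 * B) powr p / (2 powr (real j)) powr (n + s * p)" for j :: nat
  have ab: "0 \<le> \<alpha> j" "0 \<le> \<beta> j" for j by (simp_all add: \<alpha>_def \<beta>_def)
  define q1 where "q1 = 2 powr (s * p - p)"
  define q2 where "q2 = 2 powr (- (s * p))"
  have sp: "s * p < p" using s p by simp
  have q: "0 < q1" "q1 < 1" "0 < q2" "q2 < 1"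
    using sp s p powr_less_one[of 2 "s * p - p"] powr_less_one[of 2 "- (s * p)"]
    by (auto simp: q1_def q2_def)
  define c where "c j = \<alpha> j * (b * (2 powr (- real j)) powr n) + \<beta> j * (b * (2 powr (real j + 1)) powr n)" for j :: nat
  have c0: "0 \<le> c j" for j using ab b by (simp add: c_def)
  have c_eq: "c j = L powr p * 2 powr (n + s * p) * b * q1 ^ j + (2 * B) powr p * 2 powr n * b * q2 ^ j" for j
  proof -
    have qj: "q1 ^ j = 2 powr ((s * p - p) * real j)" "q2 ^ j = 2 powr (- (s * p) * real j)"
      unfolding q1_def q2_def by (simp_all add: powr_powr flip: powr_realpow)
    have k1: "K * 2 powr x / 2 powr e * 2 powr y = K * 2 powr (x - e + y)" for K x e y :: real
      by (simp add: powr_add powr_diff)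
    have k2: "K / 2 powr e * 2 powr y = K * 2 powr (y - e)" for K e y :: real
      by (simp add: powr_diff)
    have x1: "(- real j) * p - (- real j - 1) * (n + s * p) + (- real j) * n = (n + s * p) + (s * p - p) * real j"
      by (simp add: algebra_simps)
    have x2: "(real j + 1) * n - real j * (n + s * p) = n + (- (s * p) * real j)"
      by (simp add: algebra_simps)
    have "\<alpha> j * (2 powr (- real j)) powr n = L powr p * 2 powr (n + s * p) * q1 ^ j"
      unfolding \<alpha>_def powr_powr k1 x1 qj powr_add[of 2 "n + s * p"] by simp
    moreover have "\<beta> j * (2 powr (real j + 1)) powr n = (2 * B) powr p * 2 powr n * q2 ^ j"
      unfolding \<beta>_def powr_powr k2 x2 qj powr_add[of 2 n] by simp
    moreover have "c j = (\<alpha> j * (2 powr (- real j)) powr n) * b + (\<beta> j * (2 powr (real j + 1)) powr n) * b"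
      unfolding c_def by simp
    ultimately show ?thesis by simp
  qed
  have sc: "summable c"
    unfolding c_eq[abs_def] using q by (intro summable_add summable_mult summable_geometric) auto
  have "gfun s p f x \<le> ennreal (suminf c)" for x
  proof -
    have mball: "ball x \<rho> \<in> sets lebesgue" for \<rho> by simp
    have t: "(\<lambda>y. ennreal a * indicator (ball x \<rho>) y) \<in> borel_measurable lebesgue" for a \<rho>
      using mball[of \<rho>] by measurable
    define T where "T j y = ennreal (\<alpha> j) * indicator (ball x (2 powr (- real j))) y + ennreal (\<beta> j) * indicator (ball x (2 powr (real j + 1))) y" for j y
    have pw: "ennreal (\<bar>f x - f y\<bar> powr p / norm (x - y) powr (n + s * p))
      \<le> (\<Sum>j. T j y)"
      (is "?h y \<le> _") for y
    proof -
      have le: "T j y \<le> (\<Sum>j. T j y)" for j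
        using sum_le_suminf[of "\<lambda>j. T j y" "{j}"] by simp
      show ?thesis
      proof (cases "x = y")
        case False
        then have z: "0 < norm (x - y)" by simp
        from ex_dyadic[OF this] show ?thesis
        proof (elim disjE exE conjE)
          fix j :: nat assume j: "2 powr (- real j - 1) \<le> norm (x - y)" "norm (x - y) < 2 powr (- real j)"
          have "\<bar>f x - f y\<bar> powr p / norm (x - y) powr (n + s * p) \<le> \<alpha> j"
            unfolding \<alpha>_def
          proof (rule frac_le)
            have "\<bar>f x - f y\<bar> powr p \<le> (L * 2 powr (- real j)) powr p"
            proof (rule powr_mono2)
              have "L * norm (x - y) \<le> L * 2 powr (- real j)" using j L0 by (intro mult_left_mono) auto
              with L[of x y] show "\<bar>f x - f y\<bar> \<le> L * 2 powr (- real j)" by linarith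
            qed (use p in auto)
            then show "\<bar>f x - f y\<bar> powr p \<le> L powr p * (2 powr (- real j)) powr p" by (simp add: powr_mult)
            show "(2 powr (- real j - 1)) powr (n + s * p) \<le> norm (x - y) powr (n + s * p)"
              using j n s p by (intro powr_mono2) auto
          qed (use z in auto)
          then have "?h y \<le> ennreal (\<alpha> j)" by (rule ennreal_leI)
          also have "\<dots> \<le> T j y" using j by (simp add: T_def dist_norm)
          finally show ?thesis using le by (rule order_trans)
        next
          fix j :: nat assume j: "2 powr (real j) \<le> norm (x - y)" "norm (x - y) < 2 powr (real j + 1)"
          have "\<bar>f x - f y\<bar> powr p / norm (x - y) powr (n + s * p) \<le> \<beta> j"
            unfolding \<beta>_def
          proof (rule frac_le)
            show "\<bar>f x - f y\<bar> powr p \<le> (2 * B) powr p"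
              using B[of x] B[of y] p by (intro powr_mono2) auto
            show "(2 powr (real j)) powr (n + s * p) \<le> norm (x - y) powr (n + s * p)"
              using j n s p by (intro powr_mono2) auto
          qed (use z in auto)
          then have "?h y \<le> ennreal (\<beta> j)" by (rule ennreal_leI)
          also have "\<dots> \<le> T j y" using j by (simp add: T_def dist_norm)
          finally show ?thesis using le by (rule order_trans)
        qed
      qed simp
    qed
    have "gfun s p f x \<le> (\<integral>\<^sup>+ y. (\<Sum>j. T j y) \<partial>lebesgue)"
      unfolding gfun_def n_def[symmetric] by (intro nn_integral_mono pw)
    also have "\<dots> = (\<Sum>j. \<integral>\<^sup>+ y. T j y \<partial>lebesgue)"
      unfolding T_def by (rule nn_integral_suminf) (intro borel_measurable_add t)
    also have "\<dots> = (\<Sum>j. ennreal (c j))"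
    proof (rule arg_cong[where f = suminf], rule ext)
      fix j :: nat
      have "(\<integral>\<^sup>+ y. T j y \<partial>lebesgue)
        = (\<integral>\<^sup>+ y. ennreal (\<alpha> j) * indicator (ball x (2 powr (- real j))) y \<partial>lebesgue)
          + (\<integral>\<^sup>+ y. ennreal (\<beta> j) * indicator (ball x (2 powr (real j + 1))) y \<partial>lebesgue)"
        unfolding T_def by (intro nn_integral_add t)
      also have "\<dots> = ennreal (\<alpha> j) * emeasure lebesgue (ball x (2 powr (- real j)))
          + ennreal (\<beta> j) * emeasure lebesgue (ball x (2 powr (real j + 1)))"
        by (simp only: nn_integral_cmult_indicator[OF mball])
      also have "\<dots> = ennreal (\<alpha> j) * ennreal (b * (2 powr (- real j)) powr n)
          + ennreal (\<beta> j) * ennreal (b * (2 powr (real j + 1)) powr n)"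
        by (simp add: emeasure_ball_powr b_def n_def del: emeasure_completion)
      also have "\<dots> = ennreal (\<alpha> j * (b * (2 powr (- real j)) powr n))
          + ennreal (\<beta> j * (b * (2 powr (real j + 1)) powr n))"
        using ab b by (intro arg_cong2[where f = "(+)"] ennreal_mult[symmetric]) auto
      also have "\<dots> = ennreal (c j)"
        unfolding c_def using ab b by (intro ennreal_plus[symmetric]) auto
      finally show "(\<integral>\<^sup>+ y. T j y \<partial>lebesgue) = ennreal (c j)" .
    qed
    also have "\<dots> = ennreal (suminf c)" using c0 sc by (intro suminf_ennreal2)
    finally show ?thesis .
  qed
  then show ?thesis by blast
qed

text \<open>The integrand vanishes unless one of the two points lies in the ball \<open>S\<close>.
  By symmetry the double integral is at most twice the integral over \<open>S\<close> of the bounded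
  function \<open>gfun s p f\<close>.\<close>

lemma gagliardo_pow_finite:
  fixes f :: "real^'n \<Rightarrow> real"
  assumes s: "0 < s" "s < 1" and p: "1 < p" and B: "\<And>x. \<bar>f x\<bar> \<le> B"
    and L: "\<And>x y. \<bar>f x - f y\<bar> \<le> L * norm (x - y)" and L0: "0 \<le> L"
    and supp: "\<And>x. f x \<noteq> 0 \<Longrightarrow> x \<in> cball 0 R" and m: "f \<in> borel_measurable lebesgue"
  shows "gagliardo_pow s p f < \<infinity>"
proof -
  note [measurable] = m
  obtain K where K: "\<And>x. gfun s p f x \<le> ennreal K" using gfun_bounded[OF s p B L L0] by blast
  define S where "S = cball (0 :: real^'n) R"
  have S [measurable]: "S \<in> sets lebesgue" by (simp add: S_def)
  define H where "H z = ennreal (\<bar>f (fst z) - f (snd z)\<bar> powr p / norm (fst z - snd z) powr (real CARD('n) + s * p))" for z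
  have H [measurable]: "H \<in> borel_measurable (lebesgue \<Otimes>\<^sub>M lebesgue)" unfolding H_def by measurable
  have GH: "gfun s p f x = (\<integral>\<^sup>+ y. H (x, y) \<partial>lebesgue)" for x by (simp add: gfun_def H_def)
  have Hsym: "H (x, y) = H (y, x)" for x y by (simp add: H_def norm_minus_commute abs_minus_commute)
  define I where "I = (\<integral>\<^sup>+ x. indicator S x * gfun s p f x \<partial>lebesgue)"
  have I: "I < \<infinity>"
  proof -
    have "I \<le> (\<integral>\<^sup>+ x. ennreal K * indicator S x \<partial>lebesgue)"
      unfolding I_def using K by (intro nn_integral_mono) (auto simp: indicator_def)
    also have "\<dots> = ennreal K * emeasure lebesgue S" by (rule nn_integral_cmult_indicator[OF S])
    also have "\<dots> < \<infinity>" 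
      using emeasure_bounded_finite[of S] by (auto simp: S_def ennreal_mult_less_top)
    finally show ?thesis .
  qed
  have "gagliardo_pow s p f = (\<integral>\<^sup>+ z. H z \<partial>(lebesgue \<Otimes>\<^sub>M lebesgue))"
    unfolding gagliardo_pow_def by (intro nn_integral_cong) (auto simp: H_def)
  also have "\<dots> \<le> (\<integral>\<^sup>+ z. indicator S (fst z) * H z + indicator S (snd z) * H z \<partial>(lebesgue \<Otimes>\<^sub>M lebesgue))"
  proof (rule nn_integral_mono)
    fix z :: "(real^'n) \<times> (real^'n)"
    show "H z \<le> indicator S (fst z) * H z + indicator S (snd z) * H z"
    proof (cases "fst z \<in> S \<or> snd z \<in> S")
      case False
      then have "f (fst z) = 0" "f (snd z) = 0" using supp unfolding S_def by blast+
      then show ?thesis by (simp add: H_def)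
    qed (auto simp: indicator_def)
  qed
  also have "\<dots> = (\<integral>\<^sup>+ z. indicator S (fst z) * H z \<partial>(lebesgue \<Otimes>\<^sub>M lebesgue))
      + (\<integral>\<^sup>+ z. indicator S (snd z) * H z \<partial>(lebesgue \<Otimes>\<^sub>M lebesgue))"
    by (rule nn_integral_add) measurable
  also have "(\<integral>\<^sup>+ z. indicator S (fst z) * H z \<partial>(lebesgue \<Otimes>\<^sub>M lebesgue))
     = (\<integral>\<^sup>+ x. \<integral>\<^sup>+ y. indicator S x * H (x, y) \<partial>lebesgue \<partial>lebesgue)"
    by (subst leb.nn_integral_fst[symmetric]) simp_all
  also have "\<dots> = I"
    unfolding I_def GH by (intro nn_integral_cong nn_integral_cmult) measurable
  also have "(\<integral>\<^sup>+ z. indicator S (snd z) * H z \<partial>(lebesgue \<Otimes>\<^sub>M lebesgue))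
     = (\<integral>\<^sup>+ y. \<integral>\<^sup>+ x. indicator S y * H (x, y) \<partial>lebesgue \<partial>lebesgue)"
    by (subst leb2.nn_integral_snd[symmetric]) simp_all
  also have "\<dots> = I"
    unfolding I_def GH Hsym[of _ "y" for y] by (intro nn_integral_cong nn_integral_cmult) measurable
  finally show ?thesis using I by (simp add: less_top) (metis ennreal_add_eq_top infinity_ennreal_def leD less_top top_greatest)
qed

lemma C_times_continuous:
  assumes "C_times (Suc k) f"
  shows "continuous_on UNIV f"
proof (intro continuous_at_imp_continuous_on ballI differentiable_imp_continuous_within)
  show "f differentiable (at x)" for x using assms by simp
qed

lemma Cc_infty_bounds:
  fixes f :: "real^'n \<Rightarrow> real"
  assumes f: "f \<in> Cc_infty"
  obtains B L R where "0 \<le> L" "\<And>x. \<bar>f x\<bar> \<le> B" "\<And>x y. \<bar>f x - f y\<bar> \<le> L * norm (x - y)"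
    "\<And>x. f x \<noteq> 0 \<Longrightarrow> x \<in> cball 0 R" "continuous_on UNIV f"
proof -
  have C1: "C_times (Suc 0) f" and Cc: "compact (closure {x. f x \<noteq> 0})"
    using f unfolding Cc_infty_def by blast+
  have cont: "continuous_on UNIV f" using C_times_continuous[OF C1] .
  have "bounded {x. f x \<noteq> 0}" using compact_imp_bounded[OF Cc] bounded_subset closure_subset by blast
  then obtain R where R: "\<And>x. f x \<noteq> 0 \<Longrightarrow> norm x \<le> R" by (auto simp: bounded_iff)
  \<comment> \<open>One unit larger than the ball carrying the support: a point outside
    \<open>S\<close> has distance at least 1 from the support, so there the sup bound acts as a
    Lipschitz bound.\<close>
  define S where "S = cball (0 :: real^'n) (R + 1)"
  have S: "compact S" "convex S" by (simp_all add: S_def)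
  have "bounded (f ` S)" using S cont by (intro compact_imp_bounded compact_continuous_image) (auto intro: continuous_on_subset)
  then obtain B0 where B0: "\<And>x. x \<in> S \<Longrightarrow> \<bar>f x\<bar> \<le> B0" by (auto simp: bounded_iff)
  define B where "B = max B0 0"
  have B: "\<bar>f x\<bar> \<le> B" for x
    using B0[of x] R[of x] by (cases "f x = 0") (auto simp: B_def S_def le_max_iff_disj)
  have "\<exists>b. \<forall>x\<in>S. \<bar>frechet_derivative f (at x) (axis i 1)\<bar> \<le> b" for i
  proof -
    have "continuous_on UNIV (\<lambda>x. frechet_derivative f (at x) (axis i 1))" using C1 by simp
    then have "bounded ((\<lambda>x. frechet_derivative f (at x) (axis i 1)) ` S)"
      using S by (intro compact_imp_bounded compact_continuous_image) (auto intro: continuous_on_subset)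
    then show ?thesis by (auto simp: bounded_iff)
  qed
  then obtain b where b: "\<And>i x. x \<in> S \<Longrightarrow> \<bar>frechet_derivative f (at x) (axis i 1)\<bar> \<le> b i" by metis
  \<comment> \<open>Inside \<open>S\<close> the sum of the bounds on the partial derivatives
    controls the operator norm; \<open>B\<close> covers pairs with a point outside
    \<open>S\<close>.\<close>
  define L where "L = max (\<Sum>i\<in>UNIV. b i) B"
  have L0: "0 \<le> L" by (simp add: L_def B_def le_max_iff_disj)
  have lip: "\<bar>f x - f y\<bar> \<le> L * norm (x - y)" if xy: "x \<in> S" "y \<in> S" for x y
  proof -
    have "norm (f x - f y) \<le> L * norm (x - y)"
    proof (rule differentiable_bound[OF S(2) _ _ xy])
      fix x assume x: "x \<in> S"
      have D: "(f has_derivative frechet_derivative f (at x)) (at x)"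
        using C1 by (simp flip: frechet_derivative_works)
      then show "(f has_derivative frechet_derivative f (at x)) (at x within S)"
        by (rule has_derivative_at_withinI)
      show "onorm (frechet_derivative f (at x)) \<le> L"
      proof (rule onorm_bound[OF L0])
        fix v :: "real^'n"
        have lin: "linear (frechet_derivative f (at x))" using D has_derivative_linear by blast
        have "frechet_derivative f (at x) v = frechet_derivative f (at x) (\<Sum>i\<in>UNIV. v $ i *\<^sub>R axis i 1)"
          using basis_expansion[of v] by (simp add: scalar_mult_eq_scaleR)
        also have "\<dots> = (\<Sum>i\<in>UNIV. v $ i * frechet_derivative f (at x) (axis i 1))"
          by (simp add: linear_sum[OF lin] linear_scale[OF lin])
        finally have "norm (frechet_derivative f (at x) v) \<le> (\<Sum>i\<in>UNIV. \<bar>v $ i * frechet_derivative f (at x) (axis i 1)\<bar>)"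
          by simp
        also have "\<dots> \<le> (\<Sum>i\<in>UNIV. b i * norm v)"
          unfolding abs_mult using b[OF x] component_le_norm_cart[of v]
          by (intro sum_mono) (metis abs_ge_zero mult.commute mult_mono' )
        also have "\<dots> \<le> L * norm v"
          unfolding sum_distrib_right[symmetric] by (intro mult_right_mono) (auto simp: L_def)
        finally show "norm (frechet_derivative f (at x) v) \<le> L * norm v" .
      qed
    qed
    then show ?thesis by simp
  qed
  have far: "\<bar>f x - f y\<bar> \<le> L * norm (x - y)" if "y \<notin> S" for x y
  proof (cases "f x = 0")
    case True
    then show ?thesis using that R[of y] L0 by (cases "f y = 0") (auto simp: S_def)
  next
    case False
    have "f y = 0" using that R[of y] by (auto simp: S_def)
    have "R + 1 < norm y" "norm x \<le> R" using that R[OF False] by (auto simp: S_def)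
    then have "1 \<le> norm (x - y)" using norm_triangle_ineq3[of x y] by linarith
    then have "L * 1 \<le> L * norm (x - y)" using L0 by (intro mult_left_mono) auto
    moreover have "\<bar>f x\<bar> \<le> L" using B[of x] by (simp add: L_def)
    ultimately show ?thesis using \<open>f y = 0\<close> by simp
  qed
  have "\<bar>f x - f y\<bar> \<le> L * norm (x - y)" for x y
    using lip[of x y] far[of y x] far[of x y] by (metis abs_minus_commute norm_minus_commute)
  then show ?thesis using that[OF L0 B] R cont by auto
qed

lemma Cc_infty_borel:
  assumes "f \<in> Cc_infty"
  shows "f \<in> borel_measurable lebesgue"
proof -
  have "C_times (Suc 0) f" using assms unfolding Cc_infty_def by blast
  then have "f \<in> borel_measurable borel"
    by (intro borel_measurable_continuous_onI C_times_continuous)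
  then show ?thesis by (intro measurable_completion) simp
qed

lemma Cc_infty_gagliardo_finite:
  assumes "0 < s" "s < 1" "1 < p" "f \<in> Cc_infty"
  shows "gagliardo_pow s p f < \<infinity>"
proof -
  obtain B L R where "0 \<le> L" "\<And>x. \<bar>f x\<bar> \<le> B" "\<And>x y. \<bar>f x - f y\<bar> \<le> L * norm (x - y)"
    "\<And>x. f x \<noteq> 0 \<Longrightarrow> x \<in> cball 0 R"
    using Cc_infty_bounds[OF assms(4)] by metis
  then show ?thesis
    using assms Cc_infty_borel[OF assms(4)] by (intro gagliardo_pow_finite[where B = B and L = L and R = R]) auto
qed

lemma Cc_infty_Lp:
  fixes f :: "real^'n \<Rightarrow> real"
  assumes f: "f \<in> Cc_infty" and r: "0 < r"
  shows "f \<in> Lp_space lebesgue r"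
proof -
  note [measurable] = Cc_infty_borel[OF f]
  obtain B L R where B: "\<And>x. \<bar>f x\<bar> \<le> B" "\<And>x. f x \<noteq> 0 \<Longrightarrow> x \<in> cball 0 R"
    using Cc_infty_bounds[OF f] by metis
  have "integrable lebesgue (\<lambda>x. B powr r * indicator (cball (0 :: real^'n) R) x)"
    by (intro Bochner_Integration.integrable_mult_right integrable_real_indicator)
      (use emeasure_bounded_finite[of "cball (0 :: real^'n) R"] in auto)
  then have "integrable lebesgue (\<lambda>x. \<bar>f x\<bar> powr r)"
  proof (rule Bochner_Integration.integrable_bound)
    show "AE x in lebesgue. norm (\<bar>f x\<bar> powr r) \<le> norm (B powr r * indicator (cball 0 R) x)"
    proof (rule AE_I2)
      fix x
      show "norm (\<bar>f x\<bar> powr r) \<le> norm (B powr r * indicator (cball 0 R) x)"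
        using B[of x] r by (cases "f x = 0") (auto intro: powr_mono2)
    qed
  qed measurable
  then show ?thesis by (auto simp: Lp_space_def)
qed

section \<open>Linear operations on \<open>Cc_infty\<close> and a bump function\<close>

lemma C_times_add: "C_times k f \<Longrightarrow> C_times k g \<Longrightarrow> C_times k (\<lambda>x. f x + g x)"
proof (induction k arbitrary: f g)
  case (Suc k)
  have "frechet_derivative (\<lambda>x. f x + g x) (at x) = (\<lambda>h. frechet_derivative f (at x) h + frechet_derivative g (at x) h)" for x
    using Suc.prems by (intro frechet_derivative_at[symmetric] has_derivative_add) (simp_all flip: frechet_derivative_works)
  then show ?case using Suc by (auto intro: differentiable_add)
qed (auto intro: continuous_intros)

lemma C_times_cmult: "C_times k f \<Longrightarrow> C_times k (\<lambda>x. c * f x)"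
proof (induction k arbitrary: f)
  case (Suc k)
  have "frechet_derivative (\<lambda>x. c * f x) (at x) = (\<lambda>h. c * frechet_derivative f (at x) h)" for x
    using Suc.prems by (intro frechet_derivative_at[symmetric] has_derivative_mult_right) (simp_all flip: frechet_derivative_works)
  then show ?case using Suc by (auto intro: differentiable_mult)
qed (auto intro: continuous_intros)

lemma Cc_infty_iff: "f \<in> Cc_infty \<longleftrightarrow> (\<forall>k. C_times k f) \<and> bounded {x. f x \<noteq> 0}"
  unfolding Cc_infty_def by simp

lemma Cc_infty_add:
  assumes "f \<in> Cc_infty" "g \<in> Cc_infty"
  shows "(\<lambda>x. f x + g x) \<in> Cc_infty"
proof -
  have "bounded {x. f x + g x \<noteq> 0}"
    by (rule bounded_subset[of "{x. f x \<noteq> 0} \<union> {x. g x \<noteq> 0}"]) (use assms in \<open>auto simp: Cc_infty_iff\<close>)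
  then show ?thesis using assms by (simp add: Cc_infty_iff C_times_add)
qed

lemma Cc_infty_cmult:
  assumes "f \<in> Cc_infty"
  shows "(\<lambda>x. c * f x) \<in> Cc_infty"
proof -
  have "bounded {x. c * f x \<noteq> 0}"
    by (rule bounded_subset[of "{x. f x \<noteq> 0}"]) (use assms in \<open>auto simp: Cc_infty_iff\<close>)
  then show ?thesis using assms by (simp add: Cc_infty_iff C_times_cmult)
qed

text \<open>The functions \<open>t \<mapsto> e\<^sup>-\<^sup>1\<^sup>/\<^sup>t t\<^sup>-\<^sup>m\<close>, extended by \<open>0\<close>, are closed under differentiation up to
  linear combinations; hence so is the algebra generated by their values at \<open>R\<^sup>2 - \<bar>x\<bar>\<^sup>2\<close> and the
  coordinates.\<close>

definition flat :: "nat \<Rightarrow> real \<Rightarrow> real" where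
  "flat m t = (if t \<le> 0 then 0 else exp (- inverse t) * inverse t ^ m)"

lemma flat_tendsto_0: "(flat m \<longlongrightarrow> 0) (at 0)"
proof -
  have "((\<lambda>t. inverse t ^ m / exp (inverse t)) \<longlongrightarrow> 0) (at_right (0 :: real))"
    by (rule filterlim_compose[OF tendsto_power_div_exp_0 filterlim_inverse_at_top_right])
  then have "(flat m \<longlongrightarrow> 0) (at_right 0)"
    by (rule tendsto_cong[THEN iffD1, rotated])
      (use eventually_at_right_less[of "0 :: real"] in \<open>eventually_elim, simp add: flat_def exp_minus field_simps\<close>)
  moreover have "(flat m \<longlongrightarrow> 0) (at_left 0)"
    by (rule tendsto_eventually)
      (use eventually_at_left_real[of "- 1" "0 :: real"] in \<open>auto simp: flat_def elim!: eventually_mono\<close>)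
  ultimately show ?thesis by (simp add: filterlim_split_at)
qed

lemma flat_derivative: "(flat m has_real_derivative (flat (m + 2) t - real m * flat (m + 1) t)) (at t)"
proof -
  consider "t < 0" | "t > 0" | "t = 0" by linarith
  then show ?thesis
  proof cases
    case 1
    have "((\<lambda>t. 0 :: real) has_real_derivative 0) (at t)" by simp
    then have "(flat m has_real_derivative 0) (at t)"
      by (rule DERIV_cong_ev[THEN iffD1, rotated 3])
        (use 1 eventually_nhds_in_open[of "{..<0}" t] in \<open>auto simp: flat_def elim!: eventually_mono\<close>)
    then show ?thesis using 1 by (simp add: flat_def)
  next
    case 2
    have "((\<lambda>t. exp (- inverse t) * inverse t ^ m) has_real_derivative (flat (m + 2) t - real m * flat (m + 1) t)) (at t)"
    proof -
      define w where "w = inverse t"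
      have inv: "(inverse has_real_derivative - (w\<^sup>2)) (at t)"
        using DERIV_inverse[of t] 2 by (simp add: w_def power2_eq_square power_inverse)
      have "((\<lambda>t. exp (- inverse t) * inverse t ^ m) has_real_derivative
          (exp (- w) * w\<^sup>2 * w ^ m + exp (- w) * (real m * w ^ (m - 1) * - (w\<^sup>2)))) (at t)"
        unfolding w_def by (rule derivative_eq_intros inv[unfolded w_def] refl | simp)+
      moreover have "exp (- w) * w\<^sup>2 * w ^ m + exp (- w) * (real m * w ^ (m - 1) * - (w\<^sup>2))
          = flat (m + 2) t - real m * flat (m + 1) t"
        using 2 by (cases m) (simp_all add: flat_def w_def power2_eq_square algebra_simps)
      ultimately show ?thesis by simp
    qed
    then show ?thesis
      by (rule DERIV_cong_ev[THEN iffD1, rotated 3])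
        (use 2 eventually_nhds_in_open[of "{0<..}" t] in \<open>auto simp: flat_def elim!: eventually_mono\<close>)
  next
    case 3
    \<comment> \<open>At 0 the difference quotient of \<open>flat m\<close> is
      \<open>flat (m + 1)\<close>, which tends to 0.\<close>
    have "((\<lambda>h. flat m h / h) \<longlongrightarrow> 0) (at 0)"
    proof (rule Lim_transform_eventually[OF flat_tendsto_0[of "m + 1"]])
      show "\<forall>\<^sub>F h in at 0. flat (m + 1) h = flat m h / h"
        by (auto simp: flat_def field_simps intro!: always_eventually)
    qed
    then show ?thesis using 3 by (simp add: has_field_derivative_iff flat_def)
  qed
qed

inductive_set smooth_gen :: "real \<Rightarrow> (real^'n \<Rightarrow> real) set" for R where
  const: "(\<lambda>x. c) \<in> smooth_gen R"
| coord: "(\<lambda>x. x $ i) \<in> smooth_gen R"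
| bump: "(\<lambda>x. flat m (R\<^sup>2 - x \<bullet> x)) \<in> smooth_gen R"
| add: "f \<in> smooth_gen R \<Longrightarrow> g \<in> smooth_gen R \<Longrightarrow> (\<lambda>x. f x + g x) \<in> smooth_gen R"
| mult: "f \<in> smooth_gen R \<Longrightarrow> g \<in> smooth_gen R \<Longrightarrow> (\<lambda>x. f x * g x) \<in> smooth_gen R"

text \<open>The partial derivatives have to stay in the same algebra, so that
  \<open>C_times k\<close> follows for every \<open>k\<close> by induction.\<close>

lemma smooth_gen_derivative:
  assumes "f \<in> smooth_gen R"
  shows "\<exists>f'. (\<forall>x. (f has_derivative f' x) (at x)) \<and> (\<forall>i. (\<lambda>x. f' x (axis i 1)) \<in> smooth_gen R)"
  using assms
proof induction
  case (const c)
  show ?case by (intro exI[of _ "\<lambda>x h. 0"]) (auto intro: smooth_gen.const)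
next
  case (coord i)
  show ?case
    by (intro exI[of _ "\<lambda>x h. h $ i"]) (auto intro: smooth_gen.const bounded_linear_imp_has_derivative bounded_linear_vec_nth)
next
  case (bump m)
  let ?t = "\<lambda>x :: real^'n. R\<^sup>2 - x \<bullet> x"
  let ?f' = "\<lambda>x h. - (x \<bullet> h + h \<bullet> x) * (flat (m + 2) (?t x) - real m * flat (m + 1) (?t x))"
  have "((\<lambda>x. flat m (?t x)) has_derivative ?f' x) (at x)" for x
  proof -
    have "(?t has_derivative (\<lambda>h. - (x \<bullet> h + h \<bullet> x))) (at x)"
      by (auto intro!: derivative_eq_intros)
    from has_derivative_compose[OF this flat_derivative[unfolded has_field_derivative_def]]
    show ?thesis by (simp add: mult.commute)
  qed
  moreover have "(\<lambda>x. ?f' x (axis i 1)) \<in> smooth_gen R" for i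
  proof -
    have "(\<lambda>x. ((- 2) * x $ i) * (flat (m + 2) (?t x) + (- real m) * flat (m + 1) (?t x))) \<in> smooth_gen R"
      by (intro smooth_gen.mult smooth_gen.add smooth_gen.bump smooth_gen.coord smooth_gen.const)
    moreover have "(\<lambda>x. ?f' x (axis i 1)) = (\<lambda>x. ((- 2) * x $ i) * (flat (m + 2) (?t x) + (- real m) * flat (m + 1) (?t x)))"
      by (rule ext) (simp add: inner_axis inner_commute[of "axis i 1"])
    ultimately show ?thesis by simp
  qed
  ultimately show ?case by (intro exI[of _ ?f']) blast
next
  case (add f g)
  then obtain f' g' where "\<And>x. (f has_derivative f' x) (at x)" "\<And>i. (\<lambda>x. f' x (axis i 1)) \<in> smooth_gen R"
    "\<And>x. (g has_derivative g' x) (at x)" "\<And>i. (\<lambda>x. g' x (axis i 1)) \<in> smooth_gen R" by metis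
  then show ?case
    by (intro exI[of _ "\<lambda>x h. f' x h + g' x h"]) (auto intro: has_derivative_add smooth_gen.add)
next
  case (mult f g)
  then obtain f' g' where f': "\<And>x. (f has_derivative f' x) (at x)" "\<And>i. (\<lambda>x. f' x (axis i 1)) \<in> smooth_gen R"
    and g': "\<And>x. (g has_derivative g' x) (at x)" "\<And>i. (\<lambda>x. g' x (axis i 1)) \<in> smooth_gen R" by metis
  have "((\<lambda>x. f x * g x) has_derivative (\<lambda>h. f x * g' x h + f' x h * g x)) (at x)" for x
    by (rule has_derivative_mult[OF f'(1) g'(1)])
  moreover have "(\<lambda>x. f x * g' x (axis i 1) + f' x (axis i 1) * g x) \<in> smooth_gen R" for i
    by (rule smooth_gen.add[OF smooth_gen.mult[OF mult.hyps(1) g'(2)] smooth_gen.mult[OF f'(2) mult.hyps(2)]])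
  ultimately show ?case by (intro exI[of _ "\<lambda>x h. f x * g' x h + f' x h * g x"]) blast
qed

lemma smooth_gen_C_times: "f \<in> smooth_gen R \<Longrightarrow> C_times k f"
proof (induction k arbitrary: f)
  case 0
  then obtain f' where f': "\<And>x. (f has_derivative f' x) (at x)" using smooth_gen_derivative by blast
  show ?case unfolding C_times.simps
    by (intro continuous_at_imp_continuous_on ballI has_derivative_continuous[OF f'])
next
  case (Suc k)
  then obtain f' where f': "\<And>x. (f has_derivative f' x) (at x)" "\<And>i. (\<lambda>x. f' x (axis i 1)) \<in> smooth_gen R"
    using smooth_gen_derivative by blast
  have "frechet_derivative f (at x) = f' x" for x using frechet_derivative_at[OF f'(1)] by simp
  then show ?case using f' Suc.IH by (auto simp: differentiable_def)
qed

lemma bump_Cc_infty: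
  assumes "0 < R"
  obtains f :: "real^'n \<Rightarrow> real" where "f \<in> Cc_infty" "\<And>x. norm x < R \<Longrightarrow> 0 < f x"
proof
  let ?f = "\<lambda>x :: real^'n. flat 0 (R\<^sup>2 - x \<bullet> x)"
  have "bounded {x. ?f x \<noteq> 0}"
  proof (rule bounded_subset[OF bounded_cball])
    show "{x. ?f x \<noteq> 0} \<subseteq> cball 0 R"
    proof
      fix x assume "x \<in> {x. ?f x \<noteq> 0}"
      then have "x \<bullet> x \<le> R\<^sup>2" by (auto simp: flat_def split: if_splits)
      then show "x \<in> cball 0 R" using assms by (simp add: dot_square_norm power2_le_iff_abs_le abs_le_square_iff)
    qed
  qed
  moreover have "\<forall>k. C_times k ?f" by (intro allI smooth_gen_C_times[where R = R] smooth_gen.bump)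
  ultimately show "?f \<in> Cc_infty" by (simp add: Cc_infty_iff)
  show "0 < ?f x" if "norm x < R" for x
    using that power_strict_mono[OF that, of 2] by (simp add: flat_def dot_square_norm)
qed

section \<open>The space of the Gagliardo seminorm\<close>

lemma incr_linear:
  "incr (\<lambda>x. u x + v x) = (\<lambda>z. incr u z + incr v z)"
  "incr (\<lambda>x. u x - v x) = (\<lambda>z. incr u z - incr v z)"
  "incr (\<lambda>x. c * u x) = (\<lambda>z. c * incr u z)"
  by (auto simp: incr_def algebra_simps)

lemma D_space_Lp:
  fixes v :: "real^'n \<Rightarrow> real"
  assumes "v \<in> D_space s p"
  shows "v \<in> Lp_space lebesgue (crit_exp TYPE('n) s p)" "v \<in> borel_measurable lebesgue"
  using assms by (auto simp: D_space_def Lp_space_def)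

lemma Cc_infty_incr:
  assumes "0 < s" "s < 1" "1 < p" "f \<in> Cc_infty"
  shows "incr f \<in> Lp_space (gmeas s p) p"
  using incr_Lp_iff[OF Cc_infty_borel[OF assms(4)]] Cc_infty_gagliardo_finite[OF assms] by blast

text \<open>The definition of \<open>D_space\<close> controls only the differences from test
  functions; the seminorm of \<open>v\<close> itself is finite because test functions have finite
  seminorm.\<close>

lemma D_space_incr:
  assumes s: "0 < s" "s < 1" and p: "1 < p" and v: "v \<in> D_space s p"
  shows "incr v \<in> Lp_space (gmeas s p) p"
    and "0 < e \<Longrightarrow> \<exists>f\<in>Cc_infty. gag_p s p (\<lambda>x. f x - v x) < e"
proof -
  obtain \<phi> where \<phi>: "\<And>k. \<phi> k \<in> Cc_infty" "(\<lambda>k::nat. gagliardo_pow s p (\<lambda>x. \<phi> k x - v x)) \<longlonglongrightarrow> 0"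
    using v unfolding D_space_def by blast
  have ex: "\<exists>f\<in>Cc_infty. gagliardo_pow s p (\<lambda>x. f x - v x) < ennreal e" if "0 < e" for e
  proof -
    have "\<forall>\<^sub>F k in sequentially. gagliardo_pow s p (\<lambda>x. \<phi> k x - v x) < ennreal e"
      using order_tendstoD(2)[OF \<phi>(2), of "ennreal e"] that by simp
    then show ?thesis using eventually_happens'[OF sequentially_bot] \<phi>(1) by blast
  qed
  have m: "(\<lambda>x. f x - v x) \<in> borel_measurable lebesgue" if "f \<in> Cc_infty" for f
    using Cc_infty_borel[OF that] D_space_Lp(2)[OF v] by (intro borel_measurable_diff)
  have i: "incr (\<lambda>x. f x - v x) \<in> Lp_space (gmeas s p) p"
    if "f \<in> Cc_infty" "gagliardo_pow s p (\<lambda>x. f x - v x) < ennreal e" for f e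
    unfolding incr_Lp_iff[OF m[OF that(1)]] using that(2) by (simp add: less_top order.strict_trans)
  show 1: "incr v \<in> Lp_space (gmeas s p) p"
  proof -
    obtain f where f: "f \<in> Cc_infty" "gagliardo_pow s p (\<lambda>x. f x - v x) < ennreal 1" using ex[of 1] by auto
    have "(\<lambda>z. incr f z - incr (\<lambda>x. f x - v x) z) \<in> Lp_space (gmeas s p) p"
      using i[OF f] Cc_infty_incr[OF s p f(1)] p by (intro Lp_space_diff) auto
    then show ?thesis by (simp add: incr_linear)
  qed
  show "\<exists>f\<in>Cc_infty. gag_p s p (\<lambda>x. f x - v x) < e" if e: "0 < e"
  proof -
    obtain f where f: "f \<in> Cc_infty" "gagliardo_pow s p (\<lambda>x. f x - v x) < ennreal e" using ex[OF e] by auto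
    then have "ennreal (gag_p s p (\<lambda>x. f x - v x)) < ennreal e"
      using gagliardo_pow_eq_pint[OF m[OF f(1)] i[OF f]] by simp
    then have "gag_p s p (\<lambda>x. f x - v x) < e" using ennreal_less_iff[OF pint_nonneg] by blast
    with f(1) show ?thesis by blast
  qed
qed

text \<open>The premise on \<open>incr v\<close> excludes an infinite seminorm, for which
  \<open>gag_p\<close> would be the default value 0 and the approximation premise would say
  nothing.\<close>

lemma D_spaceI:
  fixes v :: "real^'n \<Rightarrow> real"
  assumes s: "0 < s" "s < 1" and p: "1 < p" and v: "v \<in> Lp_space lebesgue (crit_exp TYPE('n) s p)"
    and i: "incr v \<in> Lp_space (gmeas s p) p"
    and ex: "\<And>e. 0 < e \<Longrightarrow> \<exists>f\<in>Cc_infty. gag_p s p (\<lambda>x. f x - v x) < e"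
  shows "v \<in> D_space s p"
proof -
  have "\<exists>f\<in>Cc_infty. gag_p s p (\<lambda>x. f x - v x) < 1 / real (Suc k)" for k by (intro ex) simp
  then obtain \<phi> where \<phi>: "\<And>k. \<phi> k \<in> Cc_infty" "\<And>k. gag_p s p (\<lambda>x. \<phi> k x - v x) < 1 / real (Suc k)" by metis
  have "(\<lambda>k. gagliardo_pow s p (\<lambda>x. \<phi> k x - v x)) \<longlonglongrightarrow> 0"
  proof (rule tendsto_sandwich[OF _ _ tendsto_const])
    show "\<forall>\<^sub>F k in sequentially. gagliardo_pow s p (\<lambda>x. \<phi> k x - v x) \<le> ennreal (1 / real (Suc k))"
    proof (intro always_eventually allI)
      fix k
      have "incr (\<lambda>x. \<phi> k x - v x) \<in> Lp_space (gmeas s p) p"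
        unfolding incr_linear using Cc_infty_incr[OF s p \<phi>(1)] i p by (intro Lp_space_diff) auto
      moreover have "(\<lambda>x. \<phi> k x - v x) \<in> borel_measurable lebesgue"
        using Cc_infty_borel[OF \<phi>(1)] Lp_spaceD(1)[OF v] by (intro borel_measurable_diff)
      ultimately have "gagliardo_pow s p (\<lambda>x. \<phi> k x - v x) = ennreal (gag_p s p (\<lambda>x. \<phi> k x - v x))"
        by (intro gagliardo_pow_eq_pint)
      then show "gagliardo_pow s p (\<lambda>x. \<phi> k x - v x) \<le> ennreal (1 / real (Suc k))"
        using \<phi>(2)[of k] by (simp add: ennreal_leI less_imp_le)
    qed
    have "(\<lambda>k. ennreal (1 / real (Suc k))) \<longlonglongrightarrow> ennreal 0"
      by (intro tendsto_ennrealI LIMSEQ_Suc lim_1_over_n)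
    then show "(\<lambda>k. ennreal (1 / real (Suc k))) \<longlonglongrightarrow> 0" by simp
  qed simp
  then show ?thesis using v \<phi>(1) unfolding D_space_def by blast
qed

lemma Cc_infty_D_space:
  fixes f :: "real^'n \<Rightarrow> real"
  assumes s: "0 < s" "s < 1" and p: "1 < p" and sp: "s * p < real CARD('n)" and f: "f \<in> Cc_infty"
  shows "f \<in> D_space s p"
proof (rule D_spaceI[OF s p])
  have "0 < crit_exp TYPE('n) s p" using sp p by (simp add: crit_exp_def)
  then show "f \<in> Lp_space lebesgue (crit_exp TYPE('n) s p)" by (rule Cc_infty_Lp[OF f])
  show "incr f \<in> Lp_space (gmeas s p) p" by (rule Cc_infty_incr[OF s p f])
  show "\<exists>g\<in>Cc_infty. gag_p s p (\<lambda>x. g x - f x) < e" if "0 < e" for e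
    using f that by (intro bexI[of _ f]) (auto simp: pint_def incr_def)
qed

lemma D_space_add:
  fixes u v :: "real^'n \<Rightarrow> real"
  assumes s: "0 < s" "s < 1" and p: "1 < p" and sp: "s * p < real CARD('n)"
    and u: "u \<in> D_space s p" and v: "v \<in> D_space s p"
  shows "(\<lambda>x. u x + v x) \<in> D_space s p"
proof (rule D_spaceI[OF s p])
  note iu = D_space_incr[OF s p u] and iv = D_space_incr[OF s p v]
  have "0 \<le> crit_exp TYPE('n) s p" using sp p by (simp add: crit_exp_def)
  then show "(\<lambda>x. u x + v x) \<in> Lp_space lebesgue (crit_exp TYPE('n) s p)"
    by (intro Lp_space_add D_space_Lp(1) u v)
  show "incr (\<lambda>x. u x + v x) \<in> Lp_space (gmeas s p) p"
    unfolding incr_linear using iu(1) iv(1) p by (intro Lp_space_add) auto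
  fix e :: real assume "0 < e"
  then have e: "0 < e / (2 * 2 powr p)" by simp
  obtain f g where f: "f \<in> Cc_infty" "gag_p s p (\<lambda>x. f x - u x) < e / (2 * 2 powr p)"
    and g: "g \<in> Cc_infty" "gag_p s p (\<lambda>x. g x - v x) < e / (2 * 2 powr p)"
    using iu(2)[OF e] iv(2)[OF e] by blast
  have "gag_p s p (\<lambda>x. (f x - u x) + (g x - v x)) \<le> 2 powr p * (gag_p s p (\<lambda>x. f x - u x) + gag_p s p (\<lambda>x. g x - v x))"
    unfolding incr_linear using iu(1) iv(1) Cc_infty_incr[OF s p f(1)] Cc_infty_incr[OF s p g(1)] p
    by (intro pint_add_le Lp_space_diff) auto
  also have "\<dots> < 2 powr p * (e / (2 * 2 powr p) + e / (2 * 2 powr p))"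
    using f(2) g(2) by (intro mult_strict_left_mono add_strict_mono) auto
  also have "\<dots> = e" by simp
  also have "(\<lambda>x. (f x - u x) + (g x - v x)) = (\<lambda>x. (f x + g x) - (u x + v x))" by auto
  finally show "\<exists>h\<in>Cc_infty. gag_p s p (\<lambda>x. h x - (u x + v x)) < e"
    using Cc_infty_add[OF f(1) g(1)] by (intro bexI[of _ "\<lambda>x. f x + g x"])
qed

lemma D_space_cmult:
  fixes u :: "real^'n \<Rightarrow> real"
  assumes s: "0 < s" "s < 1" and p: "1 < p" and u: "u \<in> D_space s p"
  shows "(\<lambda>x. c * u x) \<in> D_space s p"
proof (rule D_spaceI[OF s p])
  note iu = D_space_incr[OF s p u]
  show "(\<lambda>x. c * u x) \<in> Lp_space lebesgue (crit_exp TYPE('n) s p)"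
    by (intro Lp_space_cmult D_space_Lp(1) u)
  show "incr (\<lambda>x. c * u x) \<in> Lp_space (gmeas s p) p"
    unfolding incr_linear by (intro Lp_space_cmult iu)
  fix e :: real assume e0: "0 < e"
  define k where "k = \<bar>c\<bar> powr p + 1"
  have k: "0 < k" "\<bar>c\<bar> powr p \<le> k" by (auto simp: k_def intro!: add_nonneg_pos)
  obtain f where f: "f \<in> Cc_infty" "gag_p s p (\<lambda>x. f x - u x) < e / k"
    using iu(2)[of "e / k"] e0 k by auto
  have "gag_p s p (\<lambda>x. c * (f x - u x)) = \<bar>c\<bar> powr p * gag_p s p (\<lambda>x. f x - u x)"
    unfolding incr_linear(3) by (rule pint_cmult)
  also have "\<dots> \<le> k * gag_p s p (\<lambda>x. f x - u x)"
    using k by (intro mult_right_mono pint_nonneg)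
  also have "\<dots> < k * (e / k)" using f k by (intro mult_strict_left_mono) auto
  also have "\<dots> = e" using k by simp
  finally show "\<exists>h\<in>Cc_infty. gag_p s p (\<lambda>x. h x - c * u x) < e"
    using Cc_infty_cmult[OF f(1), of c] by (intro bexI[of _ "\<lambda>x. c * f x"]) (auto simp: right_diff_distrib)
qed

text \<open>A null set times the whole space, in either order, is null for the product, and
  \<open>gmeas\<close> has a density with respect to the product.\<close>

lemma AE_gmeas:
  assumes "AE x in (lebesgue :: (real^'n) measure). P x"
  shows "AE z in (gmeas s p :: ((real^'n) \<times> (real^'n)) measure). P (fst z) \<and> P (snd z)"
proof -
  obtain N where N: "\<And>x. x \<in> space lebesgue - N \<Longrightarrow> P x" "N \<in> null_sets lebesgue"
    using AE_E3[OF assms] by metis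
  have Ns: "N \<in> sets lebesgue" "emeasure lebesgue N = 0" "UNIV \<in> sets (lebesgue :: (real^'n) measure)"
    using null_setsD1[OF N(2)] null_setsD2[OF N(2)] by simp_all
  have "N \<times> UNIV \<in> null_sets (lebesgue \<Otimes>\<^sub>M (lebesgue :: (real^'n) measure))"
    using leb.emeasure_pair_measure_Times[OF Ns(1,3)] Ns(2) pair_measureI[OF Ns(1,3)] by (intro null_setsI) simp_all
  moreover have "UNIV \<times> N \<in> null_sets ((lebesgue :: (real^'n) measure) \<Otimes>\<^sub>M lebesgue)"
    using leb.emeasure_pair_measure_Times[OF Ns(3,1)] Ns(2) pair_measureI[OF Ns(3,1)] by (intro null_setsI) simp_all
  ultimately have "(N \<times> UNIV) \<union> (UNIV \<times> N) \<in> null_sets (lebesgue \<Otimes>\<^sub>M lebesgue)" by blast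
  then have "AE z in (lebesgue \<Otimes>\<^sub>M lebesgue). P (fst z) \<and> P (snd z)"
  proof (rule AE_I')
    have "x \<in> N" if "\<not> P x" for x using N(1)[of x] that by auto
    then show "{z \<in> space (lebesgue \<Otimes>\<^sub>M lebesgue). \<not> (P (fst z) \<and> P (snd z))} \<subseteq> N \<times> UNIV \<union> UNIV \<times> N"
      by auto
  qed
  then show ?thesis unfolding gmeas_def by (subst AE_density) auto
qed

text \<open>The midpoint hull stays inside the vector space \<^const>\<open>D_space\<close>, so weak closedness reduces to
  the strong approximation of \<open>f\<close> by midpoints.\<close>

lemma D_space_AE_closed:
  fixes u :: "nat \<Rightarrow> real^'n \<Rightarrow> real"
  assumes s: "0 < s" "s < 1" and p: "1 < p" and sp: "s * p < real CARD('n)"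
    and u: "\<And>k. u k \<in> D_space s p" and M: "\<And>k. gag_p s p (u k) \<le> M"
    and M': "\<And>k. pint lebesgue (crit_exp TYPE('n) s p) (u k) \<le> M'"
    and f: "f \<in> borel_measurable lebesgue" and lim: "AE x in lebesgue. (\<lambda>k. u k x) \<longlonglongrightarrow> f x"
  shows "f \<in> D_space s p"
proof (rule D_spaceI[OF s p])
  have r: "0 < crit_exp TYPE('n) s p" using sp p by (simp add: crit_exp_def)
  show "f \<in> Lp_space lebesgue (crit_exp TYPE('n) s p)"
    by (rule Lp_fatou(1)[OF D_space_Lp(1)[OF u] always_eventually lim f r]) (use M' in blast)
  note iu = D_space_incr[OF s p u]
  have lim2: "AE z in gmeas s p. (\<lambda>k. incr (u k) z) \<longlonglongrightarrow> incr f z"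
    using AE_gmeas[OF lim, of s p] unfolding incr_def by eventually_elim (auto intro: tendsto_diff)
  show fL: "incr f \<in> Lp_space (gmeas s p) p"
    by (rule Lp_fatou(1)[OF iu(1) always_eventually lim2 incr_borel_gmeas[OF f]]) (use M p in auto)
  fix e :: real assume "0 < e"
  then have e: "0 < e / (2 * 2 powr p)" by simp
  obtain V where V: "V \<in> mid_hull (range (\<lambda>k. incr (u k)))" "V \<in> Lp_space (gmeas s p) p"
    "pint (gmeas s p) p (\<lambda>z. V z - incr f z) < e / (2 * 2 powr p)"
    using banach_saks_midpoints[OF iu(1) M lim2 fL p e] by blast
  have "\<exists>w\<in>D_space s p. V = incr w"
    using V(1)
  proof induction
    case (base f)
    then show ?case using u by auto
  next
    case (mid f g)
    then obtain w1 w2 where w: "w1 \<in> D_space s p" "f = incr w1" "w2 \<in> D_space s p" "g = incr w2" by auto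
    have "(\<lambda>x. (1 / 2) * (w1 x + w2 x)) \<in> D_space s p"
      by (intro D_space_cmult[OF s p] D_space_add[OF s p sp] w)
    moreover have "(\<lambda>x. (f x + g x) / 2) = incr (\<lambda>x. (1 / 2) * (w1 x + w2 x))"
      by (auto simp: w incr_def field_simps)
    ultimately show ?case by blast
  qed
  then obtain w where w: "w \<in> D_space s p" "V = incr w" by blast
  obtain g where g: "g \<in> Cc_infty" "gag_p s p (\<lambda>x. g x - w x) < e / (2 * 2 powr p)"
    using D_space_incr(2)[OF s p w(1) e] by blast
  have gL: "incr g \<in> Lp_space (gmeas s p) p" by (rule Cc_infty_incr[OF s p g(1)])
  have "gag_p s p (\<lambda>x. g x - f x) = pint (gmeas s p) p (\<lambda>z. (incr g z - V z) + (V z - incr f z))"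
    by (simp add: incr_linear)
  also have "\<dots> \<le> 2 powr p * (pint (gmeas s p) p (\<lambda>z. incr g z - V z) + pint (gmeas s p) p (\<lambda>z. V z - incr f z))"
    using gL V(2) fL p by (intro pint_add_le Lp_space_diff) auto
  also have "\<dots> < 2 powr p * (e / (2 * 2 powr p) + e / (2 * 2 powr p))"
    using g(2) V(3) unfolding incr_linear w(2) by (intro mult_strict_left_mono add_strict_mono) auto
  also have "\<dots> = e" by simp
  finally show "\<exists>g\<in>Cc_infty. gag_p s p (\<lambda>x. g x - f x) < e" using g(1) by blast
qed

text \<open>The linear map \<open>T\<close> is \<open>incr\<close> for the seminorm and the identity
  for the two weighted integrals. The number \<open>c * N v\<close> serves as the parameter
  \<open>t\<close> of \<open>pint_expansion\<close>; passing to \<open>c + 1\<close> avoids dividing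
  by 0.\<close>

lemma first_order_expansion_pint:
  assumes T: "\<And>u v. T (\<lambda>x. u x + v x) = (\<lambda>z. T u z + T v z)" "\<And>c v. T (\<lambda>x. c * v x) = (\<lambda>z. c * T v z)"
    and TL: "\<And>v. v \<in> D \<Longrightarrow> T v \<in> Lp_space M r" and u: "u \<in> D" and r: "1 < r" and c: "0 \<le> c"
    and N: "\<And>v. 0 \<le> N v" and b: "\<And>v. v \<in> D \<Longrightarrow> pint M r (T v) \<le> (c * N v) powr r"
  shows "first_order_expansion D N (\<lambda>v. pint M r (T v)) u (\<lambda>v. pder M r (T u) (T v))"
  unfolding first_order_expansion_def
proof (intro conjI allI impI)
  show "pder M r (T u) (T (\<lambda>x. c * v x)) = c * pder M r (T u) (T v)" for c v
    unfolding T(2) by (rule pder_cmult)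
  fix e :: real assume e: "0 < e"
  have c1: "0 < c + 1" using c by simp
  have "0 < e / (c + 1)" using e c1 by simp
  from pint_expansion[OF TL[OF u] r this] obtain d where d: "0 < d"
    "\<And>g t. g \<in> Lp_space M r \<Longrightarrow> 0 \<le> t \<Longrightarrow> t < d \<Longrightarrow> pint M r g \<le> t powr r \<Longrightarrow>
      \<bar>pint M r (\<lambda>x. T u x + g x) - pint M r (T u) - pder M r (T u) g\<bar> \<le> e / (c + 1) * t" by blast
  show "\<exists>d>0. \<forall>v\<in>D. N v < d \<longrightarrow> \<bar>pint M r (T (\<lambda>x. u x + v x)) - pint M r (T u) - pder M r (T u) (T v)\<bar> \<le> e * N v"
  proof (intro exI[of _ "d / (c + 1)"] conjI ballI impI)
    fix v assume v: "v \<in> D" "N v < d / (c + 1)"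
    have "c * N v \<le> (c + 1) * N v" using N by (simp add: distrib_right)
    also have "\<dots> < d" using v(2) c1 by (simp add: pos_less_divide_eq mult.commute)
    finally have t: "c * N v < d" .
    have "\<bar>pint M r (\<lambda>x. T u x + T v x) - pint M r (T u) - pder M r (T u) (T v)\<bar> \<le> e / (c + 1) * (c * N v)"
      using c N t v b by (intro d(2) TL) auto
    also have "\<dots> = e * N v * (c / (c + 1))" by simp
    also have "\<dots> \<le> e * N v * 1" using c e N by (intro mult_left_mono) auto
    finally show "\<bar>pint M r (T (\<lambda>x. u x + v x)) - pint M r (T u) - pder M r (T u) (T v)\<bar> \<le> e * N v"
      unfolding T(1) by simp
  qed (use d c1 in simp)
qed

section \<open>Existence of a solution\<close>

lemma pint_density:
  assumes [measurable]: "h \<in> borel_measurable M" "f \<in> borel_measurable M" and h: "AE x in M. 0 \<le> h x"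
  shows "pint (density M (\<lambda>x. ennreal (h x))) q f = (LINT x|M. h x * \<bar>f x\<bar> powr q)"
  unfolding pint_def by (subst integral_density) (use h in auto)

lemma Lp_space_density_bounded:
  assumes [measurable]: "K \<in> borel_measurable M" and K: "AE x in M. 0 \<le> K x" "AE x in M. \<bar>K x\<bar> \<le> c"
    and c: "0 \<le> c" and f: "f \<in> Lp_space M r"
  shows "f \<in> Lp_space (density M (\<lambda>x. ennreal (K x))) r"
    and "pint (density M (\<lambda>x. ennreal (K x))) r f \<le> c * pint M r f"
proof -
  note [measurable] = Lp_spaceD(1)[OF f]
  have fi: "integrable M (\<lambda>x. c * \<bar>f x\<bar> powr r)" using Lp_spaceD(2)[OF f] by simp
  have b: "AE x in M. norm (K x * \<bar>f x\<bar> powr r) \<le> c * \<bar>f x\<bar> powr r"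
    using K(2) by eventually_elim (simp add: abs_mult mult_right_mono)
  have Ki: "integrable M (\<lambda>x. K x * \<bar>f x\<bar> powr r)"
  proof (rule Bochner_Integration.integrable_bound[OF fi])
    show "AE x in M. norm (K x * \<bar>f x\<bar> powr r) \<le> norm (c * \<bar>f x\<bar> powr r)"
      using b by eventually_elim simp
  qed measurable
  have "integrable (density M (\<lambda>x. ennreal (K x))) (\<lambda>x. \<bar>f x\<bar> powr r)"
    by (subst integrable_density) (use K Ki in auto)
  then show "f \<in> Lp_space (density M (\<lambda>x. ennreal (K x))) r" by (simp add: Lp_space_def)
  have "pint (density M (\<lambda>x. ennreal (K x))) r f = (LINT x|M. K x * \<bar>f x\<bar> powr r)"
    by (rule pint_density) (use K in auto)
  also have "\<dots> \<le> (LINT x|M. c * \<bar>f x\<bar> powr r)"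
    by (rule integral_mono_AE[OF Ki fi]) (use b in eventually_elim, simp)
  finally show "pint (density M (\<lambda>x. ennreal (K x))) r f \<le> c * pint M r f" by (simp add: pint_def)
qed

lemma pint_eq_0_AE:
  assumes "f \<in> Lp_space M r" "pint M r f = 0"
  shows "AE x in M. f x = 0"
  using assms(2) integral_nonneg_eq_0_iff_AE[OF Lp_spaceD(2)[OF assms(1)]] by (simp add: pint_def)

lemma AE_zero_pint:
  assumes "f \<in> borel_measurable M" "AE x in M. f x = 0"
  shows "pint M r f = 0"
  using pint_cong_AE[of f M "\<lambda>x. 0" r] assms by (simp add: pint_def)

lemma AE_densityI:
  assumes "h \<in> borel_measurable M" "AE x in M. P x"
  shows "AE x in density M (\<lambda>x. ennreal (h x)). P x"
  using assms(2) by (subst AE_density) (use assms(1) in auto)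

lemma D_space_gagliardo:
  "v \<in> D_space s p \<Longrightarrow> gagliardo s p v = gag_p s p v powr (1 / p)"
  by (rule gagliardo_eq_pint[OF D_space_Lp(2)])

abbreviation weighted :: "(real^'n \<Rightarrow> real) \<Rightarrow> (real^'n) measure" where
  "weighted h \<equiv> density lebesgue (\<lambda>x. ennreal (h x))"

text \<open>Compactness implies boundedness: otherwise functions normalised to seminorm 1 would have
  \<open>pint (weighted h) q\<close> above every \<open>k\<close>, while a subsequence converging in
  \<open>L^q\<close> keeps it bounded. Scaling back produces the exponent
  \<open>q / p\<close>.\<close>

lemma immersion_bound:
  fixes h :: "real^'n \<Rightarrow> real"
  assumes s: "0 < s" "s < 1" and p: "1 < p" and q: "0 < q" and sp: "s * p < real CARD('n)"
    and h: "h \<in> borel_measurable lebesgue"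
    and imm: "compact_immersion (D_space s p) (gagliardo s p) (weighted h) q"
  obtains c where "0 \<le> c"
    "\<And>u. u \<in> D_space s p \<Longrightarrow> pint (weighted h) q u \<le> c * gag_p s p u powr (q / p)"
proof -
  define M where "M = weighted h"
  have VL: "u \<in> Lp_space M q" if "u \<in> D_space s p" for u
    using imm that unfolding compact_immersion_def M_def by blast
  obtain S where S: "0 \<le> S"
    "\<And>v :: real^'n \<Rightarrow> real. v \<in> Lp_space lebesgue (crit_exp TYPE('n) s p) \<Longrightarrow> incr v \<in> Lp_space (gmeas s p) p \<Longrightarrow>
       pint lebesgue (crit_exp TYPE('n) s p) v \<le> S * gag_p s p v powr (crit_exp TYPE('n) s p / p)"
    using fractional_sobolev[OF s(1) p sp] by blast
  have "\<exists>k::nat. \<forall>u\<in>D_space s p. pint M q u \<le> real k * gag_p s p u powr (q / p)"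
  proof (rule ccontr)
    assume "\<not> ?thesis"
    then obtain u where u: "\<And>k::nat. u k \<in> D_space s p" "\<And>k::nat. real k * gag_p s p (u k) powr (q / p) < pint M q (u k)"
      unfolding not_ex not_le Bex_def not_all by (metis not_le)
    define A where "A k = gag_p s p (u k)" for k
    \<comment> \<open>Normalisation needs a positive seminorm. If it vanished, Sobolev's inequality
      would make \<open>u k\<close> zero almost everywhere, against the strict inequality in
      \<open>u(2)\<close>.\<close>
    have A: "0 < A k" for k
    proof (rule ccontr)
      assume "\<not> 0 < A k"
      then have "A k = 0" using pint_nonneg[of "gmeas s p" p "incr (u k)"] by (simp add: A_def)
      then have "pint lebesgue (crit_exp TYPE('n) s p) (u k) \<le> 0"
        using S(2)[OF D_space_Lp(1)[OF u(1)] D_space_incr(1)[OF s p u(1)], of k] by (simp add: A_def)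
      then have "AE x in lebesgue. u k x = 0"
        by (intro pint_eq_0_AE[OF D_space_Lp(1)[OF u(1)]] antisym pint_nonneg)
      then have "AE x in M. u k x = 0" unfolding M_def by (rule AE_densityI[OF h])
      then have "pint M q (u k) = 0" by (intro AE_zero_pint Lp_spaceD(1)[OF VL[OF u(1)]])
      then show False using u(2)[of k] by (smt (verit) mult_nonneg_nonneg of_nat_0_le_iff powr_ge_zero)
    qed
    define v where "v k = (\<lambda>x. A k powr (- 1 / p) * u k x)" for k
    have vD: "v k \<in> D_space s p" for k unfolding v_def by (intro D_space_cmult[OF s p] u)
    have "gag_p s p (v k) = 1" for k
    proof -
      have "gag_p s p (v k) = \<bar>A k powr (- 1 / p)\<bar> powr p * A k"
        unfolding v_def incr_linear(3) A_def by (rule pint_cmult)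
      also have "\<dots> = A k powr (- 1) * A k" using p by (simp add: powr_powr)
      also have "\<dots> = 1" using A[of k] by (simp add: powr_minus)
      finally show ?thesis .
    qed
    then have "\<exists>C. \<forall>k. gagliardo s p (v k) \<le> C" by (intro exI[of _ 1]) (simp add: D_space_gagliardo[OF vD])
    then obtain \<rho> w where \<rho>: "strict_mono \<rho>" "w \<in> Lp_space M q"
      "(\<lambda>k. LINT x|M. \<bar>v (\<rho> k) x - w x\<bar> powr q) \<longlonglongrightarrow> 0"
      using imm vD unfolding compact_immersion_def M_def by blast
    have large: "real k < pint M q (v k)" for k
    proof -
      have "pint M q (v k) = \<bar>A k powr (- 1 / p)\<bar> powr q * pint M q (u k)"
        unfolding v_def by (rule pint_cmult)
      also have "\<bar>A k powr (- 1 / p)\<bar> powr q = A k powr (- (q / p))" by (simp add: powr_powr)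
      finally have "pint M q (v k) = A k powr (- (q / p)) * pint M q (u k)" .
      moreover have "A k powr (- (q / p)) * (real k * A k powr (q / p)) < A k powr (- (q / p)) * pint M q (u k)"
        using u(2)[of k] A[of k] unfolding A_def by (intro mult_strict_left_mono) auto
      moreover have "A k powr (- (q / p)) * (real k * A k powr (q / p)) = real k"
        using A[of k] by (simp add: powr_minus)
      ultimately show ?thesis by simp
    qed
    define P where "P = 2 powr q * (1 + pint M q w)"
    have "\<forall>\<^sub>F k in sequentially. pint M q (\<lambda>x. v (\<rho> k) x - w x) < 1"
      using order_tendstoD(2)[OF \<rho>(3), of 1] by (simp add: pint_def)
    then obtain N where N: "\<And>k. k \<ge> N \<Longrightarrow> pint M q (\<lambda>x. v (\<rho> k) x - w x) < 1"
      by (auto simp: eventually_sequentially)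
    obtain k :: nat where k: "N \<le> k" "P \<le> real k"
    proof -
      obtain k0 :: nat where "P \<le> real k0" using real_arch_simple by blast
      then show ?thesis using that[of "max N k0"] by auto
    qed
    have "real k \<le> real (\<rho> k)" using seq_suble[OF \<rho>(1), of k] by simp
    also have "\<dots> < pint M q (v (\<rho> k))" by (rule large)
    also have "\<dots> = pint M q (\<lambda>x. (v (\<rho> k) x - w x) + w x)" by simp
    also have "\<dots> \<le> 2 powr q * (pint M q (\<lambda>x. v (\<rho> k) x - w x) + pint M q w)"
      using \<rho>(2) VL[OF vD] q by (intro pint_add_le Lp_space_diff) auto
    also have "\<dots> \<le> P" unfolding P_def using N[OF k(1)] by (intro mult_left_mono) auto
    finally show False using k(2) by simp
  qed
  then show ?thesis using that unfolding M_def by (metis of_nat_0_le_iff)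
qed

text \<open>The immersion yields a limit \<open>w\<close> determined only for the measure h dx; the
  Gagliardo bound yields a Lebesgue almost everywhere limit \<open>f\<close> in
  \<open>D_space\<close>. The two are shown to agree for the weighted measure, so \<open>f\<close>
  serves both purposes.\<close>

lemma D_space_compactness:
  fixes u :: "nat \<Rightarrow> real^'n \<Rightarrow> real" and h :: "real^'n \<Rightarrow> real"
  assumes s: "0 < s" "s < 1" and p: "1 < p" and q: "0 < q" and sp: "s * p < real CARD('n)"
    and h: "h \<in> borel_measurable lebesgue"
    and imm: "compact_immersion (D_space s p) (gagliardo s p) (weighted h) q"
    and u: "\<And>k. u k \<in> D_space s p" and M: "\<And>k. gag_p s p (u k) \<le> M"
  obtains \<rho> f where "strict_mono \<rho>" "f \<in> D_space s p" "AE x in lebesgue. (\<lambda>k. u (\<rho> k) x) \<longlonglongrightarrow> f x"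
    "(\<lambda>k. pint (weighted h) q (\<lambda>x. u (\<rho> k) x - f x)) \<longlonglongrightarrow> 0"
proof -
  define r where "r = crit_exp TYPE('n) s p"
  define H where "H = weighted h"
  have r: "p < r"
  proof -
    have "p * (real CARD('n) - s * p) < real CARD('n) * p" using s p by (simp add: algebra_simps)
    then show ?thesis using sp by (simp add: r_def crit_exp_def pos_less_divide_eq)
  qed
  have VL: "u \<in> Lp_space H q" if "u \<in> D_space s p" for u
    using imm that unfolding compact_immersion_def H_def by blast
  obtain S where S: "0 \<le> S"
    "\<And>v :: real^'n \<Rightarrow> real. v \<in> Lp_space lebesgue r \<Longrightarrow> incr v \<in> Lp_space (gmeas s p) p \<Longrightarrow>
       pint lebesgue r v \<le> S * gag_p s p v powr (r / p)"
    using fractional_sobolev[OF s(1) p sp] unfolding r_def by blast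
  note uL = D_space_Lp(1)[OF u, folded r_def] and ui = D_space_incr(1)[OF s p u]
  have M': "pint lebesgue r (u k) \<le> S * M powr (r / p)" for k
  proof -
    have "gag_p s p (u k) powr (r / p) \<le> M powr (r / p)"
      using M pint_nonneg r p by (intro powr_mono2) auto
    then show ?thesis using S(2)[OF uL ui, of k] mult_left_mono[OF _ S(1)] order_trans by blast
  qed
  have "gagliardo s p (u k) \<le> M powr (1 / p)" for k
    unfolding D_space_gagliardo[OF u] using M pint_nonneg p by (intro powr_mono2) auto
  then obtain \<rho>1 w where w: "strict_mono \<rho>1" "w \<in> Lp_space H q"
    "(\<lambda>k. LINT x|H. \<bar>u (\<rho>1 k) x - w x\<bar> powr q) \<longlonglongrightarrow> 0"
    using imm u unfolding compact_immersion_def H_def by blast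
  obtain \<rho>2 f where f: "strict_mono \<rho>2" "f \<in> borel_measurable lebesgue"
    "AE x in lebesgue. (\<lambda>k. u (\<rho>1 (\<rho>2 k)) x) \<longlonglongrightarrow> f x"
    using gagliardo_AE_convergent_subseq[of "\<lambda>k. u (\<rho>1 k)" r p s M "S * M powr (r / p)"] uL ui M M' r p s by auto
  define y where "y k = u (\<rho>1 (\<rho>2 k))" for k
  have yD: "y k \<in> D_space s p" for k by (simp add: y_def u)
  have yf: "AE x in lebesgue. (\<lambda>k. y k x) \<longlonglongrightarrow> f x" using f(3) by (simp add: y_def)
  have fD: "f \<in> D_space s p"
    by (rule D_space_AE_closed[OF s p sp yD, where M = M and M' = "S * M powr (r / p)"])
      (use M M' f(2) yf in \<open>auto simp: y_def r_def\<close>)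
  have yw: "(\<lambda>k. LINT x|H. norm (\<bar>y k x - w x\<bar> powr q)) \<longlonglongrightarrow> 0"
    using LIMSEQ_subseq_LIMSEQ[OF w(3) f(1)] by (simp add: y_def o_def)
  have "integrable H (\<lambda>x. \<bar>y k x - w x\<bar> powr q)" for k
    using Lp_spaceD(2)[OF Lp_space_diff[OF VL[OF yD] w(2)]] q by simp
  then obtain \<tau> where \<tau>: "strict_mono \<tau>" "AE x in H. (\<lambda>k. \<bar>y (\<tau> k) x - w x\<bar> powr q) \<longlonglongrightarrow> 0"
    using tendsto_L1_AE_subseq[of H "\<lambda>k x. \<bar>y k x - w x\<bar> powr q", OF _ yw] by blast
  have "AE x in H. (\<lambda>k. y k x) \<longlonglongrightarrow> f x" unfolding H_def by (rule AE_densityI[OF h yf])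
  \<comment> \<open>A further subsequence turns convergence of the integrals to 0 into convergence
    almost everywhere; it is used only for this identification.\<close>
  with \<tau>(2) have fw: "AE x in H. f x = w x"
  proof eventually_elim
    case (elim x)
    have "(\<lambda>k. y (\<tau> k) x) \<longlonglongrightarrow> f x" using LIMSEQ_subseq_LIMSEQ[OF elim(2) \<tau>(1)] by (simp add: o_def)
    then have "(\<lambda>k. \<bar>y (\<tau> k) x - w x\<bar> powr q) \<longlonglongrightarrow> \<bar>f x - w x\<bar> powr q"
      using q by (intro tendsto_powr' tendsto_intros) auto
    from LIMSEQ_unique[OF this elim(1)] show ?case by simp
  qed
  have eq: "pint H q (\<lambda>x. y k x - f x) = pint H q (\<lambda>x. y k x - w x)" for k
    using Lp_spaceD(1)[OF VL[OF yD]] Lp_spaceD(1)[OF VL[OF fD]] Lp_spaceD(1)[OF w(2)]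
    by (intro pint_cong_AE borel_measurable_diff) (use fw in \<open>auto elim: eventually_mono\<close>)
  have "(\<lambda>k. pint H q (\<lambda>x. y k x - f x)) \<longlonglongrightarrow> 0"
    unfolding eq using yw by (simp add: pint_def)
  moreover have "strict_mono (\<lambda>k. \<rho>1 (\<rho>2 k))" using strict_mono_o[OF w(1) f(1)] by (simp add: o_def)
  ultimately show ?thesis using that[of "\<lambda>k. \<rho>1 (\<rho>2 k)" f] fD f(3) unfolding y_def H_def by blast
qed

text \<open>A bump function positive on a ball has zero weighted integral only if \<open>h\<close>
  vanishes almost everywhere on that ball; countably many balls exhaust the space.\<close>

lemma ex_D_space_weighted_pos:
  fixes h :: "real^'n \<Rightarrow> real"
  assumes s: "0 < s" "s < 1" and p: "1 < p" and sp: "s * p < real CARD('n)"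
    and h: "h \<in> borel_measurable lebesgue" "AE x in lebesgue. 0 \<le> h x" "\<not> (AE x in lebesgue. h x = 0)"
    and DL: "D_space s p \<subseteq> Lp_space (weighted h) q"
  shows "\<exists>u\<in>D_space s p. 0 < pint (weighted h) q u"
proof (rule ccontr)
  assume neg: "\<not> ?thesis"
  have "AE x in lebesgue. norm x < real (Suc k) \<longrightarrow> h x = 0" for k
  proof -
    obtain f :: "real^'n \<Rightarrow> real" where f: "f \<in> Cc_infty" "\<And>x. norm x < real (Suc k) \<Longrightarrow> 0 < f x"
      using bump_Cc_infty[of "real (Suc k)"] by auto
    have fD: "f \<in> D_space s p" by (rule Cc_infty_D_space[OF s p sp f(1)])
    then have "pint (weighted h) q f = 0"
      using neg pint_nonneg by (metis linorder_not_less order_antisym_conv)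
    then have "AE x in weighted h. f x = 0"
      using DL fD by (intro pint_eq_0_AE) auto
    then have "AE x in lebesgue. 0 < ennreal (h x) \<longrightarrow> f x = 0"
      by (subst (asm) AE_density) (use h(1) in auto)
    with h(2) show ?thesis
    proof eventually_elim
      case (elim x)
      then show ?case using f(2)[of x] by (auto simp: ennreal_0 order_le_less)
    qed
  qed
  then have "AE x in lebesgue. \<forall>k. norm x < real (Suc k) \<longrightarrow> h x = 0" by (subst AE_all_countable) blast
  then have "AE x in lebesgue. h x = 0"
  proof eventually_elim
    case (elim x)
    obtain k where "norm x < real k" using reals_Archimedean2 by blast
    then show ?case using elim by (intro elim[rule_format, of k]) simp
  qed
  with h(3) show False by blast
qed

text \<open>A weight that is not almost everywhere 0 supplies a function with positive weighted
  integral; otherwise the Nehari set would be empty. As functions stand for classes modulo null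
  sets, the limit of \<open>K\<close> at infinity is required of some representative
  \<open>K'\<close>.\<close>

theorem theorem3p1:
  fixes s p q :: real and h K :: "real^'n \<Rightarrow> real"
  assumes "0 < s" and "s < 1" and "1 < p" and "p < q"
    and "s * p < real CARD('n)"
    and "q < crit_exp TYPE('n) s p"
    and "h \<in> L1_loc" and "AE x in lebesgue. 0 \<le> h x"
    and "\<not> (AE x in lebesgue. h x = 0)"
    and "compact_immersion (D_space s p) (gagliardo s p)
           (density lebesgue (\<lambda>x. ennreal (h x))) q"
    and "K \<in> Linf_space lebesgue" and "AE x in lebesgue. 0 \<le> K x"
    and "\<exists>K' Kinf. (AE x in lebesgue. K' x = K x) \<and> (K' \<longlongrightarrow> Kinf) at_infinity"
  shows "\<exists>lam0>0. \<forall>lam>lam0. \<exists>u. weak_solution s p q h K lam u \<and> \<not> (AE x in lebesgue. u x = 0)"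
proof -
  note s = assms(1,2) and p = assms(3) and pq = assms(4) and sp = assms(5) and imm = assms(10)
  define r where "r = crit_exp TYPE('n) s p"
  have qr: "q < r" using assms(6) by (simp add: r_def)
  have q0: "0 < q" and r1: "1 < r" and q1: "1 < q" using p pq qr by auto
  have h: "h \<in> borel_measurable lebesgue" using assms(7) by (simp add: L1_loc_def)
  obtain c0 where K: "K \<in> borel_measurable lebesgue" "AE x in lebesgue. \<bar>K x\<bar> \<le> c0"
    using assms(11) unfolding Linf_space_def by blast
  define c where "c = max c0 0"
  have c: "0 \<le> c" and Kc: "AE x in lebesgue. \<bar>K x\<bar> \<le> c"
    using K(2) by (auto simp: c_def elim: eventually_mono)
  define H where "H = weighted h"
  define W where "W = weighted K"
  have HL: "u \<in> Lp_space H q" if "u \<in> D_space s p" for u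
    using imm that unfolding compact_immersion_def H_def by blast
  have rL: "u \<in> Lp_space lebesgue r" if "u \<in> D_space s p" for u :: "real^'n \<Rightarrow> real"
    using D_space_Lp(1)[OF that] by (simp add: r_def)
  have WL: "u \<in> Lp_space W r" "pint W r u \<le> c * pint lebesgue r u" if "u \<in> D_space s p" for u
    unfolding W_def by (rule Lp_space_density_bounded[OF K(1) assms(12) Kc c rL[OF that]])+
  note iL = D_space_incr(1)[OF s p]
  obtain cB where cB: "0 \<le> cB" "\<And>u. u \<in> D_space s p \<Longrightarrow> pint H q u \<le> cB * gag_p s p u powr (q / p)"
    using immersion_bound[OF s p q0 sp h imm] unfolding H_def by blast
  obtain S where S: "0 \<le> S"
    "\<And>v :: real^'n \<Rightarrow> real. v \<in> Lp_space lebesgue r \<Longrightarrow> incr v \<in> Lp_space (gmeas s p) p \<Longrightarrow>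
       pint lebesgue r v \<le> S * gag_p s p v powr (r / p)"
    using fractional_sobolev[OF s(1) p sp] unfolding r_def by blast
  have cC: "0 \<le> c * S" "pint W r u \<le> c * S * gag_p s p u powr (r / p)" if "u \<in> D_space s p" for u
  proof -
    show "0 \<le> c * S" using c S by simp
    have "pint W r u \<le> c * pint lebesgue r u" by (rule WL(2)[OF that])
    also have "\<dots> \<le> c * (S * gag_p s p u powr (r / p))"
      using c S(2)[OF rL[OF that] iL[OF that]] by (intro mult_left_mono)
    finally show "pint W r u \<le> c * S * gag_p s p u powr (r / p)" by (simp add: mult.assoc)
  qed
  \<comment> \<open>Rewrites the homogeneous bounds in the form \<open>(c * N v) powr r\<close>
    expected by \<open>first_order_expansion_pint\<close>.\<close>
  have root: "cN * a powr (\<rho> / p) = (cN powr (1 / \<rho>) * a powr (1 / p)) powr \<rho>"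
    if "0 \<le> cN" "0 < \<rho>" for cN a \<rho> :: real
    using that p by (simp add: powr_mult powr_powr)
  interpret N: nehari "D_space s p :: (real^'n \<Rightarrow> real) set" "gag_p s p" "pint H q" "pint W r" p q r cB "c * S"
  proof
    show "0 < p" "p < q" "q < r" using p pq qr by auto
    show "(\<lambda>x. u x + v x) \<in> D_space s p" if "u \<in> D_space s p" "v \<in> D_space s p" for u v :: "real^'n \<Rightarrow> real"
      by (rule D_space_add[OF s p sp that])
    show "(\<lambda>x. a * u x) \<in> D_space s p" if "u \<in> D_space s p" for a and u :: "real^'n \<Rightarrow> real"
      by (rule D_space_cmult[OF s p that])
    show "0 \<le> gag_p s p u" "0 \<le> pint H q u" "0 \<le> pint W r u" for u by (rule pint_nonneg)+
    show "gag_p s p (\<lambda>x. a * u x) = \<bar>a\<bar> powr p * gag_p s p u" for a and u :: "real^'n \<Rightarrow> real"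
      unfolding incr_linear by (rule pint_cmult)
    show "pint H q (\<lambda>x. a * u x) = \<bar>a\<bar> powr q * pint H q u" "pint W r (\<lambda>x. a * u x) = \<bar>a\<bar> powr r * pint W r u"
      for a u by (rule pint_cmult)+
    show "0 \<le> cB" "0 \<le> c * S" using cB c S by auto
    show "pint H q u \<le> cB * gag_p s p u powr (q / p)" "pint W r u \<le> c * S * gag_p s p u powr (r / p)"
      if "u \<in> D_space s p" for u using cB(2) cC(2) that by auto
    show "\<exists>L. first_order_expansion (D_space s p) (\<lambda>v. gag_p s p v powr (1 / p)) (gag_p s p) u L"
      if "u \<in> D_space s p" for u :: "real^'n \<Rightarrow> real"
    proof -
      have "first_order_expansion (D_space s p) (\<lambda>v. gag_p s p v powr (1 / p)) (gag_p s p) u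
        (\<lambda>v. pder (gmeas s p) p (incr u) (incr v))"
        using p iL that pint_nonneg
        by (intro first_order_expansion_pint[where c = 1] incr_linear) (auto simp: powr_powr)
      then show ?thesis by blast
    qed
    show "\<exists>L. first_order_expansion (D_space s p) (\<lambda>v. gag_p s p v powr (1 / p)) (pint H q) u L"
      if "u \<in> D_space s p" for u :: "real^'n \<Rightarrow> real"
    proof -
      have "first_order_expansion (D_space s p) (\<lambda>v. gag_p s p v powr (1 / p)) (\<lambda>v. pint H q v) u
        (\<lambda>v. pder H q u v)"
        by (rule first_order_expansion_pint[where c = "cB powr (1 / q)" and T = "\<lambda>v. v"])
          (use HL that q1 cB(2) root[OF cB(1) q0] in auto)
      then show ?thesis by blast
    qed
    show "\<exists>L. first_order_expansion (D_space s p) (\<lambda>v. gag_p s p v powr (1 / p)) (pint W r) u L"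
      if "u \<in> D_space s p" for u :: "real^'n \<Rightarrow> real"
    proof -
      have "first_order_expansion (D_space s p) (\<lambda>v. gag_p s p v powr (1 / p)) (\<lambda>v. pint W r v) u
        (\<lambda>v. pder W r u v)"
        by (rule first_order_expansion_pint[where c = "(c * S) powr (1 / r)" and T = "\<lambda>v. v"])
          (use WL(1) that r1 cC root[of "c * S" r] in auto)
      then show ?thesis by blast
    qed
    show "\<exists>\<rho> w. strict_mono \<rho> \<and> w \<in> D_space s p \<and>
        (\<lambda>k. gag_p s p (u (\<rho> k)) - gag_p s p (\<lambda>x. u (\<rho> k) x - w x)) \<longlonglongrightarrow> gag_p s p w \<and>
        (\<lambda>k. pint W r (u (\<rho> k)) - pint W r (\<lambda>x. u (\<rho> k) x - w x)) \<longlonglongrightarrow> pint W r w \<and>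
        (\<lambda>k. pint H q (u (\<rho> k))) \<longlonglongrightarrow> pint H q w"
      if u: "\<And>k. u k \<in> D_space s p" and M: "\<And>k. gag_p s p (u k) \<le> M" for u :: "nat \<Rightarrow> real^'n \<Rightarrow> real" and M
    proof -
      obtain \<rho> f where f: "strict_mono \<rho>" "f \<in> D_space s p" "AE x in lebesgue. (\<lambda>k. u (\<rho> k) x) \<longlonglongrightarrow> f x"
        "(\<lambda>k. pint H q (\<lambda>x. u (\<rho> k) x - f x)) \<longlonglongrightarrow> 0"
        by (rule D_space_compactness[OF s p q0 sp h imm u M, folded H_def]) (rule that)
      have mono: "gag_p s p (u k) powr t \<le> M powr t" if "0 < t" for k t
        using M pint_nonneg that by (intro powr_mono2) auto
      have bB: "pint H q (u k) \<le> cB * M powr (q / p)" for k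
      proof -
        have "cB * gag_p s p (u k) powr (q / p) \<le> cB * M powr (q / p)"
          using cB(1) q0 p by (intro mult_left_mono mono) auto
        then show ?thesis using cB(2)[OF u, of k] by linarith
      qed
      have bC: "pint W r (u k) \<le> c * S * M powr (r / p)" for k
      proof -
        have "c * S * gag_p s p (u k) powr (r / p) \<le> c * S * M powr (r / p)"
          using c S(1) r1 p by (intro mult_left_mono mono) auto
        then show ?thesis using cC(2)[OF u, of k] by linarith
      qed
      have A: "(\<lambda>k. gag_p s p (u (\<rho> k)) - gag_p s p (\<lambda>x. u (\<rho> k) x - f x)) \<longlonglongrightarrow> gag_p s p f"
        unfolding incr_linear
      proof (rule brezis_lieb[OF iL[OF u] M _ iL[OF f(2)] p])
        show "AE z in gmeas s p. (\<lambda>k. incr (u (\<rho> k)) z) \<longlonglongrightarrow> incr f z"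
          using AE_gmeas[OF f(3), of s p] unfolding incr_def by eventually_elim (auto intro: tendsto_diff)
      qed
      \<comment> \<open>\<open>K\<close> enters only through the measure, so bounded integrals and
        almost everywhere convergence suffice for the splitting at the critical exponent.\<close>
      have C: "(\<lambda>k. pint W r (u (\<rho> k)) - pint W r (\<lambda>x. u (\<rho> k) x - f x)) \<longlonglongrightarrow> pint W r f"
        by (rule brezis_lieb[OF WL(1)[OF u] bC _ WL(1)[OF f(2)] r1]) (unfold W_def, rule AE_densityI[OF K(1) f(3)])
      have "(\<lambda>k. pint H q (u (\<rho> k)) - pint H q (\<lambda>x. u (\<rho> k) x - f x)) \<longlonglongrightarrow> pint H q f"
        by (rule brezis_lieb[OF HL[OF u] bB _ HL[OF f(2)] q1]) (unfold H_def, rule AE_densityI[OF h f(3)])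
      from tendsto_add[OF this f(4)] have B: "(\<lambda>k. pint H q (u (\<rho> k))) \<longlonglongrightarrow> pint H q f" by simp
      show ?thesis using f(1,2) A B C by blast
    qed
    show "\<exists>u\<in>D_space s p. 0 < pint H q u"
      using ex_D_space_weighted_pos[OF s p sp h assms(8,9)] HL unfolding H_def by blast
  qed
  have energy: "energy s p q h K lam u = N.F lam u" if u: "u \<in> D_space s p" for lam u
  proof -
    have "gagliardo s p u powr p = gag_p s p u"
      using p pint_nonneg[of "gmeas s p" p "incr u"] by (simp add: D_space_gagliardo[OF u] powr_powr)
    moreover have "(LINT x|lebesgue. h x * \<bar>u x\<bar> powr q) = pint H q u"
      unfolding H_def by (rule pint_density[OF h D_space_Lp(2)[OF u] assms(8), symmetric])
    moreover have "(LINT x|lebesgue. K x * \<bar>u x\<bar> powr r) = pint W r u"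
      unfolding W_def by (rule pint_density[OF K(1) D_space_Lp(2)[OF u] assms(12), symmetric])
    ultimately show ?thesis unfolding energy_def r_def[symmetric] N.F_def by simp
  qed
  obtain lam0 where lam0: "0 < lam0" "\<And>lam. lam0 < lam \<Longrightarrow> \<exists>u\<in>D_space s p. 0 < pint H q u \<and>
     (\<forall>e>0. \<exists>d>0. \<forall>v\<in>D_space s p. gag_p s p v powr (1 / p) < d \<longrightarrow>
        \<bar>N.F lam (\<lambda>x. u x + v x) - N.F lam u\<bar> \<le> e * gag_p s p v powr (1 / p))"
    using N.ex_critical_point by blast
  show ?thesis
  proof (intro exI[of _ lam0] conjI allI impI lam0(1))
    fix lam assume "lam0 < lam"
    then obtain u where u: "u \<in> D_space s p" "0 < pint H q u"
      "\<forall>e>0. \<exists>d>0. \<forall>v\<in>D_space s p. gag_p s p v powr (1 / p) < d \<longrightarrow>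
        \<bar>N.F lam (\<lambda>x. u x + v x) - N.F lam u\<bar> \<le> e * gag_p s p v powr (1 / p)"
      using lam0(2) by blast
    have "weak_solution s p q h K lam u"
      unfolding weak_solution_def critical_point_def
      using u(1,3) by (simp add: energy D_space_gagliardo D_space_add[OF s p sp u(1)] cong: ball_cong)
    moreover have "\<not> (AE x in lebesgue. u x = 0)"
    proof
      assume "AE x in lebesgue. u x = 0"
      then have "AE x in H. u x = 0" unfolding H_def by (rule AE_densityI[OF h])
      then have "pint H q u = 0" by (intro AE_zero_pint Lp_spaceD(1)[OF HL[OF u(1)]])
      with u(2) show False by simp
    qed
    ultimately show "\<exists>u. weak_solution s p q h K lam u \<and> \<not> (AE x in lebesgue. u x = 0)" by blast
  qed
qed

end
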